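(* Let $f$ be a graph parameter. Then the following are equivalent. (1) There is a randomly weighted graph $H$ such that $f(F)=\hom(F,H)$ for all multigraphs $F$. (2) $f$ is reflection positive, multiplicative and $\operatorname{rk}(M(f,2))<\infty$. (3) $f$ is weakly reflection positive, multiplicative and $\operatorname{rk}(M(f,2))<\infty$.
   Context: A multigraph is a finite undirected graph with at least one node, in which multiple edges are allowed and loops are excluded; for distinct nodes $i,j$ of a multigraph $F$, $F_{i,j}$ denotes the number of edges joining $i$ and $j$. A graph parameter is a real-valued function on multigraphs that is invariant under isomorphism. It is multiplicative if $f(F_1\cup F_2)=f(F_1)f(F_2)$ for all multigraphs $F_1,F_2$, where $F_1\cup F_2$ is the disjoint union. For $n\ge 1$, let $\mathcal{G}_n$ be the set of (isomorphism types of) multigraphs in which $n$ different nodes are labeled $1,\dots,n$, with any number of further unlabeled nodes, and let $\mathcal{F}_n\subset\mathcal{G}_n$ be the set of those with node set exactly $\{1,\dots,n\}$ (no unlabeled nodes). The product $F_1F_2$ of $F_1,F_2\in\mathcal{G}_n$ is obtained by taking their disjoint union and identifying nodes with identical labels, keeping all edges with multiplicity. Let $\mathcal{Q}_n$ (resp. $\mathcal{P}_n$) be the real vector space of formal finite linear combinations of elements of $\mathcal{G}_n$ (resp. $\mathcal{F}_n$), with the product extended bilinearly, and extend $f$ linearly to $\mathcal{Q}_n$ (forgetting labels). The parameter $f$ is reflection positive (resp. weakly reflection positive) if $f(p^2)\ge 0$ for every $n$ and every $p\in\mathcal{Q}_n$ (resp. $p\in\mathcal{P}_n$). The second connection matrix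 $M(f,2)$ is the infinite matrix with rows and columns indexed by $\mathcal{G}_2$ whose entry in row $F_1$ and column $F_2$ is $f(F_1F_2)$; $\operatorname{rk}$ denotes its rank. A randomly weighted graph $H$ is a finite node set $V(H)$ with nonnegative real nodeweights $\alpha_i$ and with edges $ij$ ($i,j\in V(H)$, $i=j$ allowed) weighted by independent real random variables $B_{i,j}=B_{j,i}$, each taking only finitely many values. The empty graph $H$ is allowed, its homomorphism function being identically zero. For a multigraph $F$, $$\hom(F,H)=\sum_{\varphi:V(F)\to V(H)}\ \prod_{i\in V(F)}\alpha_{\varphi(i)}\prod_{\{i,j\}\subseteq V(F),\,i\ne j}\mathsf{E}\bigl(B_{\varphi(i),\varphi(j)}^{F_{i,j}}\bigr)$$ (with $\mathsf{E}(B^0)=1$). *)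

theory Defs
  imports
    "HOL-Probability.Probability"
    "HOL-Library.Poly_Mapping"
    "HOL-Library.Extended_Nat"
    "HOL-Library.Infinite_Typeclass"
begin

section \<open>Multigraphs and graph parameters\<close>

text \<open>
  Every finite multigraph is isomorphic to one whose nodes are natural numbers. Edges form a
  multiset of two-element node sets; the number of edges joining distinct \<open>i\<close> and \<open>j\<close>
  is \<open>count (edges F) {i, j}\<close>.
\<close>

record mgraph =
  nodes :: "nat set"
  edges :: "nat set multiset"

definition multigraph :: "mgraph \<Rightarrow> bool" where
  "multigraph F \<longleftrightarrow> finite (nodes F) \<and> nodes F \<noteq> {} \<and>
     (\<forall>e \<in># edges F. e \<subseteq> nodes F \<and> card e = 2)"

text \<open>
  In an \<open>n\<close>-labeled multigraph the node labeled \<open>i\<close> is the number \<open>i\<close> itself, for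
  \<open>1 \<le> i \<le> n\<close>; all nodes outside \<open>{1..n}\<close> (including \<open>0\<close>) are unlabeled. Isomorphisms
  preserve labels. For \<open>n = 0\<close> this is isomorphism of multigraphs.
\<close>

definition labeled :: "nat \<Rightarrow> mgraph \<Rightarrow> bool" where
  "labeled n F \<longleftrightarrow> multigraph F \<and> {1..n} \<subseteq> nodes F"

definition labeled_iso :: "nat \<Rightarrow> mgraph \<Rightarrow> mgraph \<Rightarrow> bool" where
  "labeled_iso n F G \<longleftrightarrow>
     (\<exists>h. bij_betw h (nodes F) (nodes G) \<and> (\<forall>i\<in>{1..n}. h i = i) \<and>
          image_mset (image h) (edges F) = edges G)"

definition graph_parameter :: "(mgraph \<Rightarrow> real) \<Rightarrow> bool" where
  "graph_parameter f \<longleftrightarrow>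
     (\<forall>F G. multigraph F \<and> multigraph G \<and> labeled_iso 0 F G \<longrightarrow> f F = f G)"

definition graph_union :: "mgraph \<Rightarrow> mgraph \<Rightarrow> mgraph" where
  "graph_union F G = \<lparr>nodes = nodes F \<union> nodes G, edges = edges F + edges G\<rparr>"

text \<open>
  The disjoint union of two multigraphs is determined up to isomorphism, so for a graph parameter
  it suffices to consider representatives with disjoint node sets.
\<close>

definition multiplicative :: "(mgraph \<Rightarrow> real) \<Rightarrow> bool" where
  "multiplicative f \<longleftrightarrow>
     (\<forall>F G. multigraph F \<and> multigraph G \<and> nodes F \<inter> nodes G = {} \<longrightarrow>
            f (graph_union F G) = f F * f G)"

section \<open>Isomorphism types of labeled multigraphs and quantum graphs\<close>

definition iso_type :: "nat \<Rightarrow> mgraph \<Rightarrow> mgraph set" where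
  "iso_type n F = {G. labeled n G \<and> labeled_iso n F G}"

definition labeled_types :: "nat \<Rightarrow> mgraph set set" where
  "labeled_types n = {iso_type n F | F. labeled n F}"

definition fully_labeled_types :: "nat \<Rightarrow> mgraph set set" where
  "fully_labeled_types n = {iso_type n F | F. labeled n F \<and> nodes F = {1..n}}"

text \<open>
  The product of two types: take representatives that have exactly the labeled nodes in common.
  The type of their union does not depend on the representatives.
\<close>

definition glue :: "nat \<Rightarrow> mgraph set \<Rightarrow> mgraph set \<Rightarrow> mgraph set" where
  "glue n A B =
     (\<Union>{iso_type n (graph_union F G) | F G. F \<in> A \<and> G \<in> B \<and> nodes F \<inter> nodes G = {1..n}})"

text \<open>The value of a graph parameter on a type of labeled multigraphs, forgetting the labels.\<close>

definition type_value :: "(mgraph \<Rightarrow> real) \<Rightarrow> mgraph set \<Rightarrow> real" where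
  "type_value f A = the_elem (f ` A)"

text \<open>
  A formal linear combination of types is a finitely supported function; it lies in the space
  spanned by a set \<open>X\<close> of types if its support \<open>keys p\<close> is contained in \<open>X\<close>.
\<close>

type_synonym quantum_graph = "mgraph set \<Rightarrow>\<^sub>0 real"

definition quantum_mult :: "nat \<Rightarrow> quantum_graph \<Rightarrow> quantum_graph \<Rightarrow> quantum_graph" where
  "quantum_mult n p q =
     (\<Sum>A\<in>Poly_Mapping.keys p. \<Sum>B\<in>Poly_Mapping.keys q.
        Poly_Mapping.single (glue n A B) (Poly_Mapping.lookup p A * Poly_Mapping.lookup q B))"

definition linear_extension :: "(mgraph \<Rightarrow> real) \<Rightarrow> quantum_graph \<Rightarrow> real" where
  "linear_extension f p =
     (\<Sum>A\<in>Poly_Mapping.keys p. Poly_Mapping.lookup p A * type_value f A)"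

definition reflection_positive :: "(mgraph \<Rightarrow> real) \<Rightarrow> bool" where
  "reflection_positive f \<longleftrightarrow>
     (\<forall>n\<ge>1. \<forall>p. Poly_Mapping.keys p \<subseteq> labeled_types n \<longrightarrow>
        linear_extension f (quantum_mult n p p) \<ge> 0)"

definition weakly_reflection_positive :: "(mgraph \<Rightarrow> real) \<Rightarrow> bool" where
  "weakly_reflection_positive f \<longleftrightarrow>
     (\<forall>n\<ge>1. \<forall>p. Poly_Mapping.keys p \<subseteq> fully_labeled_types n \<longrightarrow>
        linear_extension f (quantum_mult n p p) \<ge> 0)"

section \<open>Connection matrices and rank\<close>

text \<open>
  The rank of a possibly infinite matrix with row indices \<open>I\<close> and column indices \<open>J\<close>: the
  supremum of the sizes of finite linearly independent families of rows.
\<close>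

definition rows_independent :: "'j set \<Rightarrow> ('i \<Rightarrow> 'j \<Rightarrow> real) \<Rightarrow> 'i set \<Rightarrow> bool" where
  "rows_independent J M R \<longleftrightarrow>
     (\<forall>c. (\<forall>j\<in>J. (\<Sum>i\<in>R. c i * M i j) = 0) \<longrightarrow> (\<forall>i\<in>R. c i = 0))"

definition matrix_rank :: "'i set \<Rightarrow> 'j set \<Rightarrow> ('i \<Rightarrow> 'j \<Rightarrow> real) \<Rightarrow> enat" where
  "matrix_rank I J M =
     (SUP R \<in> {R. finite R \<and> R \<subseteq> I \<and> rows_independent J M R}. enat (card R))"

definition connection_matrix :: "(mgraph \<Rightarrow> real) \<Rightarrow> nat \<Rightarrow> mgraph set \<Rightarrow> mgraph set \<Rightarrow> real" where
  "connection_matrix f n A B = type_value f (glue n A B)"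

definition connection_rank :: "(mgraph \<Rightarrow> real) \<Rightarrow> nat \<Rightarrow> enat" where
  "connection_rank f n =
     matrix_rank (labeled_types n) (labeled_types n) (connection_matrix f n)"

section \<open>Randomly weighted graphs\<close>

text \<open>
  The weight of the edge \<open>ij\<close> is the random variable \<open>edge_weight H {i, j}\<close> on the probability
  space \<open>sample_space H\<close> (so a loop at \<open>i\<close> has weight \<open>edge_weight H {i}\<close>); indexing by the
  set \<open>{i, j}\<close> builds in the symmetry and makes independence range over unordered pairs.
  The node set may be empty.
\<close>

record ('v, 'w) rwgraph =
  wnodes :: "'v set"
  node_weight :: "'v \<Rightarrow> real"
  sample_space :: "'w measure"
  edge_weight :: "'v set \<Rightarrow> 'w \<Rightarrow> real"

definition randomly_weighted_graph :: "('v, 'w) rwgraph \<Rightarrow> bool" where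
  "randomly_weighted_graph H \<longleftrightarrow>
     finite (wnodes H) \<and>
     (\<forall>i\<in>wnodes H. node_weight H i \<ge> 0) \<and>
     prob_space (sample_space H) \<and>
     prob_space.indep_vars (sample_space H) (\<lambda>_. borel) (edge_weight H)
       {{i, j} | i j. i \<in> wnodes H \<and> j \<in> wnodes H} \<and>
     (\<forall>i\<in>wnodes H. \<forall>j\<in>wnodes H. finite (edge_weight H {i, j} ` space (sample_space H)))"

text \<open>
  For \<open>e = {i, j}\<close>, the image \<open>\<phi> ` e\<close> is \<open>{\<phi> i, \<phi> j}\<close>. Since \<open>x ^ 0 = 1\<close>
  for all real \<open>x\<close>, pairs of nonadjacent nodes contribute the factor \<open>1\<close>.
\<close>

definition hom_rw :: "mgraph \<Rightarrow> ('v, 'w) rwgraph \<Rightarrow> real" where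
  "hom_rw F H =
     (\<Sum>\<phi> \<in> nodes F \<rightarrow>\<^sub>E wnodes H.
        (\<Prod>i\<in>nodes F. node_weight H (\<phi> i)) *
        (\<Prod>e \<in> {e. e \<subseteq> nodes F \<and> card e = 2}.
           prob_space.expectation (sample_space H)
             (\<lambda>\<omega>. edge_weight H (\<phi> ` e) \<omega> ^ count (edges F) e)))"

end

theory Submission
  imports Defs "HOL-Computational_Algebra.Fundamental_Theorem_Algebra"
begin

text \<open>
  A randomly weighted graph gives a Gram representation of every connection matrix: condition on
  the images of the labeled nodes and on the weights of the pairs of labeled nodes. The rank is at
  most the number of such states, and reflection positivity is visible.

  Conversely, normalise \<open>f\<close> so that isolated nodes do not matter. Weak reflection positivity makes the
  normalised parameter \<open>v\<close> a positive functional on polynomials in the edge variables, and finite rank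
  makes each edge variable algebraic with distinct real roots, the colours. Hence \<open>v\<close> records the moments
  of an exchangeable random colouring of the complete graph on \<open>T\<close> nodes, in which disjoint parts are
  independent. By a second moment estimate a typical sample has homomorphism densities close to \<open>v\<close>.
  Finite rank yields a nonzero polynomial that nearly annihilates the twin distance of most pairs of
  nodes of the sample, so this distance is rarely of moderate size: most pairs are either
  nearly twins or well separated. Maurey's empirical method bounds the number of separated
  classes independently of \<open>T\<close>. Averaging the sample over these classes changes densities only slightly, by a
  counting lemma, and a compactness argument gives a finite block model representing \<open>v\<close>
  exactly, that is, a randomly weighted graph.
\<close>

section \<open>Isomorphism types and linear extensions\<close>

text \<open>Weak reflection positivity says nothing about graphs with unlabeled nodes, so
  two-labeled graphs carry no obvious inner product in which finite rank could be exploited.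
  Positivity is therefore spent on the edge variables, where it turns the normalised parameter into
  a law of colourings; everything afterwards concerns typical finite colourings.

  In a block model two nodes of one block need not see equal colours, because edges stay random when
  the blocks are known. Rows of the colouring itself thus cannot detect twins. The proportion
  \<open>agree\<close> of middle nodes joined in the same colour averages this noise out, and
  distances are measured between its rows. Powers of this squared distance are densities of graphs
  glued at nodes \<open>1\<close> and \<open>2\<close>, which is what the second connection matrix
  controls.

  The number of blocks has to be fixed before the test graphs and the accuracy are chosen, since
  compactness is applied to models with a fixed number of blocks.

  Normalisation fails if the one-node graph has value zero; positivity then forces \<open>f\<close>
  to vanish, which is the case of the empty weighted graph.\<close>

lemma labeled_iso_refl: "labeled_iso n F F"
  unfolding labeled_iso_def by (rule exI[of _ id]) auto

lemma labeled_iso_trans: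
  assumes "labeled_iso n F G" "labeled_iso n G H"
  shows "labeled_iso n F H"
proof -
  obtain h where h: "bij_betw h (nodes F) (nodes G)" "\<forall>i\<in>{1..n}. h i = i"
    "image_mset (image h) (edges F) = edges G"
    using assms(1) by (auto simp: labeled_iso_def)
  obtain k where k: "bij_betw k (nodes G) (nodes H)" "\<forall>i\<in>{1..n}. k i = i"
    "image_mset (image k) (edges G) = edges H"
    using assms(2) by (auto simp: labeled_iso_def)
  have "image_mset (image (k \<circ> h)) (edges F) = image_mset (image k) (image_mset (image h) (edges F))"
    by (simp add: image_comp image_mset.compositionality comp_def image_image)
  then show ?thesis
    unfolding labeled_iso_def using h k bij_betw_trans[OF h(1) k(1)]
    by (intro exI[of _ "k \<circ> h"]) auto
qed

text \<open>Well-formedness of \<open>F\<close> is what makes the inverse work: it undoes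
  \<open>h\<close> only on \<open>nodes F\<close>, so edges and labels must lie there.\<close>

lemma labeled_iso_sym:
  assumes "labeled n F" "labeled_iso n F G"
  shows "labeled_iso n G F"
proof -
  obtain h where h: "bij_betw h (nodes F) (nodes G)" "\<forall>i\<in>{1..n}. h i = i"
    "image_mset (image h) (edges F) = edges G"
    using assms(2) by (auto simp: labeled_iso_def)
  define k where "k = inv_into (nodes F) h"
  have F: "multigraph F" "{1..n} \<subseteq> nodes F" using assms(1) by (auto simp: labeled_def)
  have inj: "inj_on h (nodes F)" using h(1) by (rule bij_betw_imp_inj_on)
  have kh: "k (h x) = x" if "x \<in> nodes F" for x using inj that by (simp add: k_def)
  have "image_mset (image k) (edges G) = image_mset (\<lambda>e. k ` h ` e) (edges F)"
    unfolding h(3)[symmetric] by (simp add: image_mset.compositionality comp_def)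
  also have "\<dots> = image_mset (\<lambda>e. e) (edges F)"
  proof (rule image_mset_cong)
    fix e assume "e \<in># edges F"
    then have "e \<subseteq> nodes F" using F by (auto simp: multigraph_def)
    then show "k ` h ` e = e" using kh by (force simp: image_image)
  qed
  finally have "image_mset (image k) (edges G) = edges F" by simp
  moreover have "k i = i" if "i \<in> {1..n}" for i
    using kh[of i] h(2) that F by auto
  moreover have "bij_betw k (nodes G) (nodes F)"
    unfolding k_def using h(1) by (rule bij_betw_inv_into)
  ultimately show ?thesis unfolding labeled_iso_def by blast
qed

lemma multigraph_image:
  assumes "multigraph F" "inj_on h (nodes F)"
  shows "multigraph \<lparr>nodes = h ` nodes F, edges = image_mset (image h) (edges F)\<rparr>"
proof -
  have "card (h ` e) = 2" "h ` e \<subseteq> h ` nodes F" if "e \<in># edges F" for e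
  proof -
    have e: "e \<subseteq> nodes F" "card e = 2" using that assms by (auto simp: multigraph_def)
    show "card (h ` e) = 2" using e assms(2) by (metis card_image inj_on_subset)
    show "h ` e \<subseteq> h ` nodes F" using e by blast
  qed
  then show ?thesis using assms by (auto simp: multigraph_def)
qed

lemma labeled_iso_image:
  assumes "inj_on h (nodes F)" "\<And>i. i \<in> {1..n} \<Longrightarrow> h i = i"
  shows "labeled_iso n F \<lparr>nodes = h ` nodes F, edges = image_mset (image h) (edges F)\<rparr>"
  unfolding labeled_iso_def using assms by (intro exI[of _ h]) (auto simp: bij_betw_def)

lemma labeled_image:
  assumes "labeled n F" "inj_on h (nodes F)" "\<And>i. i \<in> {1..n} \<Longrightarrow> h i = i"
  shows "labeled n \<lparr>nodes = h ` nodes F, edges = image_mset (image h) (edges F)\<rparr>"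
proof -
  have "{1..n} \<subseteq> h ` nodes F"
  proof
    fix i assume i: "i \<in> {1..n}"
    then have "i \<in> nodes F" using assms(1) by (auto simp: labeled_def)
    then have "h i \<in> h ` nodes F" by simp
    then show "i \<in> h ` nodes F" using assms(3)[OF i] by simp
  qed
  then show ?thesis using assms(1,2) multigraph_image[of F h] by (simp add: labeled_def)
qed

lemma iso_type_self: "labeled n F \<Longrightarrow> F \<in> iso_type n F"
  by (simp add: iso_type_def labeled_iso_refl)

lemma iso_type_eq:
  assumes "labeled n F" "labeled n G" "labeled_iso n F G"
  shows "iso_type n F = iso_type n G"
  unfolding iso_type_def
  using assms labeled_iso_sym[OF assms(1,3)] labeled_iso_trans by blast

lemma labeled_iso_0: "labeled_iso n F G \<Longrightarrow> labeled_iso 0 F G"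
  by (auto simp: labeled_iso_def)

lemma type_value_iso_type:
  assumes "graph_parameter f" "labeled n F"
  shows "type_value f (iso_type n F) = f F"
proof -
  have "f G = f F" if "G \<in> iso_type n F" for G
  proof -
    have "multigraph F" "multigraph G" "labeled_iso 0 F G"
      using that assms(2) labeled_iso_0 by (auto simp: iso_type_def labeled_def)
    then show ?thesis using assms(1) by (simp add: graph_parameter_def)
  qed
  then have "f ` iso_type n F = {f F}" using iso_type_self[OF assms(2)] by blast
  then show ?thesis by (simp add: type_value_def)
qed

lemma labeled_graph_union:
  "labeled n F \<Longrightarrow> labeled n G \<Longrightarrow> labeled n (graph_union F G)"
  by (auto simp: labeled_def multigraph_def graph_union_def)

lemma labeled_iso_graph_union:
  assumes F: "labeled n F" "labeled n F'" "labeled_iso n F F'"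
    and G: "labeled n G" "labeled n G'" "labeled_iso n G G'"
    and int: "nodes F \<inter> nodes G = {1..n}" "nodes F' \<inter> nodes G' = {1..n}"
  shows "labeled_iso n (graph_union F G) (graph_union F' G')"
proof -
  obtain h where h: "bij_betw h (nodes F) (nodes F')" "\<forall>i\<in>{1..n}. h i = i"
    "image_mset (image h) (edges F) = edges F'"
    using F by (auto simp: labeled_iso_def)
  obtain k where k: "bij_betw k (nodes G) (nodes G')" "\<forall>i\<in>{1..n}. k i = i"
    "image_mset (image k) (edges G) = edges G'"
    using G by (auto simp: labeled_iso_def)
  \<comment> \<open>The two isomorphisms agree wherever both are defined, because common nodes are
    labels and both maps fix labels.\<close>
  define m where "m x = (if x \<in> nodes F then h x else k x)" for x
  have mF: "m x = h x" if "x \<in> nodes F" for x using that by (simp add: m_def)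
  have mG: "m x = k x" if "x \<in> nodes G" for x 
  proof (cases "x \<in> nodes F")
    case True
    then have "x \<in> {1..n}" using that int(1) by blast
    then show ?thesis using h(2) k(2) by (simp add: m_def)
  qed (simp add: m_def)
  have bF: "bij_betw m (nodes F) (nodes F')" using h(1) mF by (subst bij_betw_cong) auto
  have bG: "bij_betw m (nodes G) (nodes G')" using k(1) mG by (subst bij_betw_cong) auto
  have "inj_on m (nodes F \<union> nodes G)"
  proof (rule inj_onI)
    \<comment> \<open>A node of \<open>F\<close> and a node of \<open>G\<close> can collide only at
      a common node of the targets, hence at a label. Both maps fix that label, so injectivity on
      each side identifies it with \<open>x\<close> and with \<open>y\<close>.\<close>
    have FG: "x = y" if xy: "x \<in> nodes F" "y \<in> nodes G" "m x = m y" for x y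
    proof -
      have "m x \<in> {1..n}"
        using xy bF bG int(2) by (metis IntI bij_betwE)
      then have *: "m x \<in> nodes F" "m x \<in> nodes G" "h (m x) = m x"
        using h(2) int(1) by blast+
      then have "m (m x) = m x" using mF by simp
      then have "m x = x" "m x = y"
        using xy * inj_onD[OF bij_betw_imp_inj_on[OF bF], of "m x" x]
          inj_onD[OF bij_betw_imp_inj_on[OF bG], of "m x" y] by simp_all
      then show ?thesis by simp
    qed
    fix x y assume "x \<in> nodes F \<union> nodes G" "y \<in> nodes F \<union> nodes G" "m x = m y"
    then consider "x \<in> nodes F" "y \<in> nodes F" | "x \<in> nodes F" "y \<in> nodes G"
      | "x \<in> nodes G" "y \<in> nodes F" | "x \<in> nodes G" "y \<in> nodes G" by blast
    then show "x = y"
    proof cases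
      case 1
      then show ?thesis using inj_onD[OF bij_betw_imp_inj_on[OF bF], of x y] \<open>m x = m y\<close> by simp
    next
      case 2
      then show ?thesis using FG \<open>m x = m y\<close> by simp
    next
      case 3
      then show ?thesis using FG[of y x] \<open>m x = m y\<close> by simp
    next
      case 4
      then show ?thesis using inj_onD[OF bij_betw_imp_inj_on[OF bG], of x y] \<open>m x = m y\<close> by simp
    qed
  qed
  moreover have "m ` (nodes F \<union> nodes G) = nodes F' \<union> nodes G'"
    using bF bG by (simp add: image_Un bij_betw_def)
  moreover have "image_mset (image m) (edges F) = edges F'"
    unfolding h(3)[symmetric] using F(1) mF
    by (intro image_mset_cong image_cong) (auto simp: labeled_def multigraph_def)
  moreover have "image_mset (image m) (edges G) = edges G'"
    unfolding k(3)[symmetric] using G(1) mG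
    by (intro image_mset_cong image_cong) (auto simp: labeled_def multigraph_def)
  moreover have "\<forall>i\<in>{1..n}. m i = i"
    using mF h(2) F(1) by (auto simp: labeled_def)
  ultimately show ?thesis
    unfolding labeled_iso_def graph_union_def by (intro exI[of _ m]) (simp add: bij_betw_def)
qed

text \<open>Independence of representatives collapses the family in \<open>glue_def\<close> to one
  type, and the given pair shows that the family is nonempty; the union taken there is therefore
  that type.\<close>

lemma glue_iso_type:
  assumes F: "labeled n F" and G: "labeled n G" and int: "nodes F \<inter> nodes G = {1..n}"
  shows "glue n (iso_type n F) (iso_type n G) = iso_type n (graph_union F G)"
proof -
  have "{iso_type n (graph_union F' G') | F' G'. F' \<in> iso_type n F \<and> G' \<in> iso_type n G \<and>
      nodes F' \<inter> nodes G' = {1..n}} = {iso_type n (graph_union F G)}" (is "?L = ?R")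
  proof
    show "?R \<subseteq> ?L" using iso_type_self[OF F] iso_type_self[OF G] int by blast
    show "?L \<subseteq> ?R"
    proof
      fix A assume "A \<in> ?L"
      then obtain F' G' where *: "A = iso_type n (graph_union F' G')" "labeled n F'" "labeled_iso n F F'"
        "labeled n G'" "labeled_iso n G G'" "nodes F' \<inter> nodes G' = {1..n}"
        by (auto simp: iso_type_def)
      have "iso_type n (graph_union F G) = iso_type n (graph_union F' G')"
        using * F G int by (intro iso_type_eq labeled_iso_graph_union labeled_graph_union)
      then show "A \<in> ?R" using * by simp
    qed
  qed
  then show ?thesis unfolding glue_def by simp
qed

lemma type_value_glue:
  assumes "graph_parameter f" "labeled n F" "labeled n G" "nodes F \<inter> nodes G = {1..n}"
  shows "type_value f (glue n (iso_type n F) (iso_type n G)) = f (graph_union F G)"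
  using assms by (simp add: glue_iso_type type_value_iso_type labeled_graph_union)

lemma exists_disjoint_representative:
  assumes "labeled n G" "finite S"
  obtains G' where "labeled n G'" "labeled_iso n G G'" "nodes G' \<inter> S \<subseteq> {1..n}"
proof -
  have "finite (S \<union> {1..n})" using assms(2) by simp
  then obtain N where N: "\<forall>x \<in> S \<union> {1..n}. x < N"
    using finite_nat_set_iff_bounded by blast
  \<comment> \<open>\<open>N\<close> lies strictly above \<open>S\<close> and the labels, so shifted
    nodes avoid both; the unlabeled node \<open>0\<close> moves as well, to \<open>N\<close>
    itself.\<close>
  define h where "h x = (if x \<in> {1..n} then x else x + N)" for x
  have inj: "inj_on h (nodes G)"
  proof (rule inj_onI)
    fix x y assume "h x = h y"
    then show "x = y" using N by (auto simp: h_def split: if_splits)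
  qed
  let ?G = "\<lparr>nodes = h ` nodes G, edges = image_mset (image h) (edges G)\<rparr>"
  have "x \<in> {1..n}" if "x \<in> nodes ?G \<inter> S" for x
    using that N by (auto simp: h_def split: if_splits)
  then have "nodes ?G \<inter> S \<subseteq> {1..n}" by blast
  moreover have "h i = i" if "i \<in> {1..n}" for i using that by (simp add: h_def)
  ultimately show ?thesis
    using that[of ?G] labeled_image[OF assms(1) inj] labeled_iso_image[OF inj, of n] by blast
qed

text \<open>Kept generic in the keys: these are types for quantum graphs, and multisets of pairs,
  read as monomials, for polynomials in the edge variables.\<close>

definition lin :: "('k \<Rightarrow> real) \<Rightarrow> ('k \<Rightarrow>\<^sub>0 real) \<Rightarrow> real" where
  "lin g p = (\<Sum>k\<in>Poly_Mapping.keys p. Poly_Mapping.lookup p k * g k)"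

lemma lin_superset:
  assumes "finite S" "Poly_Mapping.keys p \<subseteq> S"
  shows "lin g p = (\<Sum>k\<in>S. Poly_Mapping.lookup p k * g k)"
  unfolding lin_def using assms by (intro sum.mono_neutral_left) (auto simp: in_keys_iff)

lemma lin_zero [simp]: "lin g 0 = 0"
  by (simp add: lin_def)

lemma lin_add: "lin g (p + q) = lin g p + lin g q"
proof -
  let ?S = "Poly_Mapping.keys p \<union> Poly_Mapping.keys q"
  have "lin g (p + q) = (\<Sum>k\<in>?S. Poly_Mapping.lookup (p + q) k * g k)"
    by (rule lin_superset) (auto simp: keys_add)
  also have "\<dots> = lin g p + lin g q"
    by (subst (1 2) lin_superset[of ?S]) (auto simp: lookup_add sum.distrib algebra_simps)
  finally show ?thesis .
qed

lemma lin_sum: "lin g (\<Sum>i\<in>I. p i) = (\<Sum>i\<in>I. lin g (p i))"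
  by (induction I rule: infinite_finite_induct) (auto simp: lin_add)

lemma lin_single [simp]: "lin g (Poly_Mapping.single k c) = c * g k"
  by (cases "c = 0") (auto simp: lin_def)

lemma lin_uminus: "lin g (- p) = - lin g p"
  using lin_add[of g p "- p"] by simp

lemma lin_diff: "lin g (p - q) = lin g p - lin g q"
  using lin_add[of g p "- q"] by (simp add: lin_uminus)

lemma lin_cong: "(\<And>k. k \<in> Poly_Mapping.keys p \<Longrightarrow> g k = h k) \<Longrightarrow> lin g p = lin h p"
  by (simp add: lin_def)

lemma poly_mapping_sum_single:
  fixes p :: "'k \<Rightarrow>\<^sub>0 real"
  shows "p = (\<Sum>k\<in>Poly_Mapping.keys p. Poly_Mapping.single k (Poly_Mapping.lookup p k))"
  by (rule poly_mapping_eqI)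
    (auto simp: lookup_sum lookup_single when_def in_keys_iff sum.delta' cong: if_cong)

text \<open>Multiplication of finitely supported functions is convolution along addition of keys.
  For multisets of pairs this addition is gluing along equal node names, so
  \<open>lin v (a * a)\<close> is the quadratic form of reflection positivity.\<close>

lemma lin_mult:
  "lin g (p * q) = lin (\<lambda>a. lin (\<lambda>b. g (a + b)) q) p"
proof -
  have "p * q = (\<Sum>a\<in>Poly_Mapping.keys p. \<Sum>b\<in>Poly_Mapping.keys q.
      Poly_Mapping.single (a + b) (Poly_Mapping.lookup p a * Poly_Mapping.lookup q b))"
    by (subst poly_mapping_sum_single[of p], subst poly_mapping_sum_single[of q])
      (simp add: sum_product mult_single)
  then have "lin g (p * q) = (\<Sum>a\<in>Poly_Mapping.keys p. \<Sum>b\<in>Poly_Mapping.keys q.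
      Poly_Mapping.lookup p a * Poly_Mapping.lookup q b * g (a + b))"
    by (simp add: lin_sum)
  then show ?thesis by (simp add: lin_def sum_distrib_left mult.assoc)
qed

text \<open>\<open>quantum_mult\<close> is not the ring product, since \<open>glue\<close> is not an
  addition of keys; evaluated by \<open>f\<close>, it leaves only a bilinear form in the
  coefficients.\<close>

lemma linear_extension_quantum_mult:
  "linear_extension f (quantum_mult n p q) =
     lin (\<lambda>A. lin (\<lambda>B. type_value f (glue n A B)) q) p"
proof -
  have "linear_extension f r = lin (type_value f) r" for r
    by (simp add: linear_extension_def lin_def)
  then show ?thesis
    by (simp add: quantum_mult_def lin_sum) (simp add: lin_def sum_distrib_left mult.assoc)
qed

section \<open>The normalised parameter\<close>

abbreviation mg :: "nat set \<Rightarrow> nat set multiset \<Rightarrow> mgraph" where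
  "mg N E \<equiv> \<lparr>nodes = N, edges = E\<rparr>"

abbreviation verts :: "nat set multiset \<Rightarrow> nat set" where
  "verts E \<equiv> \<Union>(set_mset E)"

definition simple :: "nat set multiset \<Rightarrow> nat set multiset" where
  "simple E = filter_mset (\<lambda>e. card e = 2) E"

text \<open>
  The parameter normalised so that isolated nodes do not matter. Sets that are not pairs are
  discarded, so that the functional is total on multisets without affecting positivity.
\<close>

definition edge_value :: "(mgraph \<Rightarrow> real) \<Rightarrow> nat set multiset \<Rightarrow> real" where
  "edge_value f E = f (mg (insert 0 (verts (simple E))) (simple E)) /
     f (mg {0} {#}) ^ card (insert 0 (verts (simple E)))"

lemma simple_add [simp]: "simple (E + E') = simple E + simple E'"
  and simple_empty [simp]: "simple {#} = {#}"
  and simple_simple [simp]: "simple (simple E) = simple E"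
  by (simp_all add: simple_def multiset_eq_iff)

lemma simple_id: "(\<And>e. e \<in># E \<Longrightarrow> card e = 2) \<Longrightarrow> simple E = E"
  by (simp add: simple_def filter_mset_eq_conv)

lemma card_simple: "e \<in># simple E \<Longrightarrow> card e = 2"
  by (simp add: simple_def)

lemma verts_simple: "verts (simple E) \<subseteq> verts E"
  by (auto simp: simple_def)

lemma finite_verts_simple [simp]: "finite (verts (simple E))"
proof -
  have "finite e" if "e \<in># simple E" for e
    using card_simple[OF that] by (metis card.infinite zero_neq_numeral)
  then show ?thesis by auto
qed

lemma verts_simple_empty: "verts (simple E) = {} \<longleftrightarrow> simple E = {#}"
proof
  assume "verts (simple E) = {}"
  then have "e = {}" if "e \<in># simple E" for e using that by blast
  then have "e \<notin># simple E" for e using card_simple[of e E] by fastforce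
  then show "simple E = {#}" using multiset_nonemptyE by blast
qed simp

lemma edge_value_simple [simp]: "edge_value f (simple E) = edge_value f E"
  by (simp add: edge_value_def)

lemma edge_value_add_simple:
  "edge_value f (simple E + simple E') = edge_value f (E + E')"
  by (simp add: edge_value_def)

lemma simple_image_mset:
  assumes "inj_on h (verts E)"
  shows "simple (image_mset (image h) E) = image_mset (image h) (simple E)"
proof -
  have "card (h ` e) = card e" if "e \<in># E" for e
    using assms that by (intro card_image) (meson Union_upper inj_on_subset)
  then show ?thesis
    unfolding simple_def filter_mset_image_mset by (metis (mono_tags, lifting) filter_mset_cong)
qed

lemma multigraph_mg:
  "finite N \<Longrightarrow> N \<noteq> {} \<Longrightarrow> verts (simple E) \<subseteq> N \<Longrightarrow> multigraph (mg N (simple E))"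
  by (auto simp: multigraph_def card_simple)

section \<open>Isolated nodes and normalisation\<close>

locale mult_parameter =
  fixes f :: "mgraph \<Rightarrow> real"
  assumes param: "graph_parameter f" and mult: "multiplicative f"
begin

lemma f_iso:
  "multigraph F \<Longrightarrow> multigraph G \<Longrightarrow> labeled_iso 0 F G \<Longrightarrow> f F = f G"
  using param by (simp add: graph_parameter_def)

lemma f_image:
  assumes "multigraph (mg N E)" "inj_on h N"
  shows "f (mg (h ` N) (image_mset (image h) E)) = f (mg N E)"
  using f_iso[OF assms(1), of "mg (h ` N) (image_mset (image h) E)"]
    multigraph_image[OF assms(1), of h] labeled_iso_image[of h "mg N E" 0] assms(2) by simp

lemma f_single: "f (mg {x} {#}) = f (mg {0} {#})"
  using f_image[of "{0}" "{#}" "\<lambda>_. x"] by (simp add: multigraph_def)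

lemma f_add_isolated:
  assumes "finite M" "M \<inter> N = {}" "multigraph (mg N E)"
  shows "f (mg (N \<union> M) E) = f (mg N E) * f (mg {0} {#}) ^ card M"
  using assms
proof (induction M rule: finite_induct)
  case (insert x M)
  have m: "multigraph (mg (N \<union> M) E)" "multigraph (mg {x} {#})"
    using insert by (auto simp: multigraph_def)
  have "f (graph_union (mg (N \<union> M) E) (mg {x} {#})) = f (mg (N \<union> M) E) * f (mg {x} {#})"
    using mult m insert unfolding multiplicative_def by auto
  then show ?case
    using insert by (simp add: graph_union_def f_single[of x] algebra_simps)
qed simp

end

locale nonzero_parameter = mult_parameter +
  assumes K1: "f (mg {0} {#}) \<noteq> 0"
begin

abbreviation "k1 \<equiv> f (mg {0} {#})"
abbreviation "v \<equiv> edge_value f"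

text \<open>Both \<open>N\<close> and the canonical node set of \<open>edge_value\<close> are
  enlarged to their union. Each added isolated node costs a factor \<open>k1\<close>, which is
  nonzero and cancels.\<close>

lemma f_eq_edge_value:
  assumes "finite N" "N \<noteq> {}" "verts (simple E) \<subseteq> N"
  shows "f (mg N (simple E)) = k1 ^ card N * v E"
proof -
  let ?S = "insert 0 (verts (simple E))"
  have mN: "multigraph (mg N (simple E))" and mS: "multigraph (mg ?S (simple E))"
    using assms by (auto intro!: multigraph_mg)
  have "f (mg (N \<union> (?S - N)) (simple E)) = f (mg N (simple E)) * k1 ^ card (?S - N)"
    using f_add_isolated[OF _ _ mN, of "?S - N"] by auto
  moreover have "f (mg (?S \<union> (N - ?S)) (simple E)) = f (mg ?S (simple E)) * k1 ^ card (N - ?S)"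
    using f_add_isolated[OF _ _ mS, of "N - ?S"] assms(1) by blast
  moreover have "N \<union> (?S - N) = ?S \<union> (N - ?S)" by blast
  ultimately have "f (mg N (simple E)) * k1 ^ card (?S - N) =
      v E * k1 ^ card ?S * k1 ^ card (N - ?S)"
    using K1 by (simp add: edge_value_def)
  also have "\<dots> = v E * k1 ^ (card ?S + card (N - ?S))" by (simp add: power_add)
  also have "card ?S + card (N - ?S) = card N + card (?S - N)"
  proof -
    have fS: "finite ?S" by simp
    have "card ?S + card (N - ?S) = card (?S \<union> (N - ?S))"
      using fS assms(1) by (subst card_Un_disjoint) auto
    also have "?S \<union> (N - ?S) = N \<union> (?S - N)" by blast
    also have "card \<dots> = card N + card (?S - N)"
      using fS assms(1) by (subst card_Un_disjoint) auto
    finally show ?thesis .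
  qed
  finally have "f (mg N (simple E)) * k1 ^ card (?S - N) = k1 ^ card N * v E * k1 ^ card (?S - N)"
    by (simp add: power_add mult_ac)
  then show ?thesis using K1 by simp
qed

lemma edge_value_empty [simp]: "v {#} = 1"
  using K1 by (simp add: edge_value_def)

lemma edge_value_rename:
  assumes "inj_on h (verts E)"
  shows "v (image_mset (image h) E) = v E"
proof (cases "simple E = {#}")
  case True
  then have "simple (image_mset (image h) E) = {#}" using simple_image_mset[OF assms] by simp
  then show ?thesis using True by (metis edge_value_simple)
next
  case False
  let ?N = "verts (simple E)"
  have inj: "inj_on h ?N" using assms verts_simple by (rule inj_on_subset)
  have ne: "?N \<noteq> {}" using False verts_simple_empty by simp
  have m: "multigraph (mg ?N (simple E))" using ne by (intro multigraph_mg) auto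
  have im: "simple (image_mset (image h) E) = image_mset (image h) (simple E)"
    by (rule simple_image_mset[OF assms])
  have "f (mg (h ` ?N) (simple (image_mset (image h) E))) = k1 ^ card (h ` ?N) * v (image_mset (image h) E)"
    using ne by (intro f_eq_edge_value) (auto simp: im)
  moreover have "f (mg (h ` ?N) (simple (image_mset (image h) E))) = f (mg ?N (simple E))"
    using f_image[OF m inj] im by simp
  moreover have "f (mg ?N (simple E)) = k1 ^ card ?N * v E"
    using ne by (intro f_eq_edge_value) auto
  ultimately show ?thesis using K1 by (simp add: card_image[OF inj])
qed

lemma edge_value_disjoint:
  assumes "verts E \<inter> verts E' = {}"
  shows "v (E + E') = v E * v E'"
\<comment> \<open>Without edges the vertex set is empty, and a multigraph has at least one node, so
  multiplicativity of \<open>f\<close> does not apply directly here.\<close>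
proof (cases "simple E = {#} \<or> simple E' = {#}")
  case True
  have v0: "v X = 1" if "simple X = {#}" for X
    using edge_value_simple[of f X] that by simp
  have "v (E + E') = v (simple E + simple E')" by (simp add: edge_value_add_simple)
  then show ?thesis using True v0[of E] v0[of E'] by auto
next
  case False
  let ?N = "verts (simple E)" and ?M = "verts (simple E')"
  have ne: "?N \<noteq> {}" "?M \<noteq> {}" using False verts_simple_empty by auto
  have d: "?N \<inter> ?M = {}" using assms verts_simple by blast
  have "f (graph_union (mg ?N (simple E)) (mg ?M (simple E'))) = f (mg ?N (simple E)) * f (mg ?M (simple E'))"
    using mult[unfolded multiplicative_def, rule_format, of "mg ?N (simple E)" "mg ?M (simple E')"]
      multigraph_mg[OF _ ne(1)] multigraph_mg[OF _ ne(2)] d by simp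
  also have "\<dots> = k1 ^ card ?N * v E * (k1 ^ card ?M * v E')"
    using ne by (subst (1 2) f_eq_edge_value) auto
  also have "graph_union (mg ?N (simple E)) (mg ?M (simple E')) = mg (?N \<union> ?M) (simple (E + E'))"
    by (simp add: graph_union_def)
  also have "f \<dots> = k1 ^ card (?N \<union> ?M) * v (E + E')"
    using ne by (intro f_eq_edge_value) auto
  also have "card (?N \<union> ?M) = card ?N + card ?M"
    using d by (intro card_Un_disjoint) auto
  finally show ?thesis using K1 by (simp add: power_add)
qed

end

lemma lin_sum_single_in_keys:
  assumes "A \<in> Poly_Mapping.keys (\<Sum>i\<in>I. Poly_Mapping.single (k i) (c i :: real))"
  shows "A \<in> k ` I"
proof (rule ccontr)
  assume "A \<notin> k ` I"
  then have "Poly_Mapping.lookup (\<Sum>i\<in>I. Poly_Mapping.single (k i) (c i)) A = 0"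
    unfolding lookup_sum by (intro sum.neutral) (auto simp: lookup_single when_def)
  then show False using assms by (simp add: in_keys_iff)
qed

context mult_parameter
begin

text \<open>Indexing by \<open>I\<close> instead of by types lets several indices share a type;
  their coefficients add up in \<open>p\<close>, which leaves the quadratic form unchanged.\<close>

lemma weak_reflection_positivityD:
  assumes wrp: "weakly_reflection_positive f" and "finite I" and n: "n \<ge> 1"
    and X: "\<And>i. i \<in> I \<Longrightarrow> verts (simple (X i)) \<subseteq> {1..n}"
  shows "(\<Sum>i\<in>I. \<Sum>j\<in>I. c i * c j * f (mg {1..n} (simple (X i + X j)))) \<ge> 0"
proof -
  let ?G = "\<lambda>i. mg {1..n} (simple (X i))"
  define p where "p = (\<Sum>i\<in>I. Poly_Mapping.single (iso_type n (?G i)) (c i))"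
  have lab: "labeled n (?G i)" if "i \<in> I" for i
    using X[OF that] n unfolding labeled_def by (auto intro!: multigraph_mg)
  have "Poly_Mapping.keys p \<subseteq> fully_labeled_types n"
  proof
    fix A assume "A \<in> Poly_Mapping.keys p"
    then have "A \<in> (\<lambda>i. iso_type n (?G i)) ` I"
      unfolding p_def by (rule lin_sum_single_in_keys)
    then obtain i where "i \<in> I" "A = iso_type n (?G i)" by blast
    then show "A \<in> fully_labeled_types n"
      using lab by (force simp: fully_labeled_types_def)
  qed
  then have "0 \<le> linear_extension f (quantum_mult n p p)"
    using wrp n by (simp add: weakly_reflection_positive_def)
  also have "\<dots> = (\<Sum>i\<in>I. \<Sum>j\<in>I. c i * c j * type_value f (glue n (iso_type n (?G i)) (iso_type n (?G j))))"
    unfolding linear_extension_quantum_mult p_def by (simp add: lin_sum sum_distrib_left mult.assoc)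
  also have "\<dots> = (\<Sum>i\<in>I. \<Sum>j\<in>I. c i * c j * f (mg {1..n} (simple (X i + X j))))"
    using type_value_glue[OF param lab lab] by (intro sum.cong refl) (simp add: graph_union_def)
  finally show ?thesis .
qed

text \<open>In the Gram matrix of the edgeless graph and \<open>F\<close> on the same labels, the
  diagonal entry of the edgeless graph is a power of \<open>f (mg {0} {#})\<close>, hence zero.
  Positive semidefiniteness then forces the off-diagonal entry, which is \<open>f F\<close>, to
  vanish.\<close>

lemma f_zero:
  assumes wrp: "weakly_reflection_positive f" and K1: "f (mg {0} {#}) = 0" and F: "multigraph F"
  shows "f F = 0"
proof -
  obtain N E where FE: "F = mg N E" by (cases F)
  have N: "finite N" "N \<noteq> {}" and E: "\<And>e. e \<in># E \<Longrightarrow> e \<subseteq> N \<and> card e = 2"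
    using F by (auto simp: FE multigraph_def)
  define n where "n = card N"
  have "card N = card {1..n}" by (simp add: n_def)
  then obtain h where h: "bij_betw h N {1..n}"
    using finite_same_card_bij[OF N(1), of "{1..n}"] by blast
  have n: "n \<ge> 1" using N by (simp add: n_def Suc_le_eq card_gt_0_iff)
  have e0: "f (mg {1..m} {#}) = 0" if "m \<ge> 1" for m
  proof -
    have "f (mg ({1} \<union> {2..m}) {#}) = f (mg {1} {#}) * f (mg {0} {#}) ^ card {2..m}"
      by (rule f_add_isolated) (auto simp: multigraph_def)
    also have "{1} \<union> {2..m} = {1..m}" using that by auto
    finally show ?thesis using f_single[of 1] K1 by (simp only: mult_zero_left)
  qed
  define E' where "E' = image_mset (image h) E"
  have hN: "h ` N = {1..n}" "inj_on h N" using h by (auto simp: bij_betw_def)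
  have f1: "f F = f (mg {1..n} E')"
    using f_image[OF F[unfolded FE], of h] hN unfolding FE E'_def by simp
  have "multigraph (mg (h ` N) E')"
    using multigraph_image[OF F, of h] hN unfolding FE E'_def by simp
  then have E'v: "verts E' \<subseteq> {1..n}" and E's: "simple E' = E'"
    using hN by (auto simp: multigraph_def intro!: simple_id)
  \<comment> \<open>Index \<open>0\<close> carries the edgeless graph with coefficient
    \<open>s\<close>. Its square contributes nothing, so the form is affine in \<open>s\<close> and
    stays nonnegative only with slope zero.\<close>
  have psd: "0 \<le> s * (2 * f F) + f (mg {1..n} (E' + E'))" for s
  proof -
    let ?X = "\<lambda>i::nat. if i = 0 then {#} else E'"
    let ?c = "\<lambda>i::nat. if i = 0 then s else 1"
    have "(\<Sum>i\<in>{0,1}. \<Sum>j\<in>{0,1}. ?c i * ?c j * f (mg {1..n} (simple (?X i + ?X j)))) \<ge> 0"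
      using E'v E's by (intro weak_reflection_positivityD[OF wrp _ n, where X = ?X and c = ?c]) simp_all
    then have "0 \<le> s * f (mg {1..n} E') + (s * f (mg {1..n} E') + f (mg {1..n} (E' + E')))"
      using e0[OF n] E's by simp
    then show ?thesis unfolding f1 by (simp only: mult.left_commute mult_2 distrib_left add.assoc)
  qed
  show ?thesis
  proof (rule ccontr)
    assume "f F \<noteq> 0"
    then have "- (f (mg {1..n} (E' + E')) + 1) / (2 * f F) * (2 * f F) = - (f (mg {1..n} (E' + E')) + 1)"
      by simp
    then show False
      using psd[of "- (f (mg {1..n} (E' + E')) + 1) / (2 * f F)"] by linarith
  qed
qed

text \<open>The one-node graph, with its node labeled, is its own square.\<close>

lemma f_K1_nonneg:
  assumes wrp: "weakly_reflection_positive f"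
  shows "f (mg {0} {#}) \<ge> 0"
  using weak_reflection_positivityD[OF wrp, of "{0::nat}" 1 "\<lambda>_. {#}" "\<lambda>_. 1"] f_single[of 1]
  by simp

end

context nonzero_parameter
begin

text \<open>On a fixed label set the values of \<open>f\<close> and of \<open>v\<close> differ by
  one positive constant, a power of \<open>k1\<close>, common to all entries of the quadratic
  form.\<close>

lemma edge_value_psd:
  assumes wrp: "weakly_reflection_positive f"
  shows "lin v (a * a) \<ge> 0"
proof -
  let ?I = "Poly_Mapping.keys a"
  have "finite (\<Union>E\<in>?I. verts (simple E))" by auto
  then obtain n where n: "\<forall>x\<in>(\<Union>E\<in>?I. verts (simple E)). x < n"
    using finite_nat_set_iff_bounded by blast
  \<comment> \<open>Labels start at \<open>1\<close> while node names in the keys may include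
    \<open>0\<close>, hence the shift.\<close>
  let ?X = "\<lambda>E. image_mset (image Suc) (simple E)"
  have sX: "simple (?X E) = ?X E" for E
    by (subst simple_image_mset) auto
  have 1: "(\<Sum>i\<in>?I. \<Sum>j\<in>?I. Poly_Mapping.lookup a i * Poly_Mapping.lookup a j *
      f (mg {1..Suc n} (simple (?X i + ?X j)))) \<ge> 0"
    using n by (intro weak_reflection_positivityD[OF wrp]) (auto simp: sX less_imp_le)
  have "f (mg {1..Suc n} (simple (?X i + ?X j))) = k1 ^ Suc n * v (i + j)" if ij: "i \<in> ?I" "j \<in> ?I" for i j
  proof -
    have "verts (simple (?X i + ?X j)) \<subseteq> {1..Suc n}"
      using n ij by (auto simp: sX less_imp_le)
    then have "f (mg {1..Suc n} (simple (?X i + ?X j))) = k1 ^ card {1..Suc n} * v (?X i + ?X j)"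
      by (intro f_eq_edge_value) auto
    also have "?X i + ?X j = image_mset (image Suc) (simple i + simple j)" by simp
    also have "v \<dots> = v (i + j)"
      by (subst edge_value_rename) (auto simp: edge_value_add_simple)
    finally show ?thesis by simp
  qed
  then have "0 \<le> k1 ^ Suc n * (\<Sum>i\<in>?I. \<Sum>j\<in>?I. Poly_Mapping.lookup a i * Poly_Mapping.lookup a j * v (i + j))"
    using 1 by (simp add: sum_distrib_left mult_ac)
  moreover have "k1 > 0" using f_K1_nonneg[OF wrp] K1 by simp
  then have "k1 ^ Suc n > 0" by (rule zero_less_power)
  ultimately have "0 \<le> (\<Sum>i\<in>?I. \<Sum>j\<in>?I. Poly_Mapping.lookup a i * Poly_Mapping.lookup a j * v (i + j))"
    using mult_pos_neg not_le by blast
  also have "\<dots> = lin v (a * a)"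
    unfolding lin_mult by (simp add: lin_def sum_distrib_left mult.assoc)
  finally show ?thesis .
qed

end

text \<open>Finite rank provides a largest independent family of rows, and every further row depends
  on it.\<close>

lemma matrix_rank_factorization:
  assumes "matrix_rank I J M < \<infinity>"
  shows "\<exists>R C. finite R \<and> (\<forall>i\<in>I. \<forall>j\<in>J. M i j = (\<Sum>r\<in>R. C i r * M r j))"
proof -
  let ?S = "{R. finite R \<and> R \<subseteq> I \<and> rows_independent J M R}"
  obtain k where k: "matrix_rank I J M = enat k" using assms by (cases "matrix_rank I J M") auto
  have bound: "card R \<le> k" if "R \<in> ?S" for R
  proof -
    have "enat (card R) \<le> matrix_rank I J M"
      unfolding matrix_rank_def using that by (rule SUP_upper)
    then show ?thesis using k by simp
  qed
  have "{} \<in> ?S" by (simp add: rows_independent_def)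
  from ex_has_greatest_nat[of "\<lambda>R. R \<in> ?S" "{}" card "Suc k", OF this] bound
  have "\<exists>R. R \<in> ?S \<and> (\<forall>R'. R' \<in> ?S \<longrightarrow> card R' \<le> card R)"
    by (simp add: less_Suc_eq_le)
  then obtain R where R: "R \<in> ?S" and max: "\<And>R'. R' \<in> ?S \<Longrightarrow> card R' \<le> card R"
    by (elim exE conjE) simp
  have "\<exists>c. \<forall>j\<in>J. M i j = (\<Sum>r\<in>R. c r * M r j)" if i: "i \<in> I" for i
  proof (cases "i \<in> R")
    case True
    have "M i j = (\<Sum>r\<in>R. (if r = i then 1 else 0) * M r j)" for j
      using True R by (simp add: sum.delta if_distrib[of "\<lambda>x. x * _"] cong: if_cong)
    then show ?thesis by (intro exI[of _ "\<lambda>r. if r = i then 1 else 0"]) blast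
  next
    case False
    have "insert i R \<notin> ?S"
      using max[of "insert i R"] False R by auto
    then have "\<not> rows_independent J M (insert i R)" using R i by auto
    then obtain c where c: "\<forall>j\<in>J. (\<Sum>r\<in>insert i R. c r * M r j) = 0" "\<exists>r\<in>insert i R. c r \<noteq> 0"
      unfolding rows_independent_def by blast
    have c': "c i * M i j + (\<Sum>r\<in>R. c r * M r j) = 0" if "j \<in> J" for j
      using c(1) that False R by simp
    \<comment> \<open>A dependence avoiding the new row would contradict independence of
      \<open>R\<close>; hence the equation can be solved for that row.\<close>
    have ci: "c i \<noteq> 0"
    proof
      assume "c i = 0"
      then have "\<forall>j\<in>J. (\<Sum>r\<in>R. c r * M r j) = 0" using c' by simp
      then have "\<forall>r\<in>R. c r = 0" using R unfolding rows_independent_def by blast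
      then show False using c(2) \<open>c i = 0\<close> by auto
    qed
    have "M i j = (\<Sum>r\<in>R. (- c r / c i) * M r j)" if "j \<in> J" for j
    proof -
      have "(\<Sum>r\<in>R. (- c r / c i) * M r j) = - (\<Sum>r\<in>R. c r * M r j) / c i"
        by (simp add: sum_divide_distrib sum_negf)
      also have "\<dots> = M i j" using c'[OF that] ci by (simp add: field_simps)
      finally show ?thesis ..
    qed
    then show ?thesis by (intro exI[of _ "\<lambda>r. - c r / c i"] ballI)
  qed
  then have "\<forall>i\<in>I. \<exists>c. \<forall>j\<in>J. M i j = (\<Sum>r\<in>R. c r * M r j)" by blast
  from bchoice[OF this] have "\<exists>C. \<forall>i\<in>I. \<forall>j\<in>J. M i j = (\<Sum>r\<in>R. C i r * M r j)" .
  then show ?thesis using R by blast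
qed

context nonzero_parameter
begin

text \<open>Graphs with common nodes inside \<open>{1, 2}\<close> become two-labeled graphs with
  product \<open>E + E'\<close> once both labels are adjoined to each. The factorised connection
  matrix thus separates the dependence on \<open>E\<close> from that on \<open>E'\<close>.\<close>

lemma edge_value_rank:
  assumes "connection_rank f 2 < \<infinity>"
  shows "\<exists>(m::nat) a b. \<forall>E E'. verts E \<inter> verts E' \<subseteq> {1, 2} \<longrightarrow> v (E + E') = (\<Sum>i<m. a i E * b i E')"
proof -
  obtain R C where R: "finite R" and C: "\<forall>A\<in>labeled_types 2. \<forall>B\<in>labeled_types 2.
      connection_matrix f 2 A B = (\<Sum>r\<in>R. C A r * connection_matrix f 2 r B)"
    using matrix_rank_factorization[OF assms[unfolded connection_rank_def]] by blast
  define N where "N E = {1, 2} \<union> verts (simple E)" for E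
  have N: "finite (N E)" "N E \<noteq> {}" "{1..2} \<subseteq> N E" "verts (simple E) \<subseteq> N E" for E
    by (auto simp: N_def)
  have "{1..2::nat} = {1, 2}" by auto
  let ?F = "\<lambda>E. mg (N E) (simple E)"
  let ?A = "\<lambda>E. iso_type 2 (?F E)"
  have lab: "labeled 2 (?F E)" for E
    unfolding labeled_def using N multigraph_mg by simp
  have ty: "?A E \<in> labeled_types 2" for E
    using lab by (auto simp: labeled_types_def)
  have main: "v (E + E') = (\<Sum>r\<in>R. (C (?A E) r / k1 ^ card (N E)) *
      (connection_matrix f 2 r (?A E') * k1 ^ 2 / k1 ^ card (N E')))"
    if d: "verts E \<inter> verts E' \<subseteq> {1, 2}" for E E'
  proof -
    have int: "N E \<inter> N E' = {1..2}"
      using d verts_simple[of E] verts_simple[of E'] \<open>{1..2::nat} = {1, 2}\<close> unfolding N_def by blast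
    have "connection_matrix f 2 (?A E) (?A E') = f (graph_union (?F E) (?F E'))"
      unfolding connection_matrix_def using int by (intro type_value_glue[OF param lab lab]) simp
    also have "graph_union (?F E) (?F E') = mg (N E \<union> N E') (simple (E + E'))"
      by (simp add: graph_union_def)
    also have "f \<dots> = k1 ^ card (N E \<union> N E') * v (E + E')"
      using N[of E] N[of E'] by (intro f_eq_edge_value) auto
    finally have 1: "k1 ^ card (N E \<union> N E') * v (E + E') = connection_matrix f 2 (?A E) (?A E')" ..
    \<comment> \<open>The two labels are counted in both node sets; this is the origin of the factor
      \<open>k1 ^ 2\<close>.\<close>
    have "card (N E) + card (N E') = card (N E \<union> N E') + card (N E \<inter> N E')"
      using N by (intro card_Un_Int)
    then have 2: "k1 ^ card (N E) * k1 ^ card (N E') = k1 ^ card (N E \<union> N E') * k1 ^ 2"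
      unfolding int power_add[symmetric] by simp
    have "k1 ^ card (N E) * k1 ^ card (N E') * v (E + E') =
        k1 ^ 2 * (k1 ^ card (N E \<union> N E') * v (E + E'))"
      unfolding 2 by (simp only: mult_ac)
    also have "\<dots> = k1 ^ 2 * (\<Sum>r\<in>R. C (?A E) r * connection_matrix f 2 r (?A E'))"
      unfolding 1 using C[rule_format, OF ty ty, of E E'] by (rule arg_cong)
    finally have "v (E + E') = k1 ^ 2 * (\<Sum>r\<in>R. C (?A E) r * connection_matrix f 2 r (?A E')) /
        (k1 ^ card (N E) * k1 ^ card (N E'))"
      using K1 by (subst eq_divide_eq) (simp add: mult.commute)
    also have "\<dots> = (\<Sum>r\<in>R. k1 ^ 2 * (C (?A E) r * connection_matrix f 2 r (?A E')) /
        (k1 ^ card (N E) * k1 ^ card (N E')))"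
      by (simp only: sum_distrib_left sum_divide_distrib)
    also have "\<dots> = (\<Sum>r\<in>R. (C (?A E) r / k1 ^ card (N E)) *
      (connection_matrix f 2 r (?A E') * k1 ^ 2 / k1 ^ card (N E')))"
      by (intro sum.cong refl) (simp only: times_divide_times_eq mult.commute mult.left_commute)
    finally show ?thesis .
  qed
  obtain h where h: "bij_betw h {0..<card R} R" using ex_bij_betw_nat_finite[OF R] by blast
  define a where "a i E = C (?A E) (h i) / k1 ^ card (N E)" for i E
  define b where "b i E = connection_matrix f 2 (h i) (?A E) * k1 ^ 2 / k1 ^ card (N E)" for i E
  have "v (E + E') = (\<Sum>i<card R. a i E * b i E')" if "verts E \<inter> verts E' \<subseteq> {1, 2}" for E E'
    unfolding lessThan_atLeast0 main[OF that] a_def b_def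
    by (rule sum.reindex_bij_betw[OF h, symmetric])
  then show ?thesis
    by (intro exI[of _ "card R"] exI[of _ a] exI[of _ b] allI impI)
qed

end

section \<open>Colours\<close>

text \<open>Gaussian elimination: a pivot \<open>p\<close> clears coordinate \<open>j\<close> from
  the other vectors, and a dependence among the results determines the coefficient of
  \<open>p\<close>.\<close>

lemma linear_dependence:
  fixes A :: "'k \<Rightarrow> 'i \<Rightarrow> real"
  assumes "finite J" "finite S" "card J < card S"
  shows "\<exists>c. (\<exists>k\<in>S. c k \<noteq> 0) \<and> (\<forall>i\<in>J. (\<Sum>k\<in>S. c k * A k i) = 0)"
  using assms
proof (induction J arbitrary: S A rule: finite_induct)
  case empty
  then have "S \<noteq> {}" by auto
  then show ?case by (intro exI[of _ "\<lambda>_. 1"]) auto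
next
  case (insert j J)
  show ?case
  proof (cases "\<forall>k\<in>S. A k j = 0")
    case True
    have "\<exists>c. (\<exists>k\<in>S. c k \<noteq> 0) \<and> (\<forall>i\<in>J. (\<Sum>k\<in>S. c k * A k i) = 0)"
      using insert.prems insert.hyps by (intro insert.IH) auto
    then obtain c where "\<exists>k\<in>S. c k \<noteq> 0" "\<forall>i\<in>J. (\<Sum>k\<in>S. c k * A k i) = 0"
      by (elim exE conjE)
    then show ?thesis using True by (intro exI[of _ c]) auto
  next
    case False
    then obtain p where p: "p \<in> S" "A p j \<noteq> 0" by blast
    define B where "B k i = A k i - A k j / A p j * A p i" for k i
    have "card J < card (S - {p})" using insert p by simp
    then have "\<exists>c. (\<exists>k\<in>S - {p}. c k \<noteq> 0) \<and> (\<forall>i\<in>J. (\<Sum>k\<in>S - {p}. c k * B k i) = 0)"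
      using insert.prems by (intro insert.IH) auto
    then obtain c where c: "\<exists>k\<in>S - {p}. c k \<noteq> 0" "\<forall>i\<in>J. (\<Sum>k\<in>S - {p}. c k * B k i) = 0"
      by (elim exE conjE)
    define d where "d k = (if k = p then - (\<Sum>k\<in>S - {p}. c k * A k j) / A p j else c k)" for k
    have "(\<Sum>k\<in>S. d k * A k i) = (\<Sum>k\<in>S - {p}. c k * B k i)" for i
    proof -
      have "(\<Sum>k\<in>S. d k * A k i) = d p * A p i + (\<Sum>k\<in>S - {p}. d k * A k i)"
        using insert p by (simp add: sum.remove)
      also have "(\<Sum>k\<in>S - {p}. d k * A k i) = (\<Sum>k\<in>S - {p}. c k * A k i)"
        by (intro sum.cong) (auto simp: d_def)
      also have "d p * A p i = - (\<Sum>k\<in>S - {p}. c k * (A k j / A p j * A p i))"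
        by (simp add: d_def sum_distrib_right sum_divide_distrib mult.assoc)
      finally show ?thesis by (simp add: B_def algebra_simps sum_subtractf)
    qed
    moreover have "B k j = 0" for k using p by (simp add: B_def)
    ultimately have "\<forall>i\<in>insert j J. (\<Sum>k\<in>S. d k * A k i) = 0" using c(2) by simp
    moreover have "\<exists>k\<in>S. d k \<noteq> 0" using c(1) by (auto simp: d_def)
    ultimately show ?thesis by blast
  qed
qed

text \<open>Abstract in \<phi> because two embeddings of the reals need it: into the complex
  numbers, and as constants among the polynomials in edge variables.\<close>

lemma poly_map_poly_hom:
  fixes \<phi> :: "real \<Rightarrow> 'a::comm_ring_1"
  assumes h: "\<phi> 0 = 0" "\<And>x y. \<phi> (x + y) = \<phi> x + \<phi> y" "\<And>x y. \<phi> (x * y) = \<phi> x * \<phi> y"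
  shows "poly (map_poly \<phi> (p + q)) x = poly (map_poly \<phi> p) x + poly (map_poly \<phi> q) x"
    and "poly (map_poly \<phi> (smult c p)) x = \<phi> c * poly (map_poly \<phi> p) x"
    and "poly (map_poly \<phi> (p * q)) x = poly (map_poly \<phi> p) x * poly (map_poly \<phi> q) x"
proof -
  have pc: "poly (map_poly \<phi> (pCons a r)) x = \<phi> a + x * poly (map_poly \<phi> r) x" for a r
    using h(1) by (simp add: map_poly_pCons)
  show add: "poly (map_poly \<phi> (p + q)) x = poly (map_poly \<phi> p) x + poly (map_poly \<phi> q) x" for p q
    by (induction p q rule: poly_induct2) (auto simp: pc h algebra_simps)
  show smult: "poly (map_poly \<phi> (smult c p)) x = \<phi> c * poly (map_poly \<phi> p) x" for c p
    by (induction p) (auto simp: pc h algebra_simps)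
  show "poly (map_poly \<phi> (p * q)) x = poly (map_poly \<phi> p) x * poly (map_poly \<phi> q) x"
    by (induction p) (auto simp: pc add smult h algebra_simps mult_pCons_left)
qed

text \<open>Take a complex root. If it is not real, the remainder modulo its real quadratic is
  linear and vanishes at a nonreal point, hence is zero. The quadratic is
  \<open>(x - b)^2 + c^2\<close>, a form suited to positivity arguments.\<close>

lemma real_poly_factor:
  fixes y :: "real poly"
  assumes "degree y > 0"
  shows "(\<exists>b. poly y b = 0) \<or> (\<exists>b c. c \<noteq> 0 \<and> [:b\<^sup>2 + c\<^sup>2, - 2 * b, 1:] dvd y)"
proof -
  let ?ev = "\<lambda>p. poly (map_poly complex_of_real p)"
  have hom: "?ev (p + q) x = ?ev p x + ?ev q x" "?ev (p * q) x = ?ev p x * ?ev q x" for p q x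
    by (rule poly_map_poly_hom; simp)+
  have "degree (map_poly complex_of_real y) = degree y"
    by (rule degree_map_poly) simp
  then have "\<not> constant (poly (map_poly complex_of_real y))"
    using assms constant_degree[of "map_poly complex_of_real y"] by simp
  then obtain z where z: "?ev y z = 0"
    using fundamental_theorem_of_algebra by blast
  obtain b c where bc: "z = Complex b c" by (cases z)
  show ?thesis
  proof (cases "c = 0")
    case True
    have "?ev p (complex_of_real b) = complex_of_real (poly p b)" for p
      by (induction p) (auto simp: map_poly_pCons)
    moreover have "z = complex_of_real b" using bc True by (simp add: complex_of_real_def)
    ultimately show ?thesis using z by auto
  next
    case False
    let ?q = "[:b\<^sup>2 + c\<^sup>2, - 2 * b, 1:]"
    define s where "s = y div ?q"
    define r where "r = y mod ?q"
    have y: "y = s * ?q + r" by (simp only: s_def r_def div_mult_mod_eq)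
    have qz: "?ev ?q z = 0"
      by (simp add: map_poly_pCons bc complex_eq_iff power2_eq_square algebra_simps)
    have "?ev r z = 0" using z unfolding y hom qz by simp
    moreover have "degree r < 2"
      using degree_mod_less'[of ?q y] by (cases "r = 0") (auto simp: r_def)
    then have r: "r = [:coeff r 0, coeff r 1:]"
      by (intro poly_eqI) (auto simp: coeff_pCons coeff_eq_0 numeral_2_eq_2 split: nat.split)
    ultimately have "?ev [:coeff r 0, coeff r 1:] z = 0" by (simp only:)
    then have "coeff r 1 * c = 0" "coeff r 0 + coeff r 1 * b = 0"
      by (simp_all add: map_poly_pCons bc complex_eq_iff mult.commute)
    then have "coeff r 1 = 0" "coeff r 0 = 0" using False by auto
    then have "r = 0" by (subst r) simp
    then have "y = s * ?q" using y by (simp only: add_0_right)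
    then have "?q dvd y" by (rule dvdI[OF trans[OF _ mult.commute]])
    then show ?thesis using False by blast
  qed
qed

section \<open>Polynomials in the edge variables\<close>

abbreviation cst :: "real \<Rightarrow> nat set multiset \<Rightarrow>\<^sub>0 real" where
  "cst \<equiv> Poly_Mapping.single 0"

abbreviation X :: "nat set \<Rightarrow> nat set multiset \<Rightarrow>\<^sub>0 real" where
  "X e \<equiv> Poly_Mapping.single {#e#} 1"

definition pev :: "nat set \<Rightarrow> real poly \<Rightarrow> nat set multiset \<Rightarrow>\<^sub>0 real" where
  "pev e g = poly (map_poly cst g) (X e)"

lemma cst_hom: "cst 0 = 0" "cst (x + y) = cst x + cst y" "cst (x * y) = cst x * cst y"
  by (simp_all add: single_add mult_single)

lemma pev_add: "pev e (g + h) = pev e g + pev e h"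
  and pev_smult: "pev e (smult c g) = cst c * pev e g"
  and pev_mult: "pev e (g * h) = pev e g * pev e h"
  unfolding pev_def by (rule poly_map_poly_hom; simp add: cst_hom)+

lemma pev_pCons: "pev e (pCons a g) = cst a + X e * pev e g"
  by (simp add: pev_def map_poly_pCons)

lemma pev_0 [simp]: "pev e 0 = 0" and pev_1 [simp]: "pev e 1 = 1"
  by (simp_all add: pev_def)

lemma pev_const: "pev e [:a:] = cst a"
  by (simp add: pev_pCons)

lemma pev_uminus: "pev e (- g) = - pev e g"
  using pev_add[of e g "- g"] by (simp add: eq_neg_iff_add_eq_0 add.commute)

lemma pev_diff: "pev e (g - h) = pev e g - pev e h"
  using pev_add[of e g "- h"] by (simp add: pev_uminus)

lemma pev_sum: "pev e (\<Sum>i\<in>I. g i) = (\<Sum>i\<in>I. pev e (g i))"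
  by (induction I rule: infinite_finite_induct) (auto simp: pev_add)

lemma X_power: "X e ^ n = Poly_Mapping.single (replicate_mset n e) 1"
  by (induction n) (auto simp: mult_single simp flip: single_one)

lemma pev_monom: "pev e (monom a n) = Poly_Mapping.single (replicate_mset n e) a"
proof -
  have "pev e (monom 1 n) = X e ^ n"
    by (induction n) (auto simp: monom_Suc pev_pCons cst_hom simp flip: one_pCons)
  then show ?thesis
    using pev_smult[of e a "monom 1 n"] by (simp add: smult_monom X_power mult_single)
qed

lemma lin_cst_mult: "lin v (cst c * a) = c * lin v a"
  by (simp add: lin_mult)

lemma lin_one: "lin v 1 = v {#}"
  unfolding single_one[symmetric] lin_single by simp

text \<open>What remains of the graph parameter: unit, invariance, independence of disjoint parts,
  positivity, and finite rank for overlaps inside \<open>{1, 2}\<close>.\<close>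

locale edge_functional =
  fixes v :: "nat set multiset \<Rightarrow> real"
  assumes v_empty: "v {#} = 1"
    and v_rename: "inj_on h (verts E) \<Longrightarrow> v (image_mset (image h) E) = v E"
    and v_disjoint: "verts E \<inter> verts E' = {} \<Longrightarrow> v (E + E') = v E * v E'"
    and v_psd: "lin v (a * a) \<ge> 0"
    and v_rank: "\<exists>(m::nat) a b. \<forall>E E'. verts E \<inter> verts E' \<subseteq> {1, 2} \<longrightarrow>
      v (E + E') = (\<Sum>i<m. a i E * b i E')"
begin

text \<open>The radical of the form \<open>lin v (a * b)\<close>. It is an ideal, and colours are
  constructed modulo it.\<close>

definition null :: "(nat set multiset \<Rightarrow>\<^sub>0 real) \<Rightarrow> bool" where
  "null a \<longleftrightarrow> (\<forall>b. lin v (a * b) = 0)"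

lemma null_0 [simp]: "null 0" by (simp add: null_def)

lemma null_add: "null a \<Longrightarrow> null b \<Longrightarrow> null (a + b)"
  by (simp add: null_def distrib_right lin_add)

lemma null_mult: "null a \<Longrightarrow> null (a * c)"
  by (simp add: null_def mult.assoc)

lemma null_mult_left: "null a \<Longrightarrow> null (c * a)"
  using null_mult[of a c] by (simp add: mult.commute)

lemma null_lin: "null a \<Longrightarrow> lin v a = 0"
  unfolding null_def by (metis mult.right_neutral)

lemma not_null_1: "\<not> null 1"
  using null_lin[of 1] v_empty by (auto simp: lin_one)

text \<open>Cauchy-Schwarz for a semidefinite form: the value at the square of
  \<open>cst s * y + b\<close> is affine in \<open>s\<close> and never negative, so its slope
  vanishes.\<close>

lemma null_of_square:
  assumes "lin v (y * y) = 0"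
  shows "null y"
  unfolding null_def
proof
  fix b
  have *: "0 \<le> 2 * s * lin v (y * b) + lin v (b * b)" for s
  proof -
    have "(cst s * y + b) * (cst s * y + b) = cst (s * s) * (y * y) + cst (2 * s) * (y * b) + b * b"
    proof -
      have "cst (2 * s) = cst s + cst s" by (simp flip: single_add)
      then show ?thesis by (simp add: cst_hom(3) algebra_simps)
    qed
    then have "lin v ((cst s * y + b) * (cst s * y + b)) = 2 * s * lin v (y * b) + lin v (b * b)"
      using assms by (simp add: lin_add lin_cst_mult)
    then show ?thesis using v_psd[of "cst s * y + b"] by simp
  qed
  show "lin v (y * b) = 0"
  proof (rule ccontr)
    assume nz: "lin v (y * b) \<noteq> 0"
    define s where "s = - (lin v (b * b) + 1) / (2 * lin v (y * b))"
    have "2 * s * lin v (y * b) = - (lin v (b * b) + 1)" using nz by (simp add: s_def)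
    then show False using *[of s] by linarith
  qed
qed

definition eqv :: "(nat set multiset \<Rightarrow>\<^sub>0 real) \<Rightarrow> (nat set multiset \<Rightarrow>\<^sub>0 real) \<Rightarrow> bool" (infix "\<doteq>" 50)
  where "a \<doteq> b \<longleftrightarrow> null (a - b)"

lemma eqv_refl [simp]: "a \<doteq> a" by (simp add: eqv_def)

lemma eqv_lin: "a \<doteq> b \<Longrightarrow> lin v a = lin v b"
  using null_lin[of "a - b"] by (simp add: eqv_def lin_diff)

lemma eqv_mult: "a \<doteq> b \<Longrightarrow> c \<doteq> d \<Longrightarrow> a * c \<doteq> b * d"
proof -
  assume "a \<doteq> b" "c \<doteq> d"
  then have "null ((a - b) * c + b * (c - d))"
    unfolding eqv_def by (intro null_add null_mult null_mult_left)
  then show ?thesis by (simp add: eqv_def algebra_simps)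
qed

lemma eqv_prod:
  "(\<And>i. i \<in> I \<Longrightarrow> a i \<doteq> b i) \<Longrightarrow> (\<Prod>i\<in>I. a i) \<doteq> (\<Prod>i\<in>I. b i)"
  by (induction I rule: infinite_finite_induct) (auto intro: eqv_mult)

lemma null_pev_iff:
  "null (pev e g) \<longleftrightarrow> (\<forall>E. (\<Sum>i\<le>degree g. coeff g i * v (replicate_mset i e + E)) = 0)"
proof -
  have "pev e (\<Sum>i\<le>degree g. monom (coeff g i) i) =
      (\<Sum>i\<le>degree g. Poly_Mapping.single (replicate_mset i e) (coeff g i))"
    by (simp only: pev_sum pev_monom)
  then have pe: "pev e g = (\<Sum>i\<le>degree g. Poly_Mapping.single (replicate_mset i e) (coeff g i))"
    by (simp only: poly_as_sum_of_monoms)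
  have lin: "lin v (pev e g * b) = lin (\<lambda>E. \<Sum>i\<le>degree g. coeff g i * v (replicate_mset i e + E)) b" for b
  proof -
    have "lin v (pev e g * b) = (\<Sum>i\<le>degree g. coeff g i * lin (\<lambda>E. v (replicate_mset i e + E)) b)"
      unfolding pe sum_distrib_right lin_sum by (simp add: lin_mult)
    also have "\<dots> = (\<Sum>i\<le>degree g. \<Sum>E\<in>Poly_Mapping.keys b. Poly_Mapping.lookup b E * (coeff g i * v (replicate_mset i e + E)))"
      by (simp add: lin_def sum_distrib_left mult_ac)
    also have "\<dots> = lin (\<lambda>E. \<Sum>i\<le>degree g. coeff g i * v (replicate_mset i e + E)) b"
      unfolding lin_def by (subst sum.swap) (simp add: sum_distrib_left)
    finally show ?thesis .
  qed
  show ?thesis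
  proof
    assume n: "null (pev e g)"
    show "\<forall>E. (\<Sum>i\<le>degree g. coeff g i * v (replicate_mset i e + E)) = 0"
    proof
      fix E
      have "lin v (pev e g * Poly_Mapping.single E 1) = 0" using n by (simp add: null_def)
      then show "(\<Sum>i\<le>degree g. coeff g i * v (replicate_mset i e + E)) = 0" by (simp add: lin)
    qed
  next
    assume "\<forall>E. (\<Sum>i\<le>degree g. coeff g i * v (replicate_mset i e + E)) = 0"
    then show "null (pev e g)" by (simp add: null_def lin) (simp add: lin_def)
  qed
qed

lemma null_pev_edge:
  assumes "null (pev {1, 2} g)" "card e = 2"
  shows "null (pev e g)"
  unfolding null_pev_iff
proof
  fix E :: "nat set multiset"
  obtain x y where e: "e = {x, y}" "x \<noteq> y" using assms(2) by (auto simp: card_2_iff)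
  \<comment> \<open>The first transposition moves \<open>x\<close> to \<open>1\<close>, the second
    moves the resulting image of \<open>y\<close> to \<open>2\<close>; it fixes \<open>1\<close>
    because that image is not \<open>1\<close>.\<close>
  define h where "h = Transposition.transpose 2 (Transposition.transpose 1 x y) \<circ> Transposition.transpose 1 x"
  have bij: "bij h" unfolding h_def by (intro bij_comp bij_transpose)
  have "Transposition.transpose 1 x y \<noteq> 1" using e(2) by (auto simp: Transposition.transpose_def)
  then have "h x = 1" "h y = 2"
    by (simp_all add: h_def)
  then have he: "h ` e = {1, 2}" using e by simp
  have inj: "inj_on h A" for A using bij by (meson bij_is_inj inj_on_subset subset_UNIV)
  have "v (replicate_mset i e + E) = v (replicate_mset i {1, 2} + image_mset (image h) E)" for i
    using v_rename[OF inj, of "replicate_mset i e + E"] he by simp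
  then show "(\<Sum>i\<le>degree g. coeff g i * v (replicate_mset i e + E)) = 0"
    using assms(1) unfolding null_pev_iff by simp
qed

text \<open>Powers of the edge \<open>{1, 2}\<close> meet every context \<open>E\<close> inside
  \<open>{1, 2}\<close>. Through the rank factorisation the \<open>m + 1\<close> powers of exponent
  at most \<open>m\<close> become vectors with \<open>m\<close> coordinates, and a dependence
  between these holds against all contexts at once.\<close>

lemma ex_null_poly: "\<exists>g. g \<noteq> 0 \<and> null (pev {1, 2} g)"
proof -
  obtain m :: nat and a b where ab: "\<forall>E E'. verts E \<inter> verts E' \<subseteq> {1, 2} \<longrightarrow>
      v (E + E') = (\<Sum>i<m. a i E * b i E')"
    using v_rank by (elim exE)
  have "\<exists>c. (\<exists>k\<in>{..m}. c k \<noteq> 0) \<and>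
      (\<forall>i\<in>{..<m}. (\<Sum>k\<in>{..m}. c k * a i (replicate_mset k {1, 2})) = 0)"
    by (rule linear_dependence) simp_all
  then obtain c where c: "\<exists>k\<in>{..m}. c k \<noteq> 0"
      "\<forall>i\<in>{..<m}. (\<Sum>k\<in>{..m}. c k * a i (replicate_mset k {1, 2})) = 0"
    by (elim exE conjE)
  define g where "g = (\<Sum>k\<le>m. monom (c k) k)"
  have cg: "coeff g k = (if k \<le> m then c k else 0)" for k
    by (simp add: g_def coeff_sum)
  have "g \<noteq> 0" using c(1) cg by (metis atMost_iff coeff_0)
  moreover have "null (pev {1, 2} g)"
    unfolding null_pev_iff
  proof
    fix E
    have vr: "verts (replicate_mset k {1, 2}) \<inter> verts E \<subseteq> {1, 2}" for k
      by (auto split: if_splits)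
    have "(\<Sum>k\<le>degree g. coeff g k * v (replicate_mset k {1, 2} + E)) =
        (\<Sum>k\<le>m. coeff g k * v (replicate_mset k {1, 2} + E))"
    proof (rule sum.mono_neutral_left)
      show "{..degree g} \<subseteq> {..m}" using degree_le[of m g] by (simp add: cg)
    qed (auto simp: coeff_eq_0)
    also have "\<dots> = (\<Sum>k\<le>m. c k * (\<Sum>i<m. a i (replicate_mset k {1, 2}) * b i E))"
      using ab[rule_format, OF vr] by (simp add: cg)
    also have "\<dots> = (\<Sum>i<m. (\<Sum>k\<le>m. c k * a i (replicate_mset k {1, 2})) * b i E)"
      unfolding sum_distrib_left sum_distrib_right by (subst sum.swap) (simp add: mult_ac)
    also have "\<dots> = 0" using c(2) by simp
    finally show "(\<Sum>k\<le>degree g. coeff g k * v (replicate_mset k {1, 2} + E)) = 0" .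
  qed
  ultimately show ?thesis by blast
qed

end

lemma degree_prod_linear:
  fixes L :: "real set"
  assumes "finite L"
  shows "degree (\<Prod>\<kappa>\<in>L. [:- \<kappa>, 1:]) = card L" "(\<Prod>\<kappa>\<in>L. [:- \<kappa>, 1:]) \<noteq> 0"
  using assms
proof (induction L rule: finite_induct)
  case (insert x L)
  case 1
  show ?case using insert by (simp add: degree_mult_eq del: mult_pCons_left)
next
  case (insert x L)
  case 2
  show ?case using insert by (simp del: mult_pCons_left)
qed auto

section \<open>Colours as roots of a null polynomial\<close>

context edge_functional
begin

lemma null_cst: "null (cst c * a) \<Longrightarrow> c \<noteq> 0 \<Longrightarrow> null a"
  using null_mult_left[of "cst c * a" "cst (1 / c)"]
  by (simp add: mult.assoc[symmetric] mult_single)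

text \<open>A null polynomial of least degree has only simple real roots: any other kind of factor
  produces, by positivity, a null polynomial of smaller degree.\<close>

lemma ex_roots: "\<exists>L. finite L \<and> null (pev {1, 2} (\<Prod>\<kappa>\<in>L. [:- \<kappa>, 1:]))"
proof -
  let ?P = "\<lambda>g. g \<noteq> 0 \<and> null (pev {1, 2} g)"
  let ?pr = "\<lambda>L::real set. \<Prod>\<kappa>\<in>L. [:- \<kappa>, 1:]"
  obtain g0 where "?P g0" using ex_null_poly by blast
  from ex_has_least_nat[of ?P, OF this, of degree]
  obtain g where g: "?P g" and least: "\<And>h. ?P h \<Longrightarrow> degree g \<le> degree h" by blast
  \<comment> \<open>Here \<open>g * y\<close> is the sum of the squares of
    \<open>(x - b) * y\<close> and \<open>c * y\<close>. Both have nonnegative value and the total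
    is zero, so \<open>y\<close> is null.\<close>
  have quad: False if cb: "c \<noteq> 0" "[:b\<^sup>2 + c\<^sup>2, - 2 * b, 1:] dvd g" for b c
  proof -
    let ?q = "[:b\<^sup>2 + c\<^sup>2, - 2 * b, 1:]"
    obtain y where y: "g = ?q * y" using cb(2) by (rule dvdE)
    have y0: "y \<noteq> 0" using g y by auto
    have "?q \<noteq> 0" by simp
    then have "degree g = 2 + degree y"
      using y0 unfolding y by (subst degree_mult_eq) auto
    then have nn: "\<not> null (pev {1, 2} y)" using least[of y] y0 by auto
    have q: "?q = [:- b, 1:] * [:- b, 1:] + [:c\<^sup>2:]" by (simp add: power2_eq_square)
    have "g * y = ([:- b, 1:] * y) * ([:- b, 1:] * y) + [:c\<^sup>2:] * (y * y)"
      unfolding y q by (simp only: distrib_right distrib_left mult_ac)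
    then have "pev {1, 2} g * pev {1, 2} y = pev {1, 2} ([:- b, 1:] * y) * pev {1, 2} ([:- b, 1:] * y) +
        cst (c\<^sup>2) * (pev {1, 2} y * pev {1, 2} y)"
      by (metis pev_add pev_mult pev_const)
    moreover have "lin v (pev {1, 2} g * pev {1, 2} y) = 0" using g by (simp add: null_def)
    ultimately have "lin v (pev {1, 2} ([:- b, 1:] * y) * pev {1, 2} ([:- b, 1:] * y)) +
        c\<^sup>2 * lin v (pev {1, 2} y * pev {1, 2} y) = 0"
      by (simp only: lin_add lin_cst_mult)
    moreover have "c\<^sup>2 * lin v (pev {1, 2} y * pev {1, 2} y) \<ge> 0" using v_psd by simp
    ultimately have "c\<^sup>2 * lin v (pev {1, 2} y * pev {1, 2} y) = 0"
      using v_psd[of "pev {1, 2} ([:- b, 1:] * y)"] by linarith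
    then have "lin v (pev {1, 2} y * pev {1, 2} y) = 0" using cb(1) by simp
    then show False using null_of_square nn by blast
  qed
  \<comment> \<open>Here \<open>g * y\<close> is the square of \<open>(x - b) * y\<close>, which
    would therefore be null although its degree is smaller by one.\<close>
  have double: False if "[:- b, 1:] * ([:- b, 1:] * y) = g" for b y
  proof -
    have y0: "y \<noteq> 0" using g that by auto
    have "degree g = 2 + degree y"
      using y0 unfolding that[symmetric] by (simp add: degree_mult_eq del: mult_pCons_left)
    moreover have "degree ([:- b, 1:] * y) = 1 + degree y"
      using y0 by (simp add: degree_mult_eq del: mult_pCons_left)
    ultimately have nn: "\<not> null (pev {1, 2} ([:- b, 1:] * y))"
      using least[of "[:- b, 1:] * y"] y0 by (auto simp del: mult_pCons_left)
    have "g * y = ([:- b, 1:] * y) * ([:- b, 1:] * y)"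
      unfolding that[symmetric] by (simp only: mult_ac)
    then have "pev {1, 2} g * pev {1, 2} y = pev {1, 2} ([:- b, 1:] * y) * pev {1, 2} ([:- b, 1:] * y)"
      by (metis pev_mult)
    moreover have "lin v (pev {1, 2} g * pev {1, 2} y) = 0" using g by (simp add: null_def)
    ultimately show False using null_of_square nn by metis
  qed
  let ?S = "\<lambda>L. finite L \<and> ?pr L dvd g"
  have "card L < Suc (degree g)" if "?S L" for L
    using that g dvd_imp_degree_le[of "?pr L" g] degree_prod_linear(1)[of L] by simp
  then have "\<exists>L. ?S L \<and> (\<forall>L'. ?S L' \<longrightarrow> card L' \<le> card L)"
    by (intro ex_has_greatest_nat[of ?S "{}" card "Suc (degree g)"]) auto
  then obtain L where L: "?S L" and max: "\<And>L'. ?S L' \<Longrightarrow> card L' \<le> card L"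
    by (elim exE conjE) simp
  obtain y where y: "g = ?pr L * y" using L by (auto elim: dvdE)
  \<comment> \<open>A root of the cofactor lying in \<open>L\<close> would be a double root of
    \<open>g\<close>; one outside \<open>L\<close> would enlarge \<open>L\<close>.\<close>
  have noroot: "poly y b \<noteq> 0" for b
  proof
    assume "poly y b = 0"
    then obtain z where z: "y = [:- b, 1:] * z" by (metis dvdE poly_eq_0_iff_dvd)
    show False
    proof (cases "b \<in> L")
      case True
      have "?pr L = [:- b, 1:] * ?pr (L - {b})" using L True by (simp only: prod.remove)
      then have "g = [:- b, 1:] * ([:- b, 1:] * (?pr (L - {b}) * z))"
        unfolding y z by (simp only: mult_ac)
      then show False using double by metis
    next
      case False
      have "?pr (insert b L) = [:- b, 1:] * ?pr L" using L False by (intro prod.insert) auto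
      then have "?pr (insert b L) * z = g"
        unfolding y z by (simp only: mult_ac)
      then have "?pr (insert b L) dvd g" by (metis dvd_triv_left)
      then show False using max[of "insert b L"] L False by simp
    qed
  qed
  have noquad: "\<not> [:b\<^sup>2 + c\<^sup>2, - 2 * b, 1:] dvd y" if "c \<noteq> 0" for b c
    using quad[OF that, of b] dvd_mult[of _ y "?pr L"] unfolding y by blast
  have "degree y = 0"
    using real_poly_factor[of y] noroot noquad by blast
  then obtain c where c: "y = [:c:]" by (rule degree_eq_zeroE)
  have "c \<noteq> 0" using g unfolding y c by auto
  moreover have "pev {1, 2} g = cst c * pev {1, 2} (?pr L)"
    unfolding y c pev_mult pev_const by (rule mult.commute)
  ultimately have "null (pev {1, 2} (?pr L))" using g null_cst by metis
  then show ?thesis using L by blast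
qed

definition colours :: "real set" where
  "colours = (SOME L. finite L \<and> null (pev {1, 2} (\<Prod>\<kappa>\<in>L. [:- \<kappa>, 1:])))"

lemma finite_colours [simp]: "finite colours"
  and null_colours: "null (pev {1, 2} (\<Prod>\<kappa>\<in>colours. [:- \<kappa>, 1:]))"
  using someI_ex[OF ex_roots] unfolding colours_def by blast+

text \<open>The empty product is \<open>1\<close>, which is not null because
  \<open>v {#} = 1\<close>.\<close>

lemma colours_nonempty: "colours \<noteq> {}"
  using null_colours not_null_1 by (auto simp del: One_nat_def)

text \<open>Lagrange interpolation at the colours yields the idempotent selecting one colour.\<close>

definition lagrange :: "real \<Rightarrow> real poly" where
  "lagrange \<kappa> = (\<Prod>\<mu>\<in>colours - {\<kappa>}. smult (1 / (\<kappa> - \<mu>)) [:- \<mu>, 1:])"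

lemma poly_lagrange:
  assumes "\<kappa> \<in> colours" "\<nu> \<in> colours"
  shows "poly (lagrange \<kappa>) \<nu> = (if \<nu> = \<kappa> then 1 else 0)"
proof (cases "\<nu> = \<kappa>")
  case True
  then show ?thesis unfolding lagrange_def poly_prod by (auto intro!: prod.neutral simp flip: diff_divide_distrib)
next
  case False
  then show ?thesis unfolding lagrange_def poly_prod using assms by (auto intro!: prod_zero)
qed

text \<open>The difference has degree below the number of colours but vanishes at every
  colour.\<close>

lemma sum_lagrange: "(\<Sum>\<kappa>\<in>colours. lagrange \<kappa>) = 1"
proof (rule ccontr)
  let ?p = "(\<Sum>\<kappa>\<in>colours. lagrange \<kappa>) - 1"
  assume "(\<Sum>\<kappa>\<in>colours. lagrange \<kappa>) \<noteq> 1"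
  then have p: "?p \<noteq> 0" by simp
  have pos: "card colours > 0" using colours_nonempty by (simp add: card_gt_0_iff)
  have "degree (lagrange \<kappa>) \<le> card colours - 1" if "\<kappa> \<in> colours" for \<kappa>
  proof -
    have "degree (lagrange \<kappa>) \<le> (\<Sum>\<mu>\<in>colours - {\<kappa>}. degree (smult (1 / (\<kappa> - \<mu>)) [:- \<mu>, 1:]))"
      unfolding lagrange_def by (rule order_trans[OF degree_prod_sum_le]) (simp_all add: comp_def)
    also have "\<dots> \<le> (\<Sum>\<mu>\<in>colours - {\<kappa>}. 1)"
      by (intro sum_mono) (simp add: degree_smult_eq)
    finally show ?thesis using that by simp
  qed
  then have "degree (\<Sum>\<kappa>\<in>colours. lagrange \<kappa>) \<le> card colours - 1" by (intro degree_sum_le) auto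
  then have "degree ?p \<le> card colours - 1" by (intro degree_diff_le) auto
  moreover have "poly ?p \<nu> = 0" if "\<nu> \<in> colours" for \<nu>
    using that by (simp add: poly_sum poly_lagrange sum.delta)
  then have "card colours \<le> card {x. poly ?p x = 0}"
    using poly_roots_finite[OF p] by (intro card_mono) auto
  moreover have "card {x. poly ?p x = 0} \<le> degree ?p" by (rule card_poly_roots_bound[OF p])
  ultimately show False using pos by linarith
qed

text \<open>Modulo null elements, the indicator of the event that the pair \<open>e\<close> has
  colour \<kappa>.\<close>

definition sel :: "nat set \<Rightarrow> real \<Rightarrow> nat set multiset \<Rightarrow>\<^sub>0 real" where
  "sel e \<kappa> = pev e (lagrange \<kappa>)"

lemma sum_sel: "(\<Sum>\<kappa>\<in>colours. sel e \<kappa>) = 1"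
  by (simp only: sel_def pev_sum[symmetric] sum_lagrange pev_1)

text \<open>\<open>g - g(\<kappa>)\<close> is divisible by \<open>x - \<kappa>\<close>, and
  \<open>x - \<kappa>\<close> times \<open>lagrange \<kappa>\<close> is a scalar multiple of the
  null polynomial. Hence the edge variable acts on \<open>sel e \<kappa>\<close> as the number
  \<kappa>.\<close>

lemma pev_sel:
  assumes "card e = 2" "\<kappa> \<in> colours"
  shows "pev e g * sel e \<kappa> \<doteq> cst (poly g \<kappa>) * sel e \<kappa>"
proof -
  let ?pr = "\<Prod>\<kappa>\<in>colours. [:- \<kappa>, 1:]"
  have "poly (g - [:poly g \<kappa>:]) \<kappa> = 0" by simp
  then obtain q where q: "g - [:poly g \<kappa>:] = [:- \<kappa>, 1:] * q" by (metis dvdE poly_eq_0_iff_dvd)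
  have "lagrange \<kappa> = smult (\<Prod>\<mu>\<in>colours - {\<kappa>}. 1 / (\<kappa> - \<mu>)) (\<Prod>\<mu>\<in>colours - {\<kappa>}. [:- \<mu>, 1:])"
    unfolding lagrange_def by (rule prod_smult)
  moreover have "?pr = [:- \<kappa>, 1:] * (\<Prod>\<mu>\<in>colours - {\<kappa>}. [:- \<mu>, 1:])"
    using assms by (simp only: prod.remove finite_colours)
  ultimately have l: "[:- \<kappa>, 1:] * lagrange \<kappa> = smult (\<Prod>\<mu>\<in>colours - {\<kappa>}. 1 / (\<kappa> - \<mu>)) ?pr"
    by (simp only: mult_smult_right)
  have "pev e g * sel e \<kappa> - cst (poly g \<kappa>) * sel e \<kappa> = pev e ((g - [:poly g \<kappa>:]) * lagrange \<kappa>)"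
    unfolding sel_def pev_mult pev_diff pev_const by (simp only: left_diff_distrib)
  also have "(g - [:poly g \<kappa>:]) * lagrange \<kappa> = ([:- \<kappa>, 1:] * lagrange \<kappa>) * q"
    unfolding q by (simp only: mult_ac)
  also have "pev e \<dots> = cst (\<Prod>\<mu>\<in>colours - {\<kappa>}. 1 / (\<kappa> - \<mu>)) * pev e ?pr * pev e q"
    unfolding l by (simp only: pev_mult pev_smult)
  also have "null \<dots>"
    using null_pev_edge[OF null_colours assms(1)] by (intro null_mult null_mult_left)
  finally show ?thesis by (simp add: eqv_def)
qed

lemma single_prod:
  "(\<Prod>e\<in>I. Poly_Mapping.single (m e) (1 :: real)) = Poly_Mapping.single (\<Sum>e\<in>I. m e) 1"
  by (induction I rule: infinite_finite_induct) (auto simp: mult_single)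

lemma single_eq_prod_X:
  assumes "finite Q" "set_mset E \<subseteq> Q"
  shows "Poly_Mapping.single E 1 = (\<Prod>e\<in>Q. X e ^ count E e)"
proof -
  have "(\<Sum>e\<in>Q. replicate_mset (count E e) e) = E"
    using assms by (intro multiset_eqI)
      (auto simp: count_sum sum.delta not_in_iff[symmetric] cong: if_cong)
  then show ?thesis by (simp add: X_power single_prod)
qed

lemma X_eq_pev: "X e ^ n = pev e ([:0, 1:] ^ n)"
proof -
  have "pev e [:0, 1:] = X e" by (simp add: pev_pCons)
  then show ?thesis
    by (induction n) (auto simp: pev_mult simp del: mult_pCons_left mult_pCons_right)
qed

lemma cst_prod: "cst (\<Prod>i\<in>I. c i) = (\<Prod>i\<in>I. cst (c i))"
  by (induction I rule: infinite_finite_induct) (auto simp: cst_hom(3))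

text \<open>Spectral decomposition: the products of selectors are idempotent modulo null elements,
  so each value is that of a square, and they sum to \<open>1\<close>. Multiplying a monomial by
  such a product evaluates it at the colouring.\<close>

theorem colouring_weights:
  assumes Q: "finite Q" "\<And>e. e \<in> Q \<Longrightarrow> card e = 2"
  obtains P where "\<And>c. c \<in> Q \<rightarrow>\<^sub>E colours \<Longrightarrow> P c \<ge> 0"
    and "\<And>E. set_mset E \<subseteq> Q \<Longrightarrow> v E = (\<Sum>c\<in>Q \<rightarrow>\<^sub>E colours. P c * (\<Prod>e\<in>Q. c e ^ count E e))"
proof -
  let ?C = "Q \<rightarrow>\<^sub>E colours"
  define s where "s c = (\<Prod>e\<in>Q. sel e (c e))" for c
  have mult: "(\<Prod>e\<in>Q. pev e (g e)) * s c \<doteq> cst (\<Prod>e\<in>Q. poly (g e) (c e)) * s c" if "c \<in> ?C" for c g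
    unfolding s_def cst_prod prod.distrib[symmetric]
    using that Q by (intro eqv_prod pev_sel) auto
  have "lin v (s c) \<ge> 0" if "c \<in> ?C" for c
  proof -
    have "(\<Prod>e\<in>Q. poly (lagrange (c e)) (c e)) = 1"
      using poly_lagrange PiE_mem[OF that] by (intro prod.neutral ballI) simp
    then have "s c * s c \<doteq> s c"
      using mult[OF that, of "\<lambda>e. lagrange (c e)"] by (simp add: s_def sel_def)
    then show ?thesis using eqv_lin v_psd by metis
  qed
  moreover have "v E = (\<Sum>c\<in>?C. lin v (s c) * (\<Prod>e\<in>Q. c e ^ count E e))" if E: "set_mset E \<subseteq> Q" for E
  proof -
    have one: "(\<Sum>c\<in>?C. s c) = 1"
      unfolding s_def using prod_sum_PiE[OF Q(1), of "\<lambda>_. colours" sel] by (simp add: sum_sel)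
    have "v E = lin v (Poly_Mapping.single E 1 * (\<Sum>c\<in>?C. s c))" by (simp add: one)
    also have "\<dots> = (\<Sum>c\<in>?C. lin v (Poly_Mapping.single E 1 * s c))"
      by (simp only: sum_distrib_left lin_sum)
    also have "\<dots> = (\<Sum>c\<in>?C. lin v (s c) * (\<Prod>e\<in>Q. c e ^ count E e))"
    proof (rule sum.cong[OF refl])
      fix c assume c: "c \<in> ?C"
      have "Poly_Mapping.single E 1 * s c \<doteq> cst (\<Prod>e\<in>Q. c e ^ count E e) * s c"
        using mult[OF c, of "\<lambda>e. [:0, 1:] ^ count E e"]
        unfolding single_eq_prod_X[OF Q(1) E] X_eq_pev by simp
      then show "lin v (Poly_Mapping.single E 1 * s c) = lin v (s c) * (\<Prod>e\<in>Q. c e ^ count E e)"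
        using eqv_lin by (fastforce simp: lin_cst_mult)
    qed
    finally show ?thesis .
  qed
  ultimately show thesis using that[of "\<lambda>c. lin v (s c)"] by blast
qed

end

section \<open>Homomorphism densities of colourings\<close>

lemma sum_PiE_insert:
  assumes "finite A" "finite S" "a \<notin> A"
  shows "(\<Sum>\<psi>\<in>insert a A \<rightarrow>\<^sub>E S. g \<psi>) = (\<Sum>\<psi>\<in>A \<rightarrow>\<^sub>E S. \<Sum>x\<in>S. g (\<psi>(a := x)))"
proof -
  have "(\<Sum>\<psi>\<in>A \<rightarrow>\<^sub>E S. \<Sum>x\<in>S. g (\<psi>(a := x))) = (\<Sum>(\<psi>, x)\<in>(A \<rightarrow>\<^sub>E S) \<times> S. g (\<psi>(a := x)))"
    by (rule sum.cartesian_product)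
  also have "\<dots> = (\<Sum>\<psi>\<in>insert a A \<rightarrow>\<^sub>E S. g \<psi>)"
    using assms(3)
    by (intro sum.reindex_bij_witness[of _ "\<lambda>\<psi>. (\<psi>(a := undefined), \<psi> a)" "\<lambda>(\<psi>, x). \<psi>(a := x)"])
      (auto simp: PiE_def extensional_def)
  finally show ?thesis ..
qed

definition ev :: "(nat set \<Rightarrow> real) \<Rightarrow> (nat set multiset \<Rightarrow>\<^sub>0 real) \<Rightarrow> real" where
  "ev w a = lin (\<lambda>E. prod_mset (image_mset w E)) a"

lemma ev_single: "ev w (Poly_Mapping.single E c) = c * prod_mset (image_mset w E)"
  by (simp add: ev_def)

lemma ev_cst [simp]: "ev w (cst c) = c"
  by (simp add: ev_single)

lemma ev_zero [simp]: "ev w 0 = 0" and ev_one [simp]: "ev w 1 = 1"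
  using ev_cst[of w 1] by (simp_all add: ev_def)

lemma ev_add: "ev w (a + b) = ev w a + ev w b"
  and ev_diff: "ev w (a - b) = ev w a - ev w b"
  by (simp_all add: ev_def lin_add lin_diff)

lemma ev_sum: "ev w (\<Sum>i\<in>I. a i) = (\<Sum>i\<in>I. ev w (a i))"
  by (simp add: ev_def lin_sum)

lemma ev_mult: "ev w (a * b) = ev w a * ev w b"
  unfolding ev_def lin_mult unfolding lin_def unfolding sum_product unfolding sum_distrib_left
  by (intro sum.cong refl) (simp add: mult_ac)

lemma ev_prod: "ev w (\<Prod>i\<in>I. a i) = (\<Prod>i\<in>I. ev w (a i))"
  by (induction I rule: infinite_finite_induct) (auto simp: ev_mult)

lemma ev_pev: "ev w (pev e g) = poly g (w e)"
  by (induction g) (auto simp: pev_pCons ev_add ev_mult ev_single)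

definition supp :: "nat set \<Rightarrow> (nat set multiset \<Rightarrow>\<^sub>0 real) \<Rightarrow> bool" where
  "supp U a \<longleftrightarrow> (\<forall>E\<in>Poly_Mapping.keys a. \<forall>e\<in>#E. e \<subseteq> U \<and> card e = 2)"

lemma supp_single: "(\<And>e. e \<in># E \<Longrightarrow> e \<subseteq> U \<and> card e = 2) \<Longrightarrow> supp U (Poly_Mapping.single E c)"
  by (simp add: supp_def)

lemma supp_cst [simp]: "supp U (cst c)"
  by (simp add: supp_def)

lemma supp_zero [simp]: "supp U 0" and supp_one [simp]: "supp U 1"
  by (simp_all add: supp_def)

lemma supp_add: "supp U a \<Longrightarrow> supp U b \<Longrightarrow> supp U (a + b)"
  unfolding supp_def using keys_add[of a b] by blast

lemma supp_mult: "supp U a \<Longrightarrow> supp U b \<Longrightarrow> supp U (a * b)"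
  unfolding supp_def using keys_mult[of a b] by fastforce

lemma supp_uminus: "supp U a \<Longrightarrow> supp U (- a)"
  by (simp add: supp_def in_keys_iff)

lemma supp_diff: "supp U a \<Longrightarrow> supp U b \<Longrightarrow> supp U (a - b)"
  using supp_add[of U a "- b"] supp_uminus by simp

lemma supp_sum: "(\<And>i. i \<in> I \<Longrightarrow> supp U (a i)) \<Longrightarrow> supp U (\<Sum>i\<in>I. a i)"
  by (induction I rule: infinite_finite_induct) (auto intro: supp_add)

lemma supp_prod: "(\<And>i. i \<in> I \<Longrightarrow> supp U (a i)) \<Longrightarrow> supp U (\<Prod>i\<in>I. a i)"
  by (induction I rule: infinite_finite_induct) (auto intro: supp_mult)

lemma supp_mono: "supp U a \<Longrightarrow> U \<subseteq> U' \<Longrightarrow> supp U' a"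
  unfolding supp_def by blast

lemma supp_pev: "e \<subseteq> U \<Longrightarrow> card e = 2 \<Longrightarrow> supp U (pev e g)"
  by (induction g) (auto simp: pev_pCons intro!: supp_add supp_mult supp_single)

text \<open>Noninjective maps \<open>\<psi>\<close> evaluate the colouring \<open>w\<close> at loops \<open>{x}\<close>.\<close>

definition dens :: "nat set \<Rightarrow> (nat set multiset \<Rightarrow>\<^sub>0 real) \<Rightarrow> nat \<Rightarrow> (nat set \<Rightarrow> real) \<Rightarrow> real" where
  "dens U a T w = (\<Sum>\<psi>\<in>U \<rightarrow>\<^sub>E {..<T}. ev (\<lambda>e. w (\<psi> ` e)) a) / real T ^ card U"

lemma ev_cong_supp:
  assumes "supp U a" "\<And>e. e \<subseteq> U \<Longrightarrow> w e = w' e"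
  shows "ev w a = ev w' a"
  unfolding ev_def
proof (rule lin_cong)
  fix E assume "E \<in> Poly_Mapping.keys a"
  then have "image_mset w E = image_mset w' E"
    using assms by (intro image_mset_cong) (auto simp: supp_def)
  then show "prod_mset (image_mset w E) = prod_mset (image_mset w' E)" by simp
qed

lemma sum_PiE_disjoint:
  assumes "finite U" "finite U'" "U \<inter> U' = {}"
  shows "(\<Sum>\<psi>\<in>U \<union> U' \<rightarrow>\<^sub>E S. f (restrict \<psi> U) * g (restrict \<psi> U')) =
    (\<Sum>\<psi>\<in>U \<rightarrow>\<^sub>E S. f \<psi>) * (\<Sum>\<psi>\<in>U' \<rightarrow>\<^sub>E S. g \<psi> :: real)"
proof -
  have "(\<Sum>\<psi>\<in>U \<rightarrow>\<^sub>E S. f \<psi>) * (\<Sum>\<psi>\<in>U' \<rightarrow>\<^sub>E S. g \<psi>) =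
      (\<Sum>(\<psi>, \<psi>')\<in>(U \<rightarrow>\<^sub>E S) \<times> (U' \<rightarrow>\<^sub>E S). f \<psi> * g \<psi>')"
    by (simp add: sum_product sum.cartesian_product)
  also have "\<dots> = (\<Sum>\<psi>\<in>U \<union> U' \<rightarrow>\<^sub>E S. f (restrict \<psi> U) * g (restrict \<psi> U'))"
  proof (rule sum.reindex_bij_witness[of _ "\<lambda>\<psi>. (restrict \<psi> U, restrict \<psi> U')"
        "\<lambda>(\<psi>, \<psi>') x. if x \<in> U then \<psi> x else \<psi>' x"])
    fix p assume p: "p \<in> (U \<rightarrow>\<^sub>E S) \<times> (U' \<rightarrow>\<^sub>E S)"
    obtain a b where ab: "p = (a, b)" "a \<in> U \<rightarrow>\<^sub>E S" "b \<in> U' \<rightarrow>\<^sub>E S" using p by auto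
    have "restrict (\<lambda>x. if x \<in> U then a x else b x) U = a"
      using ab(2) by (auto simp: PiE_def extensional_def fun_eq_iff)
    moreover have "restrict (\<lambda>x. if x \<in> U then a x else b x) U' = b"
      using ab(3) assms(3) by (auto simp: PiE_def extensional_def fun_eq_iff)
    ultimately show "(restrict (case p of (\<psi>, \<psi>') \<Rightarrow> \<lambda>x. if x \<in> U then \<psi> x else \<psi>' x) U,
        restrict (case p of (\<psi>, \<psi>') \<Rightarrow> \<lambda>x. if x \<in> U then \<psi> x else \<psi>' x) U') = p"
      and "f (restrict (case p of (\<psi>, \<psi>') \<Rightarrow> \<lambda>x. if x \<in> U then \<psi> x else \<psi>' x) U) *
        g (restrict (case p of (\<psi>, \<psi>') \<Rightarrow> \<lambda>x. if x \<in> U then \<psi> x else \<psi>' x) U') =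
        (case p of (\<psi>, \<psi>') \<Rightarrow> f \<psi> * g \<psi>')"
      by (simp_all add: ab(1))
    show "(case p of (\<psi>, \<psi>') \<Rightarrow> \<lambda>x. if x \<in> U then \<psi> x else \<psi>' x) \<in> U \<union> U' \<rightarrow>\<^sub>E S"
      using ab by (auto simp: PiE_def extensional_def)
  next
    fix \<psi> assume \<psi>: "\<psi> \<in> U \<union> U' \<rightarrow>\<^sub>E S"
    show "(case (restrict \<psi> U, restrict \<psi> U') of (\<psi>, \<psi>') \<Rightarrow> \<lambda>x. if x \<in> U then \<psi> x else \<psi>' x) = \<psi>"
      using \<psi> by (auto simp: PiE_def extensional_def fun_eq_iff)
    show "(restrict \<psi> U, restrict \<psi> U') \<in> (U \<rightarrow>\<^sub>E S) \<times> (U' \<rightarrow>\<^sub>E S)"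
      using \<psi> by auto
  qed
  finally show ?thesis ..
qed

text \<open>Exact, with no error term, because \<open>dens\<close> averages over all maps and not
  only over injective ones: maps of a disjoint union are pairs of maps.\<close>

lemma dens_mult:
  assumes "finite U" "finite U'" "U \<inter> U' = {}" "supp U a" "supp U' a'"
  shows "dens (U \<union> U') (a * a') T w = dens U a T w * dens U' a' T w"
proof -
  have "(\<Sum>\<psi>\<in>U \<union> U' \<rightarrow>\<^sub>E {..<T}. ev (\<lambda>e. w (\<psi> ` e)) (a * a')) =
      (\<Sum>\<psi>\<in>U \<union> U' \<rightarrow>\<^sub>E {..<T}. ev (\<lambda>e. w (restrict \<psi> U ` e)) a * ev (\<lambda>e. w (restrict \<psi> U' ` e)) a')"
  proof (rule sum.cong[OF refl])
    fix \<psi> :: "nat \<Rightarrow> nat"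
    have im: "restrict \<psi> V ` e = \<psi> ` e" if "e \<subseteq> V" for e V
      using that by (intro image_cong) auto
    have "ev (\<lambda>e. w (\<psi> ` e)) a = ev (\<lambda>e. w (restrict \<psi> U ` e)) a"
      using im by (intro ev_cong_supp[OF assms(4)]) simp
    moreover have "ev (\<lambda>e. w (\<psi> ` e)) a' = ev (\<lambda>e. w (restrict \<psi> U' ` e)) a'"
      using im by (intro ev_cong_supp[OF assms(5)]) simp
    ultimately show "ev (\<lambda>e. w (\<psi> ` e)) (a * a') =
        ev (\<lambda>e. w (restrict \<psi> U ` e)) a * ev (\<lambda>e. w (restrict \<psi> U' ` e)) a'"
      by (simp add: ev_mult)
  qed
  also have "\<dots> = (\<Sum>\<psi>\<in>U \<rightarrow>\<^sub>E {..<T}. ev (\<lambda>e. w (\<psi> ` e)) a) * (\<Sum>\<psi>\<in>U' \<rightarrow>\<^sub>E {..<T}. ev (\<lambda>e. w (\<psi> ` e)) a')"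
    by (rule sum_PiE_disjoint[OF assms(1-3)])
  finally show ?thesis
    using assms by (simp add: dens_def card_Un_disjoint power_add)
qed

lemma dens_rename:
  assumes U: "finite U" and h: "inj_on h U" and E: "\<And>e. e \<in># E \<Longrightarrow> e \<subseteq> U"
  shows "dens (h ` U) (Poly_Mapping.single (image_mset (image h) E) c) T w = dens U (Poly_Mapping.single E c) T w"
proof -
  define k where "k = the_inv_into U h"
  have kh: "k (h x) = x" if "x \<in> U" for x using the_inv_into_f_f[OF h that] by (simp add: k_def)
  have hk: "h (k y) = y" "k y \<in> U" if "y \<in> h ` U" for y using that kh by auto
  have "(\<Sum>\<psi>\<in>h ` U \<rightarrow>\<^sub>E {..<T}. ev (\<lambda>e. w (\<psi> ` e)) (Poly_Mapping.single (image_mset (image h) E) c)) =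
      (\<Sum>\<psi>\<in>U \<rightarrow>\<^sub>E {..<T}. ev (\<lambda>e. w (\<psi> ` e)) (Poly_Mapping.single E c))"
  proof (rule sum.reindex_bij_witness[of _ "\<lambda>\<psi>. \<lambda>y\<in>h ` U. \<psi> (k y)" "\<lambda>\<psi>. \<lambda>x\<in>U. \<psi> (h x)"])
    fix \<psi> assume p: "\<psi> \<in> h ` U \<rightarrow>\<^sub>E {..<T}"
    show "(\<lambda>y\<in>h ` U. (\<lambda>x\<in>U. \<psi> (h x)) (k y)) = \<psi>"
      using p hk by (auto simp: PiE_def extensional_def fun_eq_iff restrict_def)
    show "(\<lambda>x\<in>U. \<psi> (h x)) \<in> U \<rightarrow>\<^sub>E {..<T}" using p by auto
    have "image_mset (\<lambda>e. w (\<psi> ` h ` e)) E = image_mset (\<lambda>e. w ((\<lambda>x\<in>U. \<psi> (h x)) ` e)) E"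
    proof (rule image_mset_cong)
      fix e assume "e \<in># E"
      then have "(\<lambda>x\<in>U. \<psi> (h x)) ` e = \<psi> ` h ` e" using E[of e] by (force simp: image_image)
      then show "w (\<psi> ` h ` e) = w ((\<lambda>x\<in>U. \<psi> (h x)) ` e)" by simp
    qed
    then show "ev (\<lambda>e. w ((\<lambda>x\<in>U. \<psi> (h x)) ` e)) (Poly_Mapping.single E c) =
        ev (\<lambda>e. w (\<psi> ` e)) (Poly_Mapping.single (image_mset (image h) E) c)"
      by (simp add: ev_single image_mset.compositionality comp_def)
  next
    fix \<psi> assume p: "\<psi> \<in> U \<rightarrow>\<^sub>E {..<T}"
    show "(\<lambda>x\<in>U. (\<lambda>y\<in>h ` U. \<psi> (k y)) (h x)) = \<psi>"
      using p kh by (auto simp: PiE_def extensional_def fun_eq_iff restrict_def)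
    show "(\<lambda>y\<in>h ` U. \<psi> (k y)) \<in> h ` U \<rightarrow>\<^sub>E {..<T}" using p kh by auto
  qed
  then show ?thesis by (simp add: dens_def card_image[OF h])
qed

lemma dens_diff: "dens U (a - b) T w = dens U a T w - dens U b T w"
  by (simp add: dens_def ev_diff sum_subtractf diff_divide_distrib)

lemma dens_cst: "finite U \<Longrightarrow> T \<ge> 1 \<Longrightarrow> dens U (cst c) T w = c"
  by (simp add: dens_def card_PiE)

text \<open>Union bound over the pairs \<open>i\<close>, \<open>j\<close> with equal image, each of
  which removes one free coordinate.\<close>

lemma card_non_injective:
  assumes U: "finite U" and "T \<ge> 1"
  shows "real (card {\<psi> \<in> U \<rightarrow>\<^sub>E {..<T}. \<not> inj_on \<psi> U}) \<le> real (card U) ^ 2 * real T ^ card U / real T"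
proof -
  let ?D = "{(i, j) \<in> U \<times> U. i \<noteq> j}"
  let ?A = "\<lambda>(i, j). {\<psi> \<in> U \<rightarrow>\<^sub>E {..<T}. \<psi> i = \<psi> j}"
  have finD: "finite ?D" by (rule finite_subset[of _ "U \<times> U"]) (use U in auto)
  have finA: "finite (?A p)" for p using U by (auto simp: case_prod_unfold intro!: finite_PiE)
  have one: "card (?A p) \<le> T ^ (card U - 1)" if p: "p \<in> ?D" for p
  proof -
    obtain i j where ij: "p = (i, j)" "i \<in> U" "j \<in> U" "i \<noteq> j" using p by auto
    have "inj_on (\<lambda>\<psi>. restrict \<psi> (U - {j})) (?A p)"
    proof (rule inj_onI)
      fix \<psi> \<phi> assume a: "\<psi> \<in> ?A p" "\<phi> \<in> ?A p" "restrict \<psi> (U - {j}) = restrict \<phi> (U - {j})"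
      have eq: "\<psi> x = \<phi> x" if "x \<in> U - {j}" for x using fun_cong[OF a(3), of x] that by simp
      have "\<psi> i = \<psi> j" "\<phi> i = \<phi> j" using a(1,2) ij(1) by simp_all
      then have "\<psi> x = \<phi> x" if "x \<in> U" for x using eq[of x] eq[of i] ij that by (cases "x = j") auto
      then show "\<psi> = \<phi>" using a(1,2) ij(1) by (intro PiE_ext[of \<psi> U "\<lambda>_. {..<T}" \<phi>]) simp_all
    qed
    moreover have "(\<lambda>\<psi>. restrict \<psi> (U - {j})) ` ?A p \<subseteq> (U - {j}) \<rightarrow>\<^sub>E {..<T}"
      unfolding ij(1) by (auto dest: PiE_mem split: if_splits)
    ultimately have "card (?A p) \<le> card ((U - {j}) \<rightarrow>\<^sub>E {..<T})"
      using U by (intro card_inj_on_le) (auto intro!: finite_PiE)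
    also have "\<dots> = T ^ (card U - 1)" using U ij by (simp add: card_PiE)
    finally show ?thesis .
  qed
  have "{\<psi> \<in> U \<rightarrow>\<^sub>E {..<T}. \<not> inj_on \<psi> U} \<subseteq> (\<Union>p\<in>?D. ?A p)"
    by (auto simp: inj_on_def)
  then have "card {\<psi> \<in> U \<rightarrow>\<^sub>E {..<T}. \<not> inj_on \<psi> U} \<le> card (\<Union>p\<in>?D. ?A p)"
    using finD finA by (intro card_mono) auto
  also have "\<dots> \<le> (\<Sum>p\<in>?D. card (?A p))" by (rule card_UN_le[OF finD])
  also have "\<dots> \<le> (\<Sum>p\<in>?D. T ^ (card U - 1))" using one by (rule sum_mono)
  also have "\<dots> = card ?D * T ^ (card U - 1)" by simp
  also have "\<dots> \<le> card U ^ 2 * T ^ (card U - 1)"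
  proof -
    have "card ?D \<le> card (U \<times> U)" using U by (intro card_mono) auto
    then show ?thesis by (simp add: card_cartesian_product power2_eq_square)
  qed
  finally have "real (card {\<psi> \<in> U \<rightarrow>\<^sub>E {..<T}. \<not> inj_on \<psi> U}) \<le> real (card U ^ 2 * T ^ (card U - 1))"
    by (rule of_nat_mono)
  also have "\<dots> \<le> real (card U) ^ 2 * real T ^ card U / real T"
    using assms by (cases "card U") auto
  finally show ?thesis .
qed

section \<open>The twin distance as a graph density\<close>

definition kap :: "(nat set \<Rightarrow> real) \<Rightarrow> nat \<Rightarrow> nat \<Rightarrow> nat \<Rightarrow> real" where
  "kap w x z y = (if w {x, z} = w {z, y} then 1 else 0)"

definition agree :: "nat \<Rightarrow> (nat set \<Rightarrow> real) \<Rightarrow> nat \<Rightarrow> nat \<Rightarrow> real" where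
  "agree T w x y = (\<Sum>z<T. kap w x z y) / T"

text \<open>The squared distance of \<open>x\<close> and \<open>x'\<close> as rows of the matrix \<open>agree T w\<close>; it vanishes for twins.\<close>

definition sep :: "nat \<Rightarrow> (nat set \<Rightarrow> real) \<Rightarrow> nat \<Rightarrow> nat \<Rightarrow> real" where
  "sep T w x x' = (\<Sum>y<T. (agree T w x y - agree T w x' y)\<^sup>2) / T"

text \<open>Nodes \<open>1\<close> and \<open>2\<close> are the two nodes compared. Gadget
  \<open>i\<close> owns the column node \<open>3 * i + 3\<close> of the distance and two middle
  nodes, one for each factor of the square.\<close>

definition gadget_nodes :: "nat set \<Rightarrow> nat set" where
  "gadget_nodes I = {1, 2} \<union> (\<Union>i\<in>I. {3 * i + 3, 3 * i + 4, 3 * i + 5})"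

lemma gadget_nodes_insert:
  "gadget_nodes (insert j I) = insert (3 * j + 3) (insert (3 * j + 4) (insert (3 * j + 5) (gadget_nodes I)))"
  by (auto simp: gadget_nodes_def)

lemma finite_gadget_nodes: "finite I \<Longrightarrow> finite (gadget_nodes I)"
  by (simp add: gadget_nodes_def)

lemma gadget_nodes_fresh:
  assumes "j \<notin> I" "k \<in> {3, 4, 5}"
  shows "3 * j + k \<notin> gadget_nodes I"
proof
  assume "3 * j + k \<in> gadget_nodes I"
  then have "\<exists>i\<in>I. 3 * j + k \<in> {3 * i + 3, 3 * i + 4, 3 * i + 5}"
    using assms(2) by (auto simp: gadget_nodes_def)
  then obtain i where i: "i \<in> I" "3 * j + k \<in> {3 * i + 3, 3 * i + 4, 3 * i + 5}" by blast
  then have "i = j" using assms(2) by (elim insertE emptyE; presburger)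
  then show False using i assms by simp
qed

lemma card_gadget_nodes: "finite I \<Longrightarrow> card (gadget_nodes I) = 2 + 3 * card I"
proof (induction I rule: finite_induct)
  case empty
  then show ?case by (simp add: gadget_nodes_def)
next
  case (insert j I)
  then show ?case
    using gadget_nodes_fresh[of j I 3] gadget_nodes_fresh[of j I 4] gadget_nodes_fresh[of j I 5]
    by (simp add: gadget_nodes_insert finite_gadget_nodes)
qed

text \<open>Distinct gadgets share only nodes \<open>1\<close> and \<open>2\<close>, so once these
  are placed the sums over private nodes factor into equal terms. The arbitrary \<open>h\<close>
  absorbs the factors already summed out during the induction.\<close>

lemma sum_gadget:
  fixes G :: "nat \<Rightarrow> nat \<Rightarrow> nat \<Rightarrow> nat \<Rightarrow> nat \<Rightarrow> real"
  assumes "finite I" "finite S"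
  shows "(\<Sum>\<psi>\<in>gadget_nodes I \<rightarrow>\<^sub>E S. h (\<psi> 1) (\<psi> 2) *
      (\<Prod>i\<in>I. G (\<psi> 1) (\<psi> 2) (\<psi> (3 * i + 3)) (\<psi> (3 * i + 4)) (\<psi> (3 * i + 5)))) =
    (\<Sum>x\<in>S. \<Sum>y\<in>S. h x y * (\<Sum>a\<in>S. \<Sum>b\<in>S. \<Sum>c\<in>S. G x y a b c) ^ card I)"
  using assms(1)
proof (induction I arbitrary: h rule: finite_induct)
  case empty
  have "gadget_nodes {} = insert 1 (insert 2 {})" by (simp add: gadget_nodes_def)
  then show ?case
    using assms(2) by (simp add: sum_PiE_insert) (rule sum.swap)
next
  case (insert j I)
  let ?N = "gadget_nodes I"
  have fin: "finite ?N" using insert by (simp add: finite_gadget_nodes)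
  have fr: "3 * j + 3 \<notin> ?N" "3 * j + 4 \<notin> ?N" "3 * j + 5 \<notin> ?N"
    using gadget_nodes_fresh[OF insert(2)] by simp_all
  have ne: "3 * i + k \<noteq> 3 * j + l" if "i \<in> I" "k \<in> {3, 4, 5}" "l \<in> {3, 4, 5}" for i k l :: nat
  proof -
    have "i \<noteq> j" using that insert by auto
    then show ?thesis using that(2,3) by (elim insertE emptyE; presburger)
  qed
  let ?H = "\<lambda>x y. \<Sum>a\<in>S. \<Sum>b\<in>S. \<Sum>c\<in>S. G x y a b c"
  let ?P = "\<lambda>\<psi>. \<Prod>i\<in>I. G (\<psi> 1) (\<psi> 2) (\<psi> (3 * i + 3)) (\<psi> (3 * i + 4)) (\<psi> (3 * i + 5))"
  have "(\<Sum>\<psi>\<in>gadget_nodes (insert j I) \<rightarrow>\<^sub>E S. h (\<psi> 1) (\<psi> 2) *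
      (\<Prod>i\<in>insert j I. G (\<psi> 1) (\<psi> 2) (\<psi> (3 * i + 3)) (\<psi> (3 * i + 4)) (\<psi> (3 * i + 5)))) =
    (\<Sum>\<psi>\<in>gadget_nodes (insert j I) \<rightarrow>\<^sub>E S. h (\<psi> 1) (\<psi> 2) *
      (G (\<psi> 1) (\<psi> 2) (\<psi> (3 * j + 3)) (\<psi> (3 * j + 4)) (\<psi> (3 * j + 5)) * ?P \<psi>))"
    using insert by simp
  also have "\<dots> = (\<Sum>\<psi>\<in>?N \<rightarrow>\<^sub>E S. \<Sum>c\<in>S. \<Sum>b\<in>S. \<Sum>a\<in>S. h (\<psi> 1) (\<psi> 2) *
      (G (\<psi> 1) (\<psi> 2) a b c * ?P (\<psi>(3 * j + 5 := c, 3 * j + 4 := b, 3 * j + 3 := a))))"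
    unfolding gadget_nodes_insert using fin fr assms(2)
    by (subst sum_PiE_insert, simp, simp, simp)+ simp
  also have "\<dots> = (\<Sum>\<psi>\<in>?N \<rightarrow>\<^sub>E S. \<Sum>c\<in>S. \<Sum>b\<in>S. \<Sum>a\<in>S. h (\<psi> 1) (\<psi> 2) *
      (G (\<psi> 1) (\<psi> 2) a b c * ?P \<psi>))"
  proof -
    have "?P (\<psi>(3 * j + 5 := c, 3 * j + 4 := b, 3 * j + 3 := a)) = ?P \<psi>" for \<psi> a b c
      using ne insert.hyps(2) by (intro prod.cong refl) auto
    then show ?thesis by simp
  qed
  also have "\<dots> = (\<Sum>\<psi>\<in>?N \<rightarrow>\<^sub>E S. (h (\<psi> 1) (\<psi> 2) * ?H (\<psi> 1) (\<psi> 2)) * ?P \<psi>)"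
  proof (rule sum.cong[OF refl])
    fix \<psi> :: "nat \<Rightarrow> nat"
    have "(\<Sum>c\<in>S. \<Sum>b\<in>S. \<Sum>a\<in>S. G (\<psi> 1) (\<psi> 2) a b c) = ?H (\<psi> 1) (\<psi> 2)"
      by (subst sum.swap, subst (2) sum.swap, subst sum.swap) (rule refl)
    then show "(\<Sum>c\<in>S. \<Sum>b\<in>S. \<Sum>a\<in>S. h (\<psi> 1) (\<psi> 2) * (G (\<psi> 1) (\<psi> 2) a b c * ?P \<psi>)) =
        (h (\<psi> 1) (\<psi> 2) * ?H (\<psi> 1) (\<psi> 2)) * ?P \<psi>"
      by (simp only: sum_distrib_left[symmetric] sum_distrib_right[symmetric] mult.assoc)
  qed
  also have "\<dots> = (\<Sum>x\<in>S. \<Sum>y\<in>S. (h x y * ?H x y) * ?H x y ^ card I)"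
    by (rule insert.IH)
  also have "\<dots> = (\<Sum>x\<in>S. \<Sum>y\<in>S. h x y * ?H x y ^ card (insert j I))"
    using insert by (simp add: mult.assoc)
  finally show ?case .
qed

lemma abs_prod_mset_le:
  fixes w :: "'a \<Rightarrow> real"
  assumes "\<And>e. e \<in># E \<Longrightarrow> \<bar>w e\<bar> \<le> b" "b \<ge> 0"
  shows "\<bar>prod_mset (image_mset w E)\<bar> \<le> b ^ size E"
  using assms(1)
proof (induction E)
  case (add e E)
  then have "\<bar>w e\<bar> * \<bar>prod_mset (image_mset w E)\<bar> \<le> b * b ^ size E"
    using assms(2) by (intro mult_mono) auto
  then show ?case by (simp add: abs_mult)
qed simp

context edge_functional
begin

definition valid :: "nat \<Rightarrow> (nat set \<Rightarrow> real) \<Rightarrow> bool" where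
  "valid T w \<longleftrightarrow> (\<forall>x<T. \<forall>y<T. w {x, y} \<in> colours)"

text \<open>A finitely supported law \<open>p\<close> of colourings; the colours of loops are unconstrained.\<close>

definition sample :: "nat \<Rightarrow> (nat set \<Rightarrow> real) set \<Rightarrow> ((nat set \<Rightarrow> real) \<Rightarrow> real) \<Rightarrow> bool" where
  "sample T W p \<longleftrightarrow> finite W \<and> (\<forall>w\<in>W. p w \<ge> 0 \<and> valid T w) \<and>
     (\<forall>E. (\<forall>e\<in>#E. e \<subseteq> {..<T} \<and> card e = 2) \<longrightarrow>
        (\<Sum>w\<in>W. p w * prod_mset (image_mset w E)) = v E)"

lemma ex_sample: "\<exists>W p. sample T W p"
proof -
  define Q where "Q = {e. e \<subseteq> {..<T} \<and> card e = 2}"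
  have "Q \<subseteq> Pow {..<T}" by (auto simp: Q_def)
  then have Q: "finite Q" "\<And>e. e \<in> Q \<Longrightarrow> card e = 2"
    using finite_subset[of Q "Pow {..<T}"] by (auto simp: Q_def)
  obtain P where P: "\<And>c. c \<in> Q \<rightarrow>\<^sub>E colours \<Longrightarrow> P c \<ge> 0"
    "\<And>E. set_mset E \<subseteq> Q \<Longrightarrow> v E = (\<Sum>c\<in>Q \<rightarrow>\<^sub>E colours. P c * (\<Prod>e\<in>Q. c e ^ count E e))"
    using colouring_weights[OF Q] by blast
  obtain l0 where l0: "l0 \<in> colours" using colours_nonempty by blast
  let ?C = "Q \<rightarrow>\<^sub>E colours"
  \<comment> \<open>Loops must have a colour for \<open>valid\<close> to hold; a fixed colour
    \<open>l0\<close> is assigned to everything outside \<open>Q\<close>.\<close>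
  define ext where "ext c e = (if e \<in> Q then c e else l0)" for c :: "nat set \<Rightarrow> real" and e
  have rest: "restrict (ext c) Q = c" if "c \<in> ?C" for c
    using that by (auto simp: ext_def PiE_def extensional_def fun_eq_iff)
  have inj: "inj_on ext ?C" by (rule inj_on_inverseI[of _ "\<lambda>w. restrict w Q"]) (rule rest)
  define p where "p w = P (restrict w Q)" for w
  have "valid T (ext c)" if "c \<in> ?C" for c
    using that l0 PiE_mem[OF that] by (auto simp: valid_def ext_def)
  moreover have "(\<Sum>w\<in>ext ` ?C. p w * prod_mset (image_mset w E)) = v E"
    if E: "\<forall>e\<in>#E. e \<subseteq> {..<T} \<and> card e = 2" for E
  proof -
    have EQ: "set_mset E \<subseteq> Q" using E by (auto simp: Q_def)
    have "prod_mset (image_mset (ext c) E) = (\<Prod>e\<in>Q. c e ^ count E e)" for c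
    proof -
      have "prod_mset (image_mset (ext c) E) = (\<Prod>e\<in>set_mset E. ext c e ^ count E e)"
        by (rule image_prod_mset_multiplicity)
      also have "\<dots> = (\<Prod>e\<in>Q. ext c e ^ count E e)"
        using EQ Q(1) by (intro prod.mono_neutral_left) (auto simp: not_in_iff)
      finally show ?thesis by (simp add: ext_def)
    qed
    then show ?thesis
      using P(2)[OF EQ] rest by (simp add: sum.reindex[OF inj] p_def)
  qed
  ultimately have "sample T (ext ` ?C) p"
    using P(1) rest Q(1) unfolding sample_def by (auto simp: p_def intro!: finite_PiE)
  then show ?thesis by blast
qed

text \<open>Total mass is the moment of the empty monomial.\<close>

lemma sample_sum: "sample T W p \<Longrightarrow> (\<Sum>w\<in>W. p w) = 1"
  using v_empty unfolding sample_def by (auto dest: spec[of _ "{#}"])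

text \<open>By renaming invariance an injective placement has expectation exactly
  \<open>lin v a\<close>. The other placements form a proportion of order \<open>1 / T\<close> and
  contribute boundedly, uniformly in the law.\<close>

lemma expectation_dens:
  assumes U: "finite U" and a: "supp U a"
  shows "\<exists>C. \<forall>T\<ge>1. \<forall>W p. sample T W p \<longrightarrow> \<bar>(\<Sum>w\<in>W. p w * dens U a T w) - lin v a\<bar> \<le> C / real T"
proof -
  define b where "b = (\<Sum>l\<in>colours. \<bar>l\<bar>)"
  have b: "\<bar>l\<bar> \<le> b" if "l \<in> colours" for l
    unfolding b_def using that by (intro member_le_sum) auto
  have b0: "b \<ge> 0" by (simp add: b_def sum_nonneg)
  define B where "B = (\<Sum>E\<in>Poly_Mapping.keys a. \<bar>Poly_Mapping.lookup a E\<bar> * b ^ size E)"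
  \<comment> \<open>The first factor counts noninjective placements; the second bounds the deviation
    of each from the limit.\<close>
  define C where "C = real (card U) ^ 2 * (B + \<bar>lin v a\<bar>)"
  have B0: "B \<ge> 0" using b0 by (auto simp: B_def intro!: sum_nonneg)
  have main: "\<bar>(\<Sum>w\<in>W. p w * dens U a T w) - lin v a\<bar> \<le> C / real T" if T: "T \<ge> 1" and s: "sample T W p" for T W p
  proof -
    let ?F = "U \<rightarrow>\<^sub>E {..<T}"
    let ?G = "\<lambda>\<psi>. \<Sum>w\<in>W. p w * ev (\<lambda>e. w (\<psi> ` e)) a"
    have finF: "finite ?F" using U by (simp add: finite_PiE)
    have cF: "real (card ?F) = real T ^ card U" using U by (simp add: card_PiE)
    have bound: "\<bar>?G \<psi>\<bar> \<le> B" if \<psi>: "\<psi> \<in> ?F" for \<psi>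
    proof -
      have "\<bar>ev (\<lambda>e. w (\<psi> ` e)) a\<bar> \<le> B" if w: "w \<in> W" for w
      proof -
        have wb: "\<bar>w (\<psi> ` e)\<bar> \<le> b" if ee: "e \<subseteq> U" "card e = 2" for e
        proof -
          obtain x y where e: "e = {x, y}" using ee(2) by (auto simp: card_2_iff)
          have "\<psi> x < T" "\<psi> y < T" using e ee(1) \<psi> by auto
          then have "w {\<psi> x, \<psi> y} \<in> colours" using s w by (auto simp: sample_def valid_def)
          then show ?thesis using b e by simp
        qed
        have "\<bar>ev (\<lambda>e. w (\<psi> ` e)) a\<bar> \<le>
            (\<Sum>E\<in>Poly_Mapping.keys a. \<bar>Poly_Mapping.lookup a E * prod_mset (image_mset (\<lambda>e. w (\<psi> ` e)) E)\<bar>)"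
          unfolding ev_def lin_def by (rule sum_abs)
        also have "\<dots> \<le> B"
          unfolding B_def abs_mult using a wb b0
          by (intro sum_mono mult_left_mono abs_prod_mset_le) (auto simp: supp_def)
        finally show ?thesis .
      qed
      then have "\<bar>?G \<psi>\<bar> \<le> (\<Sum>w\<in>W. p w * B)"
        using s by (intro order_trans[OF sum_abs] sum_mono) (auto simp: sample_def abs_mult intro!: mult_left_mono)
      also have "\<dots> = B" using sample_sum[OF s] by (simp flip: sum_distrib_right)
      finally show ?thesis .
    qed
    have inj: "?G \<psi> = lin v a" if \<psi>: "\<psi> \<in> ?F" "inj_on \<psi> U" for \<psi>
    proof -
      have "?G \<psi> = (\<Sum>w\<in>W. \<Sum>E\<in>Poly_Mapping.keys a. Poly_Mapping.lookup a E *
          (p w * prod_mset (image_mset w (image_mset (image \<psi>) E))))"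
        unfolding ev_def lin_def sum_distrib_left
        by (intro sum.cong refl) (simp add: image_mset.compositionality comp_def mult.left_commute)
      also have "\<dots> = (\<Sum>E\<in>Poly_Mapping.keys a. Poly_Mapping.lookup a E *
          (\<Sum>w\<in>W. p w * prod_mset (image_mset w (image_mset (image \<psi>) E))))"
        unfolding sum_distrib_left by (rule sum.swap)
      also have "\<dots> = (\<Sum>E\<in>Poly_Mapping.keys a. Poly_Mapping.lookup a E * v E)"
      proof (intro sum.cong refl arg_cong2[of _ _ _ _ "(*)"])
        fix E assume E: "E \<in> Poly_Mapping.keys a"
        have vs: "verts E \<subseteq> U" using a E unfolding supp_def by blast
        have "\<forall>e\<in>#image_mset (image \<psi>) E. e \<subseteq> {..<T} \<and> card e = 2"
        proof (intro ballI)
          fix e assume "e \<in># image_mset (image \<psi>) E"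
          then obtain e' where e': "e = \<psi> ` e'" "e' \<in># E" by auto
          then have "e' \<subseteq> U" "card e' = 2" using a E by (auto simp: supp_def)
          then show "e \<subseteq> {..<T} \<and> card e = 2"
            using e' \<psi> card_image[of \<psi> e'] inj_on_subset[OF \<psi>(2)] by auto
        qed
        then have "(\<Sum>w\<in>W. p w * prod_mset (image_mset w (image_mset (image \<psi>) E))) = v (image_mset (image \<psi>) E)"
          using s unfolding sample_def by blast
        also have "\<dots> = v E" using v_rename inj_on_subset[OF \<psi>(2) vs] by blast
        finally show "(\<Sum>w\<in>W. p w * prod_mset (image_mset w (image_mset (image \<psi>) E))) = v E" .
      qed
      finally show ?thesis by (simp add: lin_def)
    qed
    have "(\<Sum>w\<in>W. p w * dens U a T w) = (\<Sum>\<psi>\<in>?F. ?G \<psi>) / real T ^ card U"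
      unfolding dens_def sum_distrib_left sum_divide_distrib times_divide_eq_right by (rule sum.swap)
    moreover have "lin v a = (\<Sum>\<psi>\<in>?F. lin v a) / real T ^ card U"
      using T by (simp add: cF)
    ultimately have "(\<Sum>w\<in>W. p w * dens U a T w) - lin v a = (\<Sum>\<psi>\<in>?F. ?G \<psi> - lin v a) / real T ^ card U"
      by (simp add: sum_subtractf diff_divide_distrib)
    also have "(\<Sum>\<psi>\<in>?F. ?G \<psi> - lin v a) = (\<Sum>\<psi>\<in>{\<psi> \<in> ?F. \<not> inj_on \<psi> U}. ?G \<psi> - lin v a)"
      using finF inj by (intro sum.mono_neutral_right) auto
    also have "\<bar>\<dots> / real T ^ card U\<bar> \<le>
        (real (card {\<psi> \<in> ?F. \<not> inj_on \<psi> U}) * (B + \<bar>lin v a\<bar>)) / real T ^ card U"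
    proof -
      have "\<bar>\<Sum>\<psi>\<in>{\<psi> \<in> ?F. \<not> inj_on \<psi> U}. ?G \<psi> - lin v a\<bar> \<le>
          (\<Sum>\<psi>\<in>{\<psi> \<in> ?F. \<not> inj_on \<psi> U}. B + \<bar>lin v a\<bar>)"
        using bound by (intro order_trans[OF sum_abs] sum_mono) (smt (verit) mem_Collect_eq)
      then show ?thesis using T by (simp add: divide_right_mono)
    qed
    also have "\<dots> \<le> (real (card U) ^ 2 * real T ^ card U / real T * (B + \<bar>lin v a\<bar>)) / real T ^ card U"
      using card_non_injective[OF U T] B0 by (intro divide_right_mono mult_right_mono) auto
    also have "\<dots> = C / real T" using T by (simp add: C_def)
    finally show ?thesis .
  qed
  then show ?thesis by blast
qed

end

section \<open>Sampling\<close>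

context edge_functional
begin

text \<open>An upper bound on the mean suffices: it is closed under addition, so finitely many
  nonnegative requirements can be met by one sample point.\<close>

definition negligible :: "(nat \<Rightarrow> (nat set \<Rightarrow> real) \<Rightarrow> real) \<Rightarrow> bool" where
  "negligible \<Psi> \<longleftrightarrow> (\<exists>C. \<forall>T\<ge>1. \<forall>W p. sample T W p \<longrightarrow> (\<Sum>w\<in>W. p w * \<Psi> T w) \<le> C / real T)"

lemma negligible_add:
  assumes "negligible \<Psi>" "negligible \<Phi>"
  shows "negligible (\<lambda>T w. \<Psi> T w + \<Phi> T w)"
proof -
  obtain C D where C: "\<And>T W p. T \<ge> 1 \<Longrightarrow> sample T W p \<Longrightarrow> (\<Sum>w\<in>W. p w * \<Psi> T w) \<le> C / real T"
    and D: "\<And>T W p. T \<ge> 1 \<Longrightarrow> sample T W p \<Longrightarrow> (\<Sum>w\<in>W. p w * \<Phi> T w) \<le> D / real T"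
    using assms unfolding negligible_def by blast
  have "(\<Sum>w\<in>W. p w * (\<Psi> T w + \<Phi> T w)) \<le> (C + D) / real T" if "T \<ge> 1" "sample T W p" for T W p
    using C[OF that] D[OF that] by (simp add: distrib_left sum.distrib add_divide_distrib)
  then show ?thesis unfolding negligible_def by blast
qed

lemma negligible_zero: "negligible (\<lambda>T w. 0)"
  unfolding negligible_def by (rule exI[of _ 0]) simp

lemma negligible_sum:
  assumes "finite I" "\<And>i. i \<in> I \<Longrightarrow> negligible (\<Psi> i)"
  shows "negligible (\<lambda>T w. \<Sum>i\<in>I. \<Psi> i T w)"
  using assms by (induction I rule: finite_induct) (simp_all add: negligible_zero negligible_add)

lemma negligible_cong:
  assumes "negligible \<Psi>" "\<And>T w. T \<ge> 1 \<Longrightarrow> valid T w \<Longrightarrow> \<Phi> T w = \<Psi> T w"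
  shows "negligible \<Phi>"
proof -
  obtain C where C: "\<And>T W p. T \<ge> 1 \<Longrightarrow> sample T W p \<Longrightarrow> (\<Sum>w\<in>W. p w * \<Psi> T w) \<le> C / real T"
    using assms unfolding negligible_def by blast
  have "(\<Sum>w\<in>W. p w * \<Phi> T w) \<le> C / real T" if T: "T \<ge> 1" and s: "sample T W p" for T W p
  proof -
    have "(\<Sum>w\<in>W. p w * \<Phi> T w) = (\<Sum>w\<in>W. p w * \<Psi> T w)"
      using s assms(2)[OF T] by (intro sum.cong refl) (simp add: sample_def)
    then show ?thesis using C[OF T s] by simp
  qed
  then show ?thesis unfolding negligible_def by blast
qed

text \<open>When the limiting values of a combination of densities cancel, only the errors of order
  \<open>1 / T\<close> in their expectations remain.\<close>

lemma negligible_dens: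
  assumes J: "finite J" and "\<And>j. j \<in> J \<Longrightarrow> finite (U j)" and "\<And>j. j \<in> J \<Longrightarrow> supp (U j) (a j)"
    and 0: "(\<Sum>j\<in>J. c j * lin v (a j)) = 0"
  shows "negligible (\<lambda>T w. \<Sum>j\<in>J. c j * dens (U j) (a j) T w)"
proof -
  have "\<forall>j\<in>J. \<exists>C. \<forall>T\<ge>1. \<forall>W p. sample T W p \<longrightarrow>
      \<bar>(\<Sum>w\<in>W. p w * dens (U j) (a j) T w) - lin v (a j)\<bar> \<le> C / real T"
    using assms expectation_dens by blast
  from bchoice[OF this] obtain C where C: "\<And>j T W p. j \<in> J \<Longrightarrow> T \<ge> 1 \<Longrightarrow> sample T W p \<Longrightarrow>
      \<bar>(\<Sum>w\<in>W. p w * dens (U j) (a j) T w) - lin v (a j)\<bar> \<le> C j / real T"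
    by blast
  have "(\<Sum>w\<in>W. p w * (\<Sum>j\<in>J. c j * dens (U j) (a j) T w)) \<le> (\<Sum>j\<in>J. \<bar>c j\<bar> * C j) / real T"
    if T: "T \<ge> 1" and s: "sample T W p" for T W p
  proof -
    have "(\<Sum>w\<in>W. p w * (\<Sum>j\<in>J. c j * dens (U j) (a j) T w)) =
        (\<Sum>j\<in>J. c j * (\<Sum>w\<in>W. p w * dens (U j) (a j) T w))"
      unfolding sum_distrib_left by (subst sum.swap) (simp add: mult_ac)
    also have "\<dots> = (\<Sum>j\<in>J. c j * ((\<Sum>w\<in>W. p w * dens (U j) (a j) T w) - lin v (a j)))"
      using 0 by (simp add: right_diff_distrib sum_subtractf)
    also have "\<dots> \<le> (\<Sum>j\<in>J. \<bar>c j\<bar> * (C j / real T))"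
    proof (rule sum_mono)
      fix j assume j: "j \<in> J"
      have "c j * ((\<Sum>w\<in>W. p w * dens (U j) (a j) T w) - lin v (a j)) \<le>
          \<bar>c j\<bar> * \<bar>(\<Sum>w\<in>W. p w * dens (U j) (a j) T w) - lin v (a j)\<bar>"
        by (metis abs_ge_self abs_mult)
      also have "\<dots> \<le> \<bar>c j\<bar> * (C j / real T)" using C[OF j T s] by (intro mult_left_mono) auto
      finally show "c j * ((\<Sum>w\<in>W. p w * dens (U j) (a j) T w) - lin v (a j)) \<le> \<bar>c j\<bar> * (C j / real T)" .
    qed
    also have "\<dots> = (\<Sum>j\<in>J. \<bar>c j\<bar> * C j) / real T" by (simp add: sum_divide_distrib)
    finally show ?thesis .
  qed
  then show ?thesis unfolding negligible_def by blast
qed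

text \<open>First moment method: a mean below \<eta> forces some sample point below \<eta>.\<close>

lemma ex_small:
  assumes "negligible \<Psi>" "\<eta> > 0"
  shows "\<exists>T\<ge>1. \<exists>w. valid T w \<and> \<Psi> T w < \<eta>"
proof (rule ccontr)
  assume neg: "\<not> (\<exists>T\<ge>1. \<exists>w. valid T w \<and> \<Psi> T w < \<eta>)"
  obtain C where C: "\<And>T W p. T \<ge> 1 \<Longrightarrow> sample T W p \<Longrightarrow> (\<Sum>w\<in>W. p w * \<Psi> T w) \<le> C / real T"
    using assms unfolding negligible_def by blast
  obtain n :: nat where n: "real n > max 1 (C / \<eta>)" using reals_Archimedean2 by blast
  then have n1: "n \<ge> 1" by simp
  obtain W p where s: "sample n W p" using ex_sample by blast
  have "\<eta> = (\<Sum>w\<in>W. p w * \<eta>)" using sample_sum[OF s] by (simp flip: sum_distrib_right)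
  also have "\<dots> \<le> (\<Sum>w\<in>W. p w * \<Psi> n w)"
    using neg n1 s by (intro sum_mono mult_left_mono) (auto simp: sample_def not_less)
  also have "\<dots> \<le> C / real n" by (rule C[OF n1 s])
  also have "\<dots> < \<eta>" using n assms(2) by (simp add: field_simps)
  finally show False by simp
qed

text \<open>Second moment method: the squared deviation is itself a density, of the product of two
  copies of \<open>E - v E\<close> on disjoint node sets. Independence of disjoint parts makes its
  limiting value zero.\<close>

lemma negligible_deviation:
  assumes U: "finite U" and E: "\<And>e. e \<in># E \<Longrightarrow> e \<subseteq> U \<and> card e = 2"
  shows "negligible (\<lambda>T w. (dens U (Poly_Mapping.single E 1) T w - v E)\<^sup>2)"
proof -
  obtain N where N: "\<forall>x\<in>U. x < N" using U finite_nat_set_iff_bounded by blast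
  \<comment> \<open>\<open>N\<close> exceeds all nodes of \<open>U\<close>, so the shift produces
    the disjoint second copy.\<close>
  let ?h = "\<lambda>x. x + N" and ?E = "image_mset (image (\<lambda>x. x + N)) E"
  have inj: "inj_on ?h A" for A by (simp add: inj_on_def)
  let ?a = "Poly_Mapping.single E 1 - cst (v E)" and ?b = "Poly_Mapping.single ?E 1 - cst (v E)"
  have fh: "finite (?h ` U)" using U by simp
  have d: "U \<inter> ?h ` U = {}" using N by fastforce
  have suppa: "supp U ?a" using E by (intro supp_diff supp_single supp_cst)
  have suppb: "supp (?h ` U) ?b"
    using E card_image[OF inj] by (intro supp_diff supp_single supp_cst) auto
  have "lin v (?a * ?b) = v (E + ?E) - v E * v E"
  proof -
    have "?a * ?b = Poly_Mapping.single (E + ?E) 1 - cst (v E) * Poly_Mapping.single E 1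
        - cst (v E) * Poly_Mapping.single ?E 1 + cst (v E) * cst (v E)"
      by (simp add: algebra_simps mult_single)
    then have "lin v (?a * ?b) = v (E + ?E) - v E * v E - v E * v ?E + v E * v E * v {#}"
      by (simp add: lin_add lin_diff mult_single)
    moreover have "v ?E = v E" by (rule v_rename[OF inj])
    ultimately show ?thesis using v_empty by simp
  qed
  also have "v (E + ?E) = v E * v ?E"
  proof (rule v_disjoint)
    have "verts E \<subseteq> U" "verts ?E \<subseteq> ?h ` U" using E by auto
    then show "verts E \<inter> verts ?E = {}" using d by blast
  qed
  also have "v ?E = v E" by (rule v_rename[OF inj])
  finally have 0: "lin v (?a * ?b) = 0" by simp
  have neg: "negligible (\<lambda>T w. \<Sum>j\<in>{()}. 1 * dens (U \<union> ?h ` U) (?a * ?b) T w)"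
    using U 0 supp_mono[OF suppa] supp_mono[OF suppb]
    by (intro negligible_dens supp_mult) auto
  show ?thesis
  proof (rule negligible_cong[OF neg])
    fix T w assume T: "T \<ge> (1::nat)"
    have "dens (U \<union> ?h ` U) (?a * ?b) T w = dens U ?a T w * dens (?h ` U) ?b T w"
      by (rule dens_mult[OF U fh d suppa suppb])
    also have "dens (?h ` U) ?b T w = dens U ?a T w"
      unfolding dens_diff using dens_rename[OF U inj, of E 1 T w] E dens_cst U fh T by simp
    finally show "(dens U (Poly_Mapping.single E 1) T w - v E)\<^sup>2 =
        (\<Sum>j\<in>{()}. 1 * dens (U \<union> ?h ` U) (?a * ?b) T w)"
      using dens_cst[OF U T] by (simp add: dens_diff power2_eq_square)
  qed
qed

definition kapr :: "nat \<Rightarrow> nat \<Rightarrow> nat \<Rightarrow> nat set multiset \<Rightarrow>\<^sub>0 real" where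
  "kapr x z y = (\<Sum>l\<in>colours. sel {x, z} l * sel {z, y} l)"

text \<open>A squared difference of averages is written as a product of two differences with
  independent middle nodes, so that its density with \<open>1\<close> and \<open>2\<close> held
  fixed is \<open>sep\<close>.\<close>

definition gadget :: "nat \<Rightarrow> nat set multiset \<Rightarrow>\<^sub>0 real" where
  "gadget i = (kapr 1 (3 * i + 4) (3 * i + 3) - kapr 2 (3 * i + 4) (3 * i + 3)) *
     (kapr 1 (3 * i + 5) (3 * i + 3) - kapr 2 (3 * i + 5) (3 * i + 3))"

lemma ev_kapr:
  assumes "w {x, z} \<in> colours" "w {z, y} \<in> colours"
  shows "ev w (kapr x z y) = kap w x z y"
proof -
  have "ev w (kapr x z y) = (\<Sum>l\<in>colours. (if w {x, z} = l then 1 else 0) * (if w {z, y} = l then 1 else 0))"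
    unfolding kapr_def ev_sum ev_mult sel_def ev_pev
    using assms by (intro sum.cong refl) (simp add: poly_lagrange)
  also have "\<dots> = (\<Sum>l\<in>colours. if w {x, z} = l then (if w {z, y} = l then 1 else 0) else 0)"
    by (intro sum.cong refl) simp
  also have "\<dots> = kap w x z y" using assms by (simp add: kap_def)
  finally show ?thesis .
qed

lemma supp_gadget: "i \<in> I \<Longrightarrow> supp (gadget_nodes I) (gadget i)"
  unfolding gadget_def kapr_def sel_def
  by (intro supp_mult supp_diff supp_sum supp_pev) (auto simp: gadget_nodes_def)

lemma dens_gadget:
  assumes I: "finite I" and T: "T \<ge> 1" and w: "valid T w"
  shows "dens (gadget_nodes I) (\<Prod>i\<in>I. gadget i) T w =
    (\<Sum>x<T. \<Sum>y<T. sep T w x y ^ card I) / real T ^ 2"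
proof -
  let ?G = "\<lambda>x y a b c. (kap w x b a - kap w y b a) * (kap w x c a - kap w y c a)"
  have "(\<Sum>\<psi>\<in>gadget_nodes I \<rightarrow>\<^sub>E {..<T}. ev (\<lambda>e. w (\<psi> ` e)) (\<Prod>i\<in>I. gadget i)) =
      (\<Sum>\<psi>\<in>gadget_nodes I \<rightarrow>\<^sub>E {..<T}. 1 *
        (\<Prod>i\<in>I. ?G (\<psi> 1) (\<psi> 2) (\<psi> (3 * i + 3)) (\<psi> (3 * i + 4)) (\<psi> (3 * i + 5))))"
    unfolding ev_prod mult_1
  proof (intro sum.cong prod.cong refl)
    fix \<psi> i assume \<psi>: "\<psi> \<in> gadget_nodes I \<rightarrow>\<^sub>E {..<T}" and i: "i \<in> I"
    have m: "\<psi> x < T" if "x \<in> gadget_nodes I" for x using PiE_mem[OF \<psi> that] by simp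
    have mem: "1 \<in> gadget_nodes I" "2 \<in> gadget_nodes I" "3 * i + 3 \<in> gadget_nodes I"
      "3 * i + 4 \<in> gadget_nodes I" "3 * i + 5 \<in> gadget_nodes I"
      using i by (auto simp: gadget_nodes_def)
    have col: "w {\<psi> x, \<psi> y} \<in> colours" if "x \<in> gadget_nodes I" "y \<in> gadget_nodes I" for x y
      using w m[OF that(1)] m[OF that(2)] by (simp add: valid_def)
    have "ev (\<lambda>e. w (\<psi> ` e)) (kapr x z y) = kap w (\<psi> x) (\<psi> z) (\<psi> y)"
      if "x \<in> gadget_nodes I" "y \<in> gadget_nodes I" "z \<in> gadget_nodes I" for x y z
      using ev_kapr[of "\<lambda>e. w (\<psi> ` e)" x z y] col that by (simp add: kap_def)
    then show "ev (\<lambda>e. w (\<psi> ` e)) (gadget i) =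
        ?G (\<psi> 1) (\<psi> 2) (\<psi> (3 * i + 3)) (\<psi> (3 * i + 4)) (\<psi> (3 * i + 5))"
      unfolding gadget_def ev_mult ev_diff using mem by simp
  qed
  also have "\<dots> = (\<Sum>x<T. \<Sum>y<T. 1 * (\<Sum>a<T. \<Sum>b<T. \<Sum>c<T. ?G x y a b c) ^ card I)"
    by (rule sum_gadget[OF I finite_lessThan])
  also have "\<dots> = (\<Sum>x<T. \<Sum>y<T. (real T ^ 3 * sep T w x y) ^ card I)"
  proof (intro sum.cong refl)
    fix x y
    have "(\<Sum>b<T. \<Sum>c<T. ?G x y a b c) = real T ^ 2 * (agree T w x a - agree T w y a)\<^sup>2" for a
    proof -
      have "(\<Sum>b<T. \<Sum>c<T. ?G x y a b c) = (\<Sum>b<T. kap w x b a - kap w y b a)\<^sup>2"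
        by (simp add: power2_eq_square sum_product)
      also have "(\<Sum>b<T. kap w x b a - kap w y b a) = real T * (agree T w x a - agree T w y a)"
        using T by (simp add: agree_def sum_subtractf right_diff_distrib)
      finally show ?thesis by (simp add: power_mult_distrib)
    qed
    then have "(\<Sum>a<T. \<Sum>b<T. \<Sum>c<T. ?G x y a b c) =
        real T ^ 2 * (\<Sum>a<T. (agree T w x a - agree T w y a)\<^sup>2)"
      by (simp only: sum_distrib_left)
    \<comment> \<open>Two factors \<open>T\<close> come from the middle nodes through
      \<open>agree\<close>, the third from the mean in \<open>sep\<close>; they cancel the three
      private nodes of each gadget.\<close>
    also have "\<dots> = real T ^ 3 * sep T w x y"
      using T by (simp add: sep_def power3_eq_cube power2_eq_square)
    finally have "(\<Sum>a<T. \<Sum>b<T. \<Sum>c<T. ?G x y a b c) = real T ^ 3 * sep T w x y" .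
    then show "1 * (\<Sum>a<T. \<Sum>b<T. \<Sum>c<T. ?G x y a b c) ^ card I = (real T ^ 3 * sep T w x y) ^ card I"
      by simp
  qed
  also have "\<dots> = real T ^ (3 * card I) * (\<Sum>x<T. \<Sum>y<T. sep T w x y ^ card I)"
    by (simp add: power_mult_distrib sum_distrib_left power_mult)
  finally show ?thesis
    using T by (simp add: dens_def card_gadget_nodes[OF I] power_add power2_eq_square)
qed

lemma lin_mult_rank:
  assumes ab: "\<forall>E E'. verts E \<inter> verts E' \<subseteq> {1, 2} \<longrightarrow> v (E + E') = (\<Sum>i<m. a i E * b i E')"
    and d: "supp U d" "supp U' d'" "U \<inter> U' \<subseteq> {1, 2}"
  shows "lin v (d * d') = (\<Sum>i<m. lin (a i) d * lin (b i) d')"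
proof -
  have "lin v (d * d') = lin (\<lambda>E. lin (\<lambda>E'. \<Sum>i<m. a i E * b i E') d') d"
    unfolding lin_mult
  proof (intro lin_cong ab[rule_format])
    fix E E' assume "E \<in> Poly_Mapping.keys d" "E' \<in> Poly_Mapping.keys d'"
    then have "verts E \<subseteq> U" "verts E' \<subseteq> U'" using d(1,2) unfolding supp_def by blast+
    then show "verts E \<inter> verts E' \<subseteq> {1, 2}" using d(3) by blast
  qed
  also have "\<dots> = (\<Sum>E\<in>Poly_Mapping.keys d. \<Sum>i<m. \<Sum>E'\<in>Poly_Mapping.keys d'.
      Poly_Mapping.lookup d E * (Poly_Mapping.lookup d' E' * (a i E * b i E')))"
    unfolding lin_def sum_distrib_left by (intro sum.cong refl sum.swap)
  also have "\<dots> = (\<Sum>i<m. \<Sum>E\<in>Poly_Mapping.keys d. \<Sum>E'\<in>Poly_Mapping.keys d'.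
      Poly_Mapping.lookup d E * (Poly_Mapping.lookup d' E' * (a i E * b i E')))"
    by (rule sum.swap)
  also have "\<dots> = (\<Sum>i<m. lin (a i) d * lin (b i) d')"
    unfolding lin_def sum_product by (intro sum.cong refl) (simp only: mult_ac)
  finally show ?thesis .
qed

text \<open>
  Gluing \<open>k\<close> gadgets at the nodes \<open>1, 2\<close> gives the \<open>k\<close>-th moments of \<open>sep\<close>. By finite rank
  these powers are linearly dependent in the mean square sense, which makes \<open>r (sep)\<close> small on most pairs.
\<close>

lemma ex_sep_poly:
  "\<exists>r. r \<noteq> 0 \<and> negligible (\<lambda>T w. (\<Sum>x<T. \<Sum>y<T. (poly r (sep T w x y))\<^sup>2) / real T ^ 2)"
proof -
  obtain m :: nat and a b where ab: "\<forall>E E'. verts E \<inter> verts E' \<subseteq> {1, 2} \<longrightarrow>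
      v (E + E') = (\<Sum>i<m. a i E * b i E')"
    using v_rank by (elim exE)
  define d where "d I = (\<Prod>i\<in>I. gadget i)" for I
  have sd: "supp (gadget_nodes I) (d I)" if "finite I" for I
    unfolding d_def by (intro supp_prod supp_gadget)
  have "\<exists>c. (\<exists>k\<in>{..m}. c k \<noteq> 0) \<and> (\<forall>i\<in>{..<m}. (\<Sum>k\<in>{..m}. c k * lin (a i) (d {..<k})) = 0)"
    by (rule linear_dependence) simp_all
  then obtain c where c: "\<exists>k\<in>{..m}. c k \<noteq> 0"
      "\<forall>i\<in>{..<m}. (\<Sum>k\<in>{..m}. c k * lin (a i) (d {..<k})) = 0"
    by (elim exE conjE)
  define r where "r = (\<Sum>k\<le>m. monom (c k) k)"
  have "coeff r k = (if k \<le> m then c k else 0)" for k by (simp add: r_def coeff_sum)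
  then have r0: "r \<noteq> 0" using c(1) by (metis atMost_iff coeff_0)
  have pr: "poly r x = (\<Sum>k\<le>m. c k * x ^ k)" for x by (simp add: r_def poly_sum poly_monom)
  \<comment> \<open>Powers \<open>k\<close> and \<open>l\<close> are realised by gadgets with
    disjoint indices. Since \<open>k\<close> is at most \<open>m\<close>, starting the second range
    at \<open>Suc m\<close> leaves only nodes \<open>1\<close> and \<open>2\<close> in
    common.\<close>
  define I where "I p = {..<fst p} \<union> {Suc m..<Suc m + snd p}" for p :: "nat \<times> nat"
  let ?J = "{..m} \<times> {..m}"
  have fI: "finite (I p)" for p by (simp add: I_def)
  have cI: "card (I p) = fst p + snd p" if "p \<in> ?J" for p
    unfolding I_def using that by (subst card_Un_disjoint) auto
  have dI: "d (I (k, l)) = d {..<k} * d {Suc m..<Suc m + l}" if "k \<le> m" for k l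
    unfolding d_def I_def using that by (subst prod.union_disjoint[symmetric]) auto
  have int: "gadget_nodes {..<k} \<inter> gadget_nodes {Suc m..<Suc m + l} \<subseteq> {1, 2}" if "k \<le> m" for k l
  proof
    fix x assume x: "x \<in> gadget_nodes {..<k} \<inter> gadget_nodes {Suc m..<Suc m + l}"
    show "x \<in> {1, 2}"
    proof (rule ccontr)
      assume "x \<notin> {1, 2}"
      then have "\<exists>i<k. x \<in> {3 * i + 3, 3 * i + 4, 3 * i + 5}" "\<exists>j>m. x \<in> {3 * j + 3, 3 * j + 4, 3 * j + 5}"
        using x by (auto simp: gadget_nodes_def Suc_le_eq)
      then obtain i j where "i < k" "x \<in> {3 * i + 3, 3 * i + 4, 3 * i + 5}"
        "j > m" "x \<in> {3 * j + 3, 3 * j + 4, 3 * j + 5}" by blast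
      then show False using that by auto
    qed
  qed
  have "(\<Sum>p\<in>?J. (c (fst p) * c (snd p)) * lin v (d (I p))) =
      (\<Sum>k\<le>m. \<Sum>l\<le>m. (c k * c l) * lin v (d (I (k, l))))"
    by (simp add: sum.cartesian_product case_prod_beta)
  also have "\<dots> = (\<Sum>k\<le>m. \<Sum>l\<le>m. \<Sum>i<m. c k * c l * (lin (a i) (d {..<k}) * lin (b i) (d {Suc m..<Suc m + l})))"
  proof (intro sum.cong refl)
    fix k l assume "k \<in> {..m}"
    then have k: "k \<le> m" by simp
    have "lin v (d {..<k} * d {Suc m..<Suc m + l}) =
        (\<Sum>i<m. lin (a i) (d {..<k}) * lin (b i) (d {Suc m..<Suc m + l}))"
      by (rule lin_mult_rank[OF ab sd sd int[OF k]]) simp_all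
    then show "(c k * c l) * lin v (d (I (k, l))) =
        (\<Sum>i<m. c k * c l * (lin (a i) (d {..<k}) * lin (b i) (d {Suc m..<Suc m + l})))"
      unfolding dI[OF k] by (simp only: sum_distrib_left)
  qed
  also have "\<dots> = (\<Sum>l\<le>m. \<Sum>i<m. \<Sum>k\<le>m. c k * c l * (lin (a i) (d {..<k}) * lin (b i) (d {Suc m..<Suc m + l})))"
    by (subst sum.swap) (intro sum.cong refl sum.swap)
  \<comment> \<open>The choice of \<open>c\<close> annihilates the inner sum for every
    \<open>i\<close>, whatever the other factor is.\<close>
  also have "\<dots> = (\<Sum>l\<le>m. \<Sum>i<m. (\<Sum>k\<le>m. c k * lin (a i) (d {..<k})) * (c l * lin (b i) (d {Suc m..<Suc m + l})))"
    unfolding sum_distrib_right by (intro sum.cong refl) (simp only: mult_ac)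
  also have "\<dots> = 0" using c(2) by simp
  finally have 0: "(\<Sum>p\<in>?J. (c (fst p) * c (snd p)) * lin v (d (I p))) = 0" .
  have neg: "negligible (\<lambda>T w. \<Sum>p\<in>?J. (c (fst p) * c (snd p)) * dens (gadget_nodes (I p)) (d (I p)) T w)"
    using 0 fI sd by (intro negligible_dens finite_gadget_nodes) auto
  have "negligible (\<lambda>T w. (\<Sum>x<T. \<Sum>y<T. (poly r (sep T w x y))\<^sup>2) / real T ^ 2)"
  proof (rule negligible_cong[OF neg])
    fix T w assume T: "T \<ge> (1::nat)" and w: "valid T w"
    have "(\<Sum>p\<in>?J. (c (fst p) * c (snd p)) * dens (gadget_nodes (I p)) (d (I p)) T w) =
        (\<Sum>p\<in>?J. (c (fst p) * c (snd p)) * ((\<Sum>x<T. \<Sum>y<T. sep T w x y ^ (fst p + snd p)) / real T ^ 2))"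
      using dens_gadget[OF fI T w] cI by (intro sum.cong refl) (simp add: d_def)
    also have "\<dots> = (\<Sum>p\<in>?J. \<Sum>x<T. \<Sum>y<T. (c (fst p) * c (snd p)) * sep T w x y ^ (fst p + snd p)) / real T ^ 2"
      by (simp only: sum_divide_distrib sum_distrib_left times_divide_eq_right)
    also have "(\<Sum>p\<in>?J. \<Sum>x<T. \<Sum>y<T. (c (fst p) * c (snd p)) * sep T w x y ^ (fst p + snd p)) =
        (\<Sum>x<T. \<Sum>y<T. \<Sum>p\<in>?J. (c (fst p) * c (snd p)) * sep T w x y ^ (fst p + snd p))"
      by (subst sum.swap) (intro sum.cong refl sum.swap)
    also have "\<dots> = (\<Sum>x<T. \<Sum>y<T. (poly r (sep T w x y))\<^sup>2)"
    proof (intro sum.cong refl)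
      fix x y
      let ?s = "sep T w x y"
      have "(poly r ?s)\<^sup>2 = (\<Sum>k\<le>m. \<Sum>l\<le>m. (c k * ?s ^ k) * (c l * ?s ^ l))"
        unfolding pr power2_eq_square sum_product ..
      also have "\<dots> = (\<Sum>p\<in>?J. (c (fst p) * ?s ^ fst p) * (c (snd p) * ?s ^ snd p))"
        by (simp add: sum.cartesian_product case_prod_beta)
      finally show "(\<Sum>p\<in>?J. (c (fst p) * c (snd p)) * ?s ^ (fst p + snd p)) = (poly r ?s)\<^sup>2"
        by (simp add: power_add mult_ac)
    qed
    finally show "(\<Sum>x<T. \<Sum>y<T. (poly r (sep T w x y))\<^sup>2) / real T ^ 2 =
        (\<Sum>p\<in>?J. (c (fst p) * c (snd p)) * dens (gadget_nodes (I p)) (d (I p)) T w)" ..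
  qed
  then show ?thesis using r0 by blast
qed

text \<open>All requirements are nonnegative and negligible, so one sample makes their sum small.
  The polynomial \<open>r\<close> is fixed before the tests, which later keeps the number of blocks
  independent of them.\<close>

theorem sampling:
  "\<exists>r. r \<noteq> 0 \<and> (\<forall>FF. finite FF \<longrightarrow> (\<forall>(U, E)\<in>FF. finite U \<and> (\<forall>e\<in>#E. e \<subseteq> U \<and> card e = 2)) \<longrightarrow>
     (\<forall>\<eta>>0. \<exists>T\<ge>1. \<exists>w. valid T w \<and>
        (\<forall>(U, E)\<in>FF. (dens U (Poly_Mapping.single E 1) T w - v E)\<^sup>2 < \<eta>) \<and>
        (\<Sum>x<T. \<Sum>y<T. (poly r (sep T w x y))\<^sup>2) / real T ^ 2 < \<eta>))"
proof -
  obtain r where r: "r \<noteq> 0"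
    and neg: "negligible (\<lambda>T w. (\<Sum>x<T. \<Sum>y<T. (poly r (sep T w x y))\<^sup>2) / real T ^ 2)" (is "negligible ?A")
    using ex_sep_poly by blast
  have "\<exists>T\<ge>1. \<exists>w. valid T w \<and>
        (\<forall>(U, E)\<in>FF. (dens U (Poly_Mapping.single E 1) T w - v E)\<^sup>2 < \<eta>) \<and> ?A T w < \<eta>"
    if FF: "finite FF" "\<forall>(U, E)\<in>FF. finite U \<and> (\<forall>e\<in>#E. e \<subseteq> U \<and> card e = 2)" and \<eta>: "\<eta> > 0" for FF \<eta>
  proof -
    let ?D = "\<lambda>p T w. (dens (fst p) (Poly_Mapping.single (snd p) 1) T w - v (snd p))\<^sup>2"
    have FF': "finite (fst p)" "\<And>e. e \<in># snd p \<Longrightarrow> e \<subseteq> fst p \<and> card e = 2" if "p \<in> FF" for p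
      using bspec[OF FF(2) that] by (simp_all add: case_prod_beta)
    have "negligible (\<lambda>T w. (\<Sum>p\<in>FF. ?D p T w) + ?A T w)"
      by (intro negligible_add[OF negligible_sum[OF FF(1)] neg] negligible_deviation FF')
    then obtain T w where T: "T \<ge> 1" "valid T w" "(\<Sum>p\<in>FF. ?D p T w) + ?A T w < \<eta>"
      using ex_small[OF _ \<eta>] by blast
    have A0: "?A T w \<ge> 0" by (intro divide_nonneg_nonneg sum_nonneg) auto
    have D: "?D p T w \<le> (\<Sum>p\<in>FF. ?D p T w)" if "p \<in> FF" for p
      using FF(1) that by (intro member_le_sum) auto
    have D0: "(\<Sum>p\<in>FF. ?D p T w) \<ge> 0" by (intro sum_nonneg) auto
    have "\<forall>p\<in>FF. ?D p T w < \<eta>" using D A0 T(3) by fastforce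
    then have "\<forall>(U, E)\<in>FF. (dens U (Poly_Mapping.single E 1) T w - v E)\<^sup>2 < \<eta>" by auto
    moreover have "?A T w < \<eta>" using D0 T(3) by linarith
    ultimately show ?thesis using T by blast
  qed
  then show ?thesis using r by blast
qed

end

section \<open>Partition into classes of near-twins\<close>

text \<open>
  Derandomised empirical averaging (Maurey): choosing the sample points one by one so that the
  cross term is nonpositive keeps the variance linear in the number of samples.
\<close>

lemma greedy_sample:
  fixes a :: "'v \<Rightarrow> 'j \<Rightarrow> real"
  assumes V: "finite V" "V \<noteq> {}" and mean: "\<And>j. j \<in> J \<Longrightarrow> (\<Sum>z\<in>V. a z j) = 0"
    and B: "\<And>z. z \<in> V \<Longrightarrow> (\<Sum>j\<in>J. (a z j)\<^sup>2) \<le> B"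
  shows "\<exists>zs. (\<forall>l<n. zs l \<in> V) \<and> (\<Sum>j\<in>J. (\<Sum>l<n. a (zs l) j)\<^sup>2) \<le> real n * B"
proof (induction n)
  case (Suc n)
  then obtain zs where zs: "\<forall>l<n. zs l \<in> V" "(\<Sum>j\<in>J. (\<Sum>l<n. a (zs l) j)\<^sup>2) \<le> real n * B"
    by blast
  let ?s = "\<lambda>j. \<Sum>l<n. a (zs l) j"
  have "(\<Sum>z\<in>V. \<Sum>j\<in>J. ?s j * a z j) = (\<Sum>j\<in>J. ?s j * (\<Sum>z\<in>V. a z j))"
    unfolding sum_distrib_left by (rule sum.swap)
  also have "\<dots> = 0" using mean by simp
  finally have z0: "(\<Sum>z\<in>V. \<Sum>j\<in>J. ?s j * a z j) = 0" .
  have "\<exists>z\<in>V. (\<Sum>j\<in>J. ?s j * a z j) \<le> 0"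
  proof (rule ccontr)
    assume "\<not> ?thesis"
    then have "(\<Sum>z\<in>V. \<Sum>j\<in>J. ?s j * a z j) > 0" by (intro sum_pos[OF V]) (simp add: not_le)
    then show False using z0 by simp
  qed
  then obtain z where z: "z \<in> V" "(\<Sum>j\<in>J. ?s j * a z j) \<le> 0" by blast
  define zs' where "zs' = zs(n := z)"
  have "(\<Sum>j\<in>J. (\<Sum>l<Suc n. a (zs' l) j)\<^sup>2) = (\<Sum>j\<in>J. (?s j + a z j)\<^sup>2)"
    by (simp add: zs'_def)
  also have "\<dots> = (\<Sum>j\<in>J. (?s j)\<^sup>2) + 2 * (\<Sum>j\<in>J. ?s j * a z j) + (\<Sum>j\<in>J. (a z j)\<^sup>2)"
  proof -
    have "(\<Sum>j\<in>J. (s j + a z j)\<^sup>2) = (\<Sum>j\<in>J. (s j)\<^sup>2) + 2 * (\<Sum>j\<in>J. s j * a z j) + (\<Sum>j\<in>J. (a z j)\<^sup>2)" for s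
      unfolding power2_sum sum.distrib by (simp add: sum_distrib_left mult.assoc)
    then show ?thesis .
  qed
  also have "\<dots> \<le> real (Suc n) * B" using zs(2) z(2) B[OF z(1)] by (simp add: algebra_simps)
  finally show ?case using zs(1) z(1) by (intro exI[of _ zs']) (auto simp: zs'_def less_Suc_eq)
qed simp

section \<open>The twin distance as a quasi-metric and its covering numbers\<close>

lemma sep_self [simp]: "sep T w x x = 0"
  by (simp add: sep_def)

lemma sep_commute: "sep T w x y = sep T w y x"
  by (simp add: sep_def power2_commute)

lemma sep_nonneg: "sep T w x y \<ge> 0"
  by (auto simp: sep_def intro!: divide_nonneg_nonneg sum_nonneg)

lemma square_diff_le: "(a - b)\<^sup>2 \<le> 2 * (a - c)\<^sup>2 + 2 * (b - c)\<^sup>2" for a b c :: real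
proof -
  have "2 * (a - c)\<^sup>2 + 2 * (b - c)\<^sup>2 - (a - b)\<^sup>2 = (a + b - 2 * c)\<^sup>2"
    by (simp add: power2_eq_square algebra_simps)
  then show ?thesis using zero_le_power2[of "a + b - 2 * c"] by linarith
qed

lemma sep_triangle: "sep T w x y \<le> 2 * sep T w x z + 2 * sep T w y z"
proof -
  have "sep T w x y \<le> (\<Sum>u<T. 2 * (agree T w x u - agree T w z u)\<^sup>2 + 2 * (agree T w y u - agree T w z u)\<^sup>2) / T"
    unfolding sep_def by (intro divide_right_mono sum_mono square_diff_le) simp
  then show ?thesis by (simp add: sep_def sum.distrib sum_distrib_left add_divide_distrib)
qed

lemma agree_bounds: "0 \<le> agree T w x y" "agree T w x y \<le> 1"
proof -
  have "(\<Sum>z<T. kap w x z y) \<le> (\<Sum>z<T. 1)" by (intro sum_mono) (simp add: kap_def)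
  then show "agree T w x y \<le> 1" by (cases "T = 0") (simp_all add: agree_def)
  show "0 \<le> agree T w x y" by (auto simp: agree_def kap_def intro!: divide_nonneg_nonneg sum_nonneg)
qed

text \<open>From here on the estimates concern one fixed colouring; loops are coloured as
  well.\<close>

locale coloured =
  fixes T :: nat and w :: "nat set \<Rightarrow> real" and L :: "real set"
  assumes T: "T \<ge> 1" and L: "finite L" and w: "\<And>x y. x < T \<Longrightarrow> y < T \<Longrightarrow> w {x, y} \<in> L"
begin

text \<open>A few well chosen middle nodes approximate most rows of \<open>agree\<close>, and the
  approximation of row \<open>x\<close> depends only on the colours from \<open>x\<close> to them.
  Separated nodes with good approximations therefore have distinct colour patterns, of which there
  are at most \<open>card L ^ n\<close>, independently of \<open>T\<close>.\<close>

lemma separated_bound: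
  assumes A: "A \<subseteq> {..<T}" and sep: "\<And>x y. x \<in> A \<Longrightarrow> y \<in> A \<Longrightarrow> x \<noteq> y \<Longrightarrow> sep T w x y \<ge> \<epsilon>"
    and \<epsilon>: "\<epsilon> > 0" and n: "real n \<ge> 8 / \<epsilon>"
  shows "card A \<le> 2 * card L ^ n"
proof -
  have finX: "finite A" using A finite_subset by blast
  have n0: "n > 0" using n \<epsilon> by (metis gr0I less_divide_eq_numeral1(1) of_nat_0 not_le zero_less_divide_iff zero_less_numeral)
  \<comment> \<open>The vectors are centred in \<open>z\<close> and indexed by all rows in
    \<open>A\<close> at once, so one choice of middle nodes serves all rows in the mean.\<close>
  let ?a = "\<lambda>z (x, y). kap w x z y - agree T w x y"
  let ?J = "A \<times> {..<T}"
  have "\<exists>zs. (\<forall>l<n. zs l \<in> {..<T}) \<and> (\<Sum>j\<in>?J. (\<Sum>l<n. ?a (zs l) j)\<^sup>2) \<le> real n * (real (card A) * T)"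
  proof (rule greedy_sample)
    show "{..<T} \<noteq> {}" using T by (simp add: lessThan_empty_iff)
    show "(\<Sum>z<T. ?a z j) = 0" if "j \<in> ?J" for j
      using T by (cases j) (simp add: sum_subtractf agree_def)
    show "(\<Sum>j\<in>?J. (?a z j)\<^sup>2) \<le> real (card A) * T" if "z \<in> {..<T}" for z
    proof -
      have "(\<Sum>j\<in>?J. (?a z j)\<^sup>2) \<le> (\<Sum>j\<in>?J. 1)"
      proof (rule sum_mono)
        fix j assume "j \<in> ?J"
        obtain x y where j: "j = (x, y)" by fastforce
        have "\<bar>kap w x z y - agree T w x y\<bar> \<le> 1" using agree_bounds[of T w x y] by (auto simp: kap_def)
        then show "(?a z j)\<^sup>2 \<le> 1" unfolding j by (simp add: abs_square_le_1)
      qed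
      then show ?thesis by (simp add: card_cartesian_product)
    qed
  qed simp
  then obtain zs where zs: "\<forall>l<n. zs l < T"
    "(\<Sum>j\<in>?J. (\<Sum>l<n. ?a (zs l) j)\<^sup>2) \<le> real n * (real (card A) * T)" by auto
  define q where "q x y = (\<Sum>l<n. kap w x (zs l) y) / n" for x y
  define err where "err x = (\<Sum>y<T. (agree T w x y - q x y)\<^sup>2) / T" for x
  have err0: "err x \<ge> 0" for x by (auto simp: err_def intro!: divide_nonneg_nonneg sum_nonneg)
  have "(\<Sum>l<n. ?a (zs l) (x, y))\<^sup>2 = real n ^ 2 * (agree T w x y - q x y)\<^sup>2" for x y
  proof -
    have "(\<Sum>l<n. ?a (zs l) (x, y)) = - (real n * (agree T w x y - q x y))"
      using n0 by (simp add: q_def sum_subtractf right_diff_distrib)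
    then show ?thesis by (simp add: power_mult_distrib)
  qed
  then have "(\<Sum>j\<in>?J. (\<Sum>l<n. ?a (zs l) j)\<^sup>2) = (\<Sum>x\<in>A. \<Sum>y<T. real n ^ 2 * (agree T w x y - q x y)\<^sup>2)"
    unfolding sum.cartesian_product by (intro sum.cong refl) auto
  also have "\<dots> = real n ^ 2 * (\<Sum>x\<in>A. \<Sum>y<T. (agree T w x y - q x y)\<^sup>2)"
    by (simp only: sum_distrib_left)
  also have "(\<Sum>x\<in>A. \<Sum>y<T. (agree T w x y - q x y)\<^sup>2) = T * (\<Sum>x\<in>A. err x)"
    using T by (simp add: err_def sum_divide_distrib[symmetric])
  finally have "real n ^ 2 * (T * (\<Sum>x\<in>A. err x)) \<le> real n * (real (card A) * T)" using zs(2) by simp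
  then have "(real n * real T) * (real n * (\<Sum>x\<in>A. err x)) \<le> (real n * real T) * real (card A)"
    by (simp add: power2_eq_square mult_ac)
  then have tot: "real n * (\<Sum>x\<in>A. err x) \<le> real (card A)" using n0 T by simp
  \<comment> \<open>Two rows with error below \<open>\<epsilon> / 4\<close> and a common pattern are
    closer than \<epsilon>. With \<open>n\<close> at least \<open>8 / \<epsilon>\<close>, Markov's
    inequality leaves at most half of \<open>A\<close> bad, whence the factor
    \<open>2\<close>.\<close>
  define Bad where "Bad = {x \<in> A. err x \<ge> \<epsilon> / 4}"
  have "real (card Bad) * (\<epsilon> / 4) = (\<Sum>x\<in>Bad. \<epsilon> / 4)" by simp
  also have "\<dots> \<le> (\<Sum>x\<in>Bad. err x)" by (intro sum_mono) (simp add: Bad_def)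
  also have "\<dots> \<le> (\<Sum>x\<in>A. err x)" using finX err0 by (intro sum_mono2) (auto simp: Bad_def)
  finally have bad: "real (card Bad) * (\<epsilon> / 4) \<le> (\<Sum>x\<in>A. err x)" .
  have "8 \<le> real n * \<epsilon>" using n \<epsilon> by (simp add: field_simps)
  then have "8 * real (card Bad) \<le> (real n * \<epsilon>) * real (card Bad)" by (intro mult_right_mono) auto
  also have "\<dots> = 4 * (real n * (real (card Bad) * (\<epsilon> / 4)))" by simp
  also have "\<dots> \<le> 4 * (real n * (\<Sum>x\<in>A. err x))" using bad by (intro mult_left_mono) auto
  also have "\<dots> \<le> 4 * real (card A)" using tot by simp
  finally have half: "2 * card Bad \<le> card A" by linarith
  \<comment> \<open>This pattern determines the approximating row \<open>q x\<close>.\<close>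
  let ?col = "\<lambda>x. \<lambda>l\<in>{..<n}. w {x, zs l}"
  have inj: "inj_on ?col (A - Bad)"
  proof (rule inj_onI, rule ccontr)
    fix x y assume xy: "x \<in> A - Bad" "y \<in> A - Bad" "?col x = ?col y" "x \<noteq> y"
    have "w {x, zs l} = w {y, zs l}" if "l < n" for l using fun_cong[OF xy(3), of l] that by simp
    then have q: "q x u = q y u" for u by (simp add: q_def kap_def)
    have "sep T w x y \<le> (\<Sum>u<T. 2 * (agree T w x u - q x u)\<^sup>2 + 2 * (agree T w y u - q y u)\<^sup>2) / T"
      unfolding sep_def
    proof (intro divide_right_mono sum_mono)
      fix u show "(agree T w x u - agree T w y u)\<^sup>2 \<le> 2 * (agree T w x u - q x u)\<^sup>2 + 2 * (agree T w y u - q y u)\<^sup>2"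
        unfolding q by (rule square_diff_le)
    qed simp
    also have "\<dots> = 2 * err x + 2 * err y"
      by (simp add: err_def sum.distrib sum_distrib_left add_divide_distrib)
    also have "\<dots> < \<epsilon>" using xy(1,2) by (auto simp: Bad_def)
    finally show False using sep[of x y] xy by auto
  qed
  have "?col ` (A - Bad) \<subseteq> {..<n} \<rightarrow>\<^sub>E L" 
    using zs(1) w A by (intro image_subsetI restrict_PiE_iff[THEN iffD2]) blast
  then have "card (A - Bad) \<le> card ({..<n} \<rightarrow>\<^sub>E L)"
    using inj L by (intro card_inj_on_le[where f = ?col]) (auto intro!: finite_PiE)
  then have "card (A - Bad) \<le> card L ^ n" by (simp add: card_PiE)
  moreover have "card A = card (A - Bad) + card Bad"
  proof -
    have "Bad \<subseteq> A" by (auto simp: Bad_def)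
    then show ?thesis using finX by (simp add: card_Diff_subset card_mono finite_subset)
  qed
  ultimately show ?thesis using half by linarith
qed

text \<open>Centres form a maximal \<epsilon>-separated set, so every node is within \<epsilon> of
  one. The factor \<open>4\<close> is the loss in the triangle inequality for squared
  distances.\<close>

lemma ex_partition:
  assumes \<epsilon>: "\<epsilon> > 0" and n: "real n \<ge> 8 / \<epsilon>"
  shows "\<exists>cl. (\<forall>x<T. cl x < 2 * card L ^ n) \<and>
    (\<forall>x<T. \<forall>y<T. cl x = cl y \<longrightarrow> sep T w x y < 4 * \<epsilon>)"
proof -
  let ?S = "\<lambda>X. X \<subseteq> {..<T} \<and> (\<forall>x\<in>X. \<forall>y\<in>X. x \<noteq> y \<longrightarrow> sep T w x y \<ge> \<epsilon>)"
  have b: "card X \<le> 2 * card L ^ n" if "?S X" for X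
    using that by (intro separated_bound[OF _ _ \<epsilon> n]) auto
  have "\<exists>X. ?S X \<and> (\<forall>X'. ?S X' \<longrightarrow> card X' \<le> card X)"
    using b by (intro ex_has_greatest_nat[of ?S "{}" card "Suc (2 * card L ^ n)"]) (auto simp: less_Suc_eq_le)
  then obtain X where X: "?S X" and max: "\<And>X'. ?S X' \<Longrightarrow> card X' \<le> card X"
    by (elim exE conjE) simp
  have finX: "finite X" using X finite_subset by blast
  have near: "\<exists>x\<in>X. sep T w u x < \<epsilon>" if u: "u < T" for u
  proof (rule ccontr)
    assume far: "\<not> (\<exists>x\<in>X. sep T w u x < \<epsilon>)"
    then have uX: "u \<notin> X" using \<epsilon> by (metis sep_self)
    have "?S (insert u X)" using X far u sep_commute[of T w u] by (auto simp: not_less)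
    then show False using max[of "insert u X"] uX finX by simp
  qed
  define c where "c u = (SOME x. x \<in> X \<and> sep T w u x < \<epsilon>)" for u
  have c: "c u \<in> X" "sep T w u (c u) < \<epsilon>" if "u < T" for u
    using someI_ex[of "\<lambda>x. x \<in> X \<and> sep T w u x < \<epsilon>"] near[OF that] unfolding c_def by blast+
  obtain g where g: "bij_betw g X {0..<card X}" using finX ex_bij_betw_finite_nat by blast
  have "g (c x) < 2 * card L ^ n" if "x < T" for x
  proof -
    have "g (c x) < card X" using bij_betwE[OF g] c(1)[OF that] by auto
    then show ?thesis using b[OF X] by linarith
  qed
  moreover have "sep T w x y < 4 * \<epsilon>" if "x < T" "y < T" "g (c x) = g (c y)" for x y
  proof -
    have "c x = c y" using g c(1) that by (auto simp: bij_betw_def dest: inj_onD)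
    then show ?thesis using sep_triangle[of T w x y "c x"] c(2)[OF that(1)] c(2)[OF that(2)] by simp
  qed
  ultimately show ?thesis by (intro exI[of _ "\<lambda>x. g (c x)"]) auto
qed

end

section \<open>Averaging over classes in the cut norm\<close>

locale coloured_partition = coloured +
  fixes cl :: "nat \<Rightarrow> nat" and k :: nat
  assumes cl: "\<And>x. x < T \<Longrightarrow> cl x < k"
begin

definition block :: "nat \<Rightarrow> nat set" where
  "block c = {u. u < T \<and> cl u = c}"

definition mix :: "nat \<Rightarrow> nat \<Rightarrow> real" where
  "mix x u = (if cl u = cl x then 1 / card (block (cl x)) else 0)"

text \<open>Conditional expectation on the classes, as an operator with the symmetric kernel
  \<open>mix\<close>.\<close>

definition avg :: "(nat \<Rightarrow> real) \<Rightarrow> nat \<Rightarrow> real" where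
  "avg a x = (\<Sum>u<T. mix x u * a u)"

definition d1 :: "nat \<Rightarrow> nat \<Rightarrow> real" where
  "d1 x u = (\<Sum>y<T. \<bar>agree T w x y - agree T w u y\<bar>) / T"

text \<open>Mean l1 distance between the \<open>agree\<close> rows of a random node and of a random
  member of its class: the single quantity governing the error of averaging.\<close>

definition spread :: real where
  "spread = (\<Sum>x<T. avg (d1 x) x) / T"

definition hit :: "real \<Rightarrow> nat \<Rightarrow> nat \<Rightarrow> real" where
  "hit l x y = (if w {x, y} = l then 1 else 0)"

lemma finite_block [simp]: "finite (block c)"
  by (simp add: block_def)

lemma block_pos: "x < T \<Longrightarrow> card (block (cl x)) > 0"
  by (auto simp: card_gt_0_iff block_def)

lemma mix_commute: "mix x u = mix u x"
  by (simp add: mix_def)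

lemma mix_nonneg: "mix x u \<ge> 0"
  by (simp add: mix_def)

lemma sum_mix_block: "(\<Sum>u<T. mix x u * a u) = (\<Sum>u\<in>block (cl x). a u) / card (block (cl x))"
proof -
  have "(\<Sum>u<T. mix x u * a u) = (\<Sum>u\<in>block (cl x). mix x u * a u)"
    by (rule sum.mono_neutral_right) (auto simp: block_def mix_def)
  also have "\<dots> = (\<Sum>u\<in>block (cl x). a u / card (block (cl x)))"
    by (intro sum.cong refl) (simp add: block_def mix_def)
  finally show ?thesis by (simp add: sum_divide_distrib)
qed

lemma sum_mix: "x < T \<Longrightarrow> (\<Sum>u<T. mix x u) = 1"
  using sum_mix_block[of x "\<lambda>_. 1"] block_pos[of x] by (simp add: card_gt_0_iff)

lemma avg_self_adjoint: "(\<Sum>x<T. avg a x * g x) = (\<Sum>x<T. a x * avg g x)"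
proof -
  have "(\<Sum>x<T. avg a x * g x) = (\<Sum>x<T. \<Sum>u<T. mix x u * a u * g x)"
    by (simp add: avg_def sum_distrib_right)
  also have "\<dots> = (\<Sum>u<T. \<Sum>x<T. mix x u * a u * g x)" by (rule sum.swap)
  also have "\<dots> = (\<Sum>u<T. a u * avg g u)"
    unfolding avg_def sum_distrib_left
    by (intro sum.cong refl) (simp add: mix_commute mult_ac)
  finally show ?thesis .
qed

lemma avg_abs_le:
  assumes "x < T" "\<And>u. u < T \<Longrightarrow> \<bar>a u\<bar> \<le> b"
  shows "\<bar>avg a x\<bar> \<le> b"
proof -
  have "\<bar>avg a x\<bar> \<le> (\<Sum>u<T. mix x u * b)"
    unfolding avg_def using assms(2) mix_nonneg
    by (intro order_trans[OF sum_abs] sum_mono) (simp add: abs_mult mult_left_mono)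
  also have "\<dots> = b" using sum_mix[OF assms(1)] by (simp flip: sum_distrib_right)
  finally show ?thesis .
qed

lemma hit_commute: "hit l x y = hit l y x"
  by (simp add: hit_def insert_commute)

text \<open>Up to the factor \<open>T\<close>, \<open>agree\<close> is the Gram matrix of the colour
  indicators. Through this identity closeness of its rows controls sums against
  \<open>hit\<close>.\<close>

lemma sum_hit_hit:
  assumes "x < T" "x' < T"
  shows "(\<Sum>y<T. \<Sum>l\<in>L. hit l x y * hit l x' y) = T * agree T w x x'"
proof -
  have "(\<Sum>l\<in>L. hit l x y * hit l x' y) = kap w x y x'" if "y < T" for y
  proof -
    have "(\<Sum>l\<in>L. hit l x y * hit l x' y) = (\<Sum>l\<in>L. if l = w {x, y} then (if w {x', y} = w {x, y} then 1 else 0) else 0)"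
      by (intro sum.cong refl) (auto simp: hit_def)
    also have "\<dots> = kap w x y x'"
      using w[OF assms(1) that] L by (simp add: kap_def insert_commute eq_commute)
    finally show ?thesis .
  qed
  then show ?thesis using T by (simp add: agree_def)
qed

lemma avg_diff_bound:
  assumes "x < T"
  shows "\<bar>g x - avg g x\<bar> \<le> avg (\<lambda>u. \<bar>g x - g u\<bar>) x"
proof -
  have "g x - avg g x = (\<Sum>u<T. mix x u * (g x - g u))"
    using sum_mix[OF assms] by (simp add: avg_def right_diff_distrib sum_subtractf flip: sum_distrib_right)
  then show ?thesis
    unfolding avg_def using mix_nonneg
    by (simp add: abs_mult order_trans[OF sum_abs])
qed

text \<open>Cauchy-Schwarz in \<open>y\<close> removes \<open>b\<close> and leaves squared column
  sums. Expanding them turns \<open>hit\<close> into \<open>agree\<close>, and self-adjointness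
  moves the averaging from \<open>a\<close> onto the rows of \<open>agree\<close>, where
  \<open>spread\<close> bounds it.\<close>

lemma cut_bound_left:
  assumes a: "\<And>x. x < T \<Longrightarrow> \<bar>a x\<bar> \<le> 1" and b: "\<And>y. y < T \<Longrightarrow> \<bar>b y\<bar> \<le> 1" and l: "l \<in> L"
  shows "\<bar>\<Sum>x<T. \<Sum>y<T. (a x - avg a x) * b y * hit l x y\<bar> \<le> real T ^ 2 * sqrt (2 * spread)"
proof -
  define a0 where "a0 x = a x - avg a x" for x
  have a0: "\<bar>a0 x\<bar> \<le> 2" if "x < T" for x
    using avg_abs_le[OF that, of a 1] a[OF that] a by (simp add: a0_def)
  define S where "S l y = (\<Sum>x<T. a0 x * hit l x y)" for l y
  have sa: "(\<Sum>x<T. a0 x * g x) = (\<Sum>x<T. a x * (g x - avg g x))" for g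
    using avg_self_adjoint[of a g] by (simp add: a0_def left_diff_distrib right_diff_distrib sum_subtractf)
  \<comment> \<open>All colours are summed although only one is asked for: only the full sum is
    expressible by \<open>agree\<close>, and the squares make the enlargement harmless.\<close>
  have "(\<Sum>y<T. \<Sum>l\<in>L. (S l y)\<^sup>2) = (\<Sum>y<T. \<Sum>l\<in>L. \<Sum>x<T. \<Sum>x'<T. a0 x * a0 x' * (hit l x y * hit l x' y))"
    unfolding S_def power2_eq_square sum_product by (simp add: mult_ac)
  also have "\<dots> = (\<Sum>x<T. \<Sum>x'<T. a0 x * a0 x' * (\<Sum>y<T. \<Sum>l\<in>L. hit l x y * hit l x' y))"
  proof -
    have "(\<Sum>y<T. \<Sum>l\<in>L. \<Sum>x<T. \<Sum>x'<T. F y l x x') = (\<Sum>x<T. \<Sum>x'<T. \<Sum>y<T. \<Sum>l\<in>L. F y l x x')"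
      for F :: "nat \<Rightarrow> real \<Rightarrow> nat \<Rightarrow> nat \<Rightarrow> real"
    proof -
      have "(\<Sum>y<T. \<Sum>l\<in>L. \<Sum>x<T. \<Sum>x'<T. F y l x x') = (\<Sum>y<T. \<Sum>x<T. \<Sum>l\<in>L. \<Sum>x'<T. F y l x x')"
        by (intro sum.cong refl sum.swap)
      also have "\<dots> = (\<Sum>x<T. \<Sum>y<T. \<Sum>l\<in>L. \<Sum>x'<T. F y l x x')" by (rule sum.swap)
      also have "\<dots> = (\<Sum>x<T. \<Sum>y<T. \<Sum>x'<T. \<Sum>l\<in>L. F y l x x')" by (intro sum.cong refl sum.swap)
      also have "\<dots> = (\<Sum>x<T. \<Sum>x'<T. \<Sum>y<T. \<Sum>l\<in>L. F y l x x')" by (intro sum.cong refl sum.swap)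
      finally show ?thesis .
    qed
    then show ?thesis by (simp only: sum_distrib_left)
  qed
  also have "\<dots> = (\<Sum>x<T. \<Sum>x'<T. a0 x * a0 x' * (T * agree T w x x'))"
    using sum_hit_hit by (intro sum.cong refl) simp
  also have "\<dots> = (\<Sum>x'<T. T * a0 x' * (\<Sum>x<T. a0 x * agree T w x x'))"
    unfolding sum_distrib_left by (subst sum.swap) (simp add: mult_ac)
  also have "\<dots> = (\<Sum>x'<T. T * a0 x' * (\<Sum>x<T. a x * (agree T w x x' - avg (\<lambda>x. agree T w x x') x)))"
    unfolding sa ..
  also have "\<dots> \<le> (\<Sum>x'<T. T * 2 * (\<Sum>x<T. avg (\<lambda>u. \<bar>agree T w x x' - agree T w u x'\<bar>) x))"
  proof (rule sum_mono)
    fix x' assume x': "x' \<in> {..<T}"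
    let ?s = "\<Sum>x<T. a x * (agree T w x x' - avg (\<lambda>x. agree T w x x') x)"
    let ?r = "\<Sum>x<T. avg (\<lambda>u. \<bar>agree T w x x' - agree T w u x'\<bar>) x"
    have "\<bar>?s\<bar> \<le> (\<Sum>x<T. 1 * \<bar>agree T w x x' - avg (\<lambda>x. agree T w x x') x\<bar>)"
      using a by (intro order_trans[OF sum_abs] sum_mono) (simp add: abs_mult mult_left_le_one_le)
    also have "\<dots> \<le> ?r"
      using avg_diff_bound[of _ "\<lambda>x. agree T w x x'"] by (intro sum_mono) simp
    finally have s: "\<bar>?s\<bar> \<le> ?r" .
    have "a0 x' * ?s \<le> \<bar>a0 x'\<bar> * \<bar>?s\<bar>"
      unfolding abs_mult[symmetric] by (rule abs_ge_self)
    then have "T * a0 x' * ?s \<le> T * (\<bar>a0 x'\<bar> * \<bar>?s\<bar>)"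
      unfolding mult.assoc by (intro mult_left_mono) simp_all
    also have "\<dots> \<le> T * (2 * ?r)"
      using a0 x' s by (intro mult_left_mono mult_mono) auto
    finally show "T * a0 x' * ?s \<le> T * 2 * ?r" by simp
  qed
  also have "\<dots> = real T * 2 * (\<Sum>x<T. \<Sum>x'<T. avg (\<lambda>u. \<bar>agree T w x x' - agree T w u x'\<bar>) x)"
    unfolding sum_distrib_left[symmetric] by (subst sum.swap) simp
  also have "\<dots> = real T * 2 * (T * (\<Sum>x<T. avg (d1 x) x))"
  proof -
    have "(\<Sum>x'<T. avg (\<lambda>u. \<bar>agree T w x x' - agree T w u x'\<bar>) x) = T * avg (d1 x) x" for x
    proof -
      have "(\<Sum>x'<T. avg (\<lambda>u. \<bar>agree T w x x' - agree T w u x'\<bar>) x) =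
          (\<Sum>u<T. mix x u * (\<Sum>x'<T. \<bar>agree T w x x' - agree T w u x'\<bar>))"
        unfolding avg_def sum_distrib_left by (rule sum.swap)
      also have "\<dots> = T * avg (d1 x) x"
        using T by (simp add: avg_def d1_def sum_divide_distrib[symmetric])
      finally show ?thesis .
    qed
    then show ?thesis by (simp add: sum_distrib_left)
  qed
  also have "\<dots> = real T ^ 3 * (2 * spread)"
    using T by (simp add: spread_def power3_eq_cube)
  finally have S: "(\<Sum>y<T. \<Sum>l\<in>L. (S l y)\<^sup>2) \<le> real T ^ 3 * (2 * spread)" .
  have "(\<Sum>y<T. (S l y)\<^sup>2) \<le> (\<Sum>y<T. \<Sum>l\<in>L. (S l y)\<^sup>2)"
    using l L by (intro sum_mono member_le_sum) auto
  then have S1: "(\<Sum>y<T. (S l y)\<^sup>2) \<le> real T ^ 3 * (2 * spread)" using S by linarith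
  have bS: "(\<Sum>x<T. \<Sum>y<T. a0 x * b y * hit l x y) = (\<Sum>y<T. b y * S l y)"
    unfolding S_def sum_distrib_left by (subst sum.swap) (simp add: mult_ac)
  have "(\<Sum>x<T. \<Sum>y<T. a0 x * b y * hit l x y)\<^sup>2 \<le> (\<Sum>y<T. (b y)\<^sup>2) * (\<Sum>y<T. (S l y)\<^sup>2)" unfolding bS by (rule Cauchy_Schwarz_ineq_sum)
  also have "\<dots> \<le> (\<Sum>y<T. 1) * (real T ^ 3 * (2 * spread))"
  proof (rule mult_mono[OF _ S1])
    show "(\<Sum>y<T. (b y)\<^sup>2) \<le> (\<Sum>y<T. 1)" using b by (intro sum_mono) (simp add: abs_square_le_1)
  qed (auto intro!: sum_nonneg)
  also have "\<dots> = (real T ^ 2)\<^sup>2 * (2 * spread)" by (simp add: power2_eq_square power3_eq_cube)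
  finally have "sqrt ((\<Sum>x<T. \<Sum>y<T. a0 x * b y * hit l x y)\<^sup>2) \<le> sqrt ((real T ^ 2)\<^sup>2 * (2 * spread))"
    by (rule real_sqrt_le_mono)
  then show ?thesis
    unfolding real_sqrt_mult[of "(real T ^ 2)\<^sup>2"] real_sqrt_abs by (simp add: a0_def)
qed

definition density :: "nat \<Rightarrow> nat \<Rightarrow> real \<Rightarrow> real" where
  "density c c' l = (\<Sum>u\<in>block c. \<Sum>u'\<in>block c'. hit l u u') / (card (block c) * card (block c'))"

lemma density_commute: "density c c' l = density c' c l"
proof -
  have "(\<Sum>u\<in>block c. \<Sum>u'\<in>block c'. hit l u u') = (\<Sum>u'\<in>block c'. \<Sum>u\<in>block c. hit l u' u)"
    by (subst sum.swap) (simp add: hit_commute)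
  then show ?thesis by (simp add: density_def mult.commute)
qed

lemma avg_avg_hit: "avg (\<lambda>u. avg (hit l u) y) x = density (cl x) (cl y) l"
  unfolding avg_def sum_mix_block density_def
  by (simp add: sum_divide_distrib mult.commute)

text \<open>With \<open>P\<close> the averaging operator and \<open>H\<close> the indicator matrix,
  \<open>H - PHP = (1 - P)H + PH(1 - P)\<close>. Symmetry of \<open>H\<close> reduces the second
  term to the one-sided bound with the test functions exchanged.\<close>

lemma cut_bound:
  assumes a: "\<And>x. x < T \<Longrightarrow> \<bar>a x\<bar> \<le> 1" and b: "\<And>y. y < T \<Longrightarrow> \<bar>b y\<bar> \<le> 1" and l: "l \<in> L"
  shows "\<bar>\<Sum>x<T. \<Sum>y<T. a x * b y * (hit l x y - density (cl x) (cl y) l)\<bar> \<le> 2 * real T ^ 2 * sqrt (2 * spread)"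
proof -
  have 1: "\<bar>\<Sum>x<T. \<Sum>y<T. (a x - avg a x) * b y * hit l x y\<bar> \<le> real T ^ 2 * sqrt (2 * spread)"
    by (rule cut_bound_left[OF a b l])
  have 2: "\<bar>\<Sum>y<T. \<Sum>x<T. (b y - avg b y) * avg a x * hit l y x\<bar> \<le> real T ^ 2 * sqrt (2 * spread)"
    using avg_abs_le[OF _ a] by (intro cut_bound_left[OF b _ l]) auto
  have "(\<Sum>x<T. \<Sum>y<T. avg a x * avg b y * hit l x y) = (\<Sum>x<T. avg a x * (\<Sum>y<T. avg b y * hit l x y))"
    by (simp add: sum_distrib_left mult.assoc)
  also have "\<dots> = (\<Sum>x<T. a x * avg (\<lambda>u. \<Sum>y<T. b y * avg (hit l u) y) x)"
    unfolding avg_self_adjoint[of b] avg_self_adjoint[of a] ..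
  also have "\<dots> = (\<Sum>x<T. \<Sum>y<T. a x * b y * density (cl x) (cl y) l)"
  proof (rule sum.cong[OF refl])
    fix x
    have "avg (\<lambda>u. \<Sum>y<T. b y * avg (hit l u) y) x = (\<Sum>y<T. b y * avg (\<lambda>u. avg (hit l u) y) x)"
      unfolding avg_def[of _ x] sum_distrib_left by (subst sum.swap) (simp add: mult_ac)
    then show "a x * avg (\<lambda>u. \<Sum>y<T. b y * avg (hit l u) y) x = (\<Sum>y<T. a x * b y * density (cl x) (cl y) l)"
      by (simp add: avg_avg_hit sum_distrib_left mult.assoc)
  qed
  finally have d: "(\<Sum>x<T. \<Sum>y<T. avg a x * avg b y * hit l x y) =
      (\<Sum>x<T. \<Sum>y<T. a x * b y * density (cl x) (cl y) l)" .
  have split: "(\<Sum>x<T. \<Sum>y<T. A x y) + (\<Sum>x<T. \<Sum>y<T. B x y) = (\<Sum>x<T. \<Sum>y<T. C x y) + (\<Sum>x<T. \<Sum>y<T. D x y)"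
    if "\<And>x y. A x y + B x y = C x y + D x y" for A B C D :: "nat \<Rightarrow> nat \<Rightarrow> real"
    using that by (simp only: sum.distrib[symmetric])
  have s1: "(\<Sum>x<T. \<Sum>y<T. a x * b y * (hit l x y - density (cl x) (cl y) l)) +
      (\<Sum>x<T. \<Sum>y<T. a x * b y * density (cl x) (cl y) l) =
      (\<Sum>x<T. \<Sum>y<T. a x * b y * hit l x y) + (\<Sum>x<T. \<Sum>y<T. 0)"
    by (rule split) (simp add: algebra_simps)
  have s2: "(\<Sum>x<T. \<Sum>y<T. (a x - avg a x) * b y * hit l x y) +
      (\<Sum>x<T. \<Sum>y<T. (b y - avg b y) * avg a x * hit l y x) =
      (\<Sum>x<T. \<Sum>y<T. a x * b y * hit l x y) + (\<Sum>x<T. \<Sum>y<T. - (avg a x * avg b y * hit l x y))"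
  proof (rule split)
    fix x y
    show "(a x - avg a x) * b y * hit l x y + (b y - avg b y) * avg a x * hit l y x =
        a x * b y * hit l x y + - (avg a x * avg b y * hit l x y)"
      unfolding hit_commute[of l y x] by (simp add: algebra_simps)
  qed
  have 3: "(\<Sum>x<T. \<Sum>y<T. a x * b y * (hit l x y - density (cl x) (cl y) l)) =
      (\<Sum>x<T. \<Sum>y<T. (a x - avg a x) * b y * hit l x y) +
      (\<Sum>x<T. \<Sum>y<T. (b y - avg b y) * avg a x * hit l y x)"
    using s1 s2 d by (simp add: sum_negf)
  have 4: "(\<Sum>x<T. \<Sum>y<T. (b y - avg b y) * avg a x * hit l y x) =
      (\<Sum>y<T. \<Sum>x<T. (b y - avg b y) * avg a x * hit l y x)" by (rule sum.swap)
  show ?thesis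
    unfolding 3 4 using order_trans[OF abs_triangle_ineq add_mono[OF 1 2]] by simp
qed

lemma d1_le: "d1 x u \<le> sqrt (sep T w x u)" "d1 x u \<le> 1" "d1 x u \<ge> 0"
proof -
  let ?g = "\<lambda>y. agree T w x y - agree T w u y"
  have "(\<Sum>y<T. 1 * \<bar>?g y\<bar>)\<^sup>2 \<le> (\<Sum>y<T. 1\<^sup>2) * (\<Sum>y<T. \<bar>?g y\<bar>\<^sup>2)"
    by (rule Cauchy_Schwarz_ineq_sum)
  then have cs: "(\<Sum>y<T. \<bar>?g y\<bar>)\<^sup>2 \<le> real T * (\<Sum>y<T. (?g y)\<^sup>2)"
    by simp
  have "(d1 x u)\<^sup>2 = (\<Sum>y<T. \<bar>?g y\<bar>)\<^sup>2 / (real T)\<^sup>2"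
    by (simp only: d1_def power_divide)
  also have "\<dots> \<le> (real T * (\<Sum>y<T. (?g y)\<^sup>2)) / (real T)\<^sup>2"
    using cs by (rule divide_right_mono) simp
  also have "\<dots> = sep T w x u"
    using T by (simp add: sep_def power2_eq_square)
  finally have "(d1 x u)\<^sup>2 \<le> sep T w x u" .
  then show "d1 x u \<le> sqrt (sep T w x u)" by (rule real_le_rsqrt)
  have le1: "\<bar>agree T w x y - agree T w u y\<bar> \<le> 1" for y
    using agree_bounds[of T w x y] agree_bounds[of T w u y] by linarith
  have "(\<Sum>y<T. \<bar>agree T w x y - agree T w u y\<bar>) \<le> (\<Sum>y<T. 1)"
    by (rule sum_mono) (rule le1)
  then have "(\<Sum>y<T. \<bar>agree T w x y - agree T w u y\<bar>) \<le> real T" by simp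
  then show "d1 x u \<le> 1" unfolding d1_def using T by (intro divide_le_eq_1_pos[THEN iffD2]) simp_all
  show "d1 x u \<ge> 0" by (auto simp: d1_def intro!: divide_nonneg_nonneg sum_nonneg)
qed

text \<open>Nodes in blocks with fewer than \<open>\<theta> T\<close> nodes are bounded trivially; in the other blocks the bad pairs have small weight.\<close>

lemma spread_bound:
  fixes \<epsilon>1 \<theta> :: real
  assumes \<epsilon>: "\<epsilon>1 \<ge> 0" and \<theta>: "\<theta> > 0"
  defines "bad \<equiv> {(x, u). x < T \<and> u < T \<and> cl u = cl x \<and> sep T w x u \<ge> \<epsilon>1}"
  shows "spread \<le> sqrt \<epsilon>1 + real (card bad) / (\<theta> * real T ^ 2) + k * \<theta>"
proof -
  let ?n = "\<lambda>x. real (card (block (cl x)))"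
  define p where "p x = (if ?n x < \<theta> * T then 1 else 0 :: real)" for x
  have pt: "mix x u * d1 x u \<le> mix x u * sqrt \<epsilon>1 + (if (x, u) \<in> bad then 1 / (\<theta> * T) else 0) + mix x u * p x"
    if "x < T" "u < T" for x u
  proof (cases "cl u = cl x \<and> sep T w x u \<ge> \<epsilon>1")
    case False
    have "mix x u * d1 x u \<le> mix x u * sqrt \<epsilon>1"
    proof (cases "cl u = cl x")
      case True
      then have "sep T w x u \<le> \<epsilon>1" using False by simp
      then have "sqrt (sep T w x u) \<le> sqrt \<epsilon>1" by (rule real_sqrt_le_mono)
      with d1_le(1) have "d1 x u \<le> sqrt \<epsilon>1" by (rule order_trans)
      then show ?thesis using mix_nonneg by (intro mult_left_mono)
    qed (simp add: mix_def)
    moreover have "mix x u * p x \<ge> 0" using mix_nonneg[of x u] by (simp add: p_def)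
    moreover have "(x, u) \<notin> bad" using False by (simp add: bad_def)
    ultimately show ?thesis by simp
  next
    case True
    then have b: "(x, u) \<in> bad" using that by (simp add: bad_def)
    have m: "mix x u * d1 x u \<le> mix x u" using d1_le(2)[of x u] mix_nonneg[of x u] by (simp add: mult_left_le)
    have s: "mix x u * sqrt \<epsilon>1 \<ge> 0" using mix_nonneg[of x u] \<epsilon> by simp
    show ?thesis
    proof (cases "?n x < \<theta> * T")
      case True
      then have "p x = 1" by (simp add: p_def)
      moreover have "1 / (\<theta> * T) \<ge> 0" using \<theta> by simp
      ultimately show ?thesis using m s by (simp only: b if_True mult_1_right)
    next
      case False
      \<comment> \<open>In a large block each member has averaging weight at most
        \<open>1 / (\<theta> * T)\<close>, which is the price of one bad pair.\<close>
      have "\<theta> * T > 0" using \<theta> T by simp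
      then have "mix x u \<le> 1 / (\<theta> * T)"
        using False \<open>cl u = cl x \<and> _\<close> by (simp add: mix_def frac_le)
      then show ?thesis using m s b False by (simp add: p_def)
    qed
  qed
  have "spread * T = (\<Sum>x<T. \<Sum>u<T. mix x u * d1 x u)"
    using T by (simp add: spread_def avg_def)
  also have "\<dots> \<le> (\<Sum>x<T. \<Sum>u<T. mix x u * sqrt \<epsilon>1 + (if (x, u) \<in> bad then 1 / (\<theta> * T) else 0) + mix x u * p x)"
    using pt by (intro sum_mono) simp
  also have "\<dots> = (\<Sum>x<T. sqrt \<epsilon>1 + (\<Sum>u<T. if (x, u) \<in> bad then 1 / (\<theta> * T) else 0) + p x)"
  proof (rule sum.cong[OF refl])
    fix x assume "x \<in> {..<T}"
    then have m: "(\<Sum>u<T. mix x u) = 1" by (intro sum_mix) simp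
    show "(\<Sum>u<T. mix x u * sqrt \<epsilon>1 + (if (x, u) \<in> bad then 1 / (\<theta> * T) else 0) + mix x u * p x) =
        sqrt \<epsilon>1 + (\<Sum>u<T. if (x, u) \<in> bad then 1 / (\<theta> * T) else 0) + p x"
      by (simp only: sum.distrib sum_distrib_right[symmetric] m mult_1_left)
  qed
  finally have 0: "spread * T \<le> T * sqrt \<epsilon>1 + (\<Sum>x<T. \<Sum>u<T. if (x, u) \<in> bad then 1 / (\<theta> * T) else 0) +
      (\<Sum>x<T. p x)"
    by (simp add: sum.distrib)
  have "(\<Sum>x<T. \<Sum>u<T. if (x, u) \<in> bad then 1 / (\<theta> * T) else 0) =
      (\<Sum>q\<in>{..<T} \<times> {..<T}. if q \<in> bad then 1 / (\<theta> * T) else 0)"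
    by (simp only: sum.cartesian_product split_def prod.collapse)
  also have "\<dots> = (\<Sum>q\<in>{..<T} \<times> {..<T} \<inter> bad. 1 / (\<theta> * T))"
    by (rule sum.inter_restrict[symmetric]) simp
  also have "{..<T} \<times> {..<T} \<inter> bad = bad"
    unfolding bad_def by (rule Int_absorb1) blast
  finally have 1: "spread * T \<le> T * sqrt \<epsilon>1 + card bad / (\<theta> * T) + (\<Sum>x<T. p x)"
    using 0 by simp
  have 2: "(\<Sum>x<T. p x) \<le> real k * (\<theta> * real T)"
  proof -
    have "(\<Sum>x<T. p x) = (\<Sum>c<k. \<Sum>x\<in>{x \<in> {..<T}. cl x = c}. p x)"
      using cl by (intro sum.group[symmetric]) auto
    also have "\<dots> \<le> (\<Sum>c<k. \<theta> * real T)"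
    proof (rule sum_mono)
      fix c
      have "(\<Sum>x\<in>{x \<in> {..<T}. cl x = c}. p x) = (\<Sum>x\<in>block c. if real (card (block c)) < \<theta> * T then 1 else 0)"
        by (intro sum.cong) (auto simp: block_def p_def)
      also have "\<dots> \<le> \<theta> * real T" using \<theta> by simp
      finally show "(\<Sum>x\<in>{x \<in> {..<T}. cl x = c}. p x) \<le> \<theta> * real T" .
    qed
    finally show ?thesis by simp
  qed
  have "(sqrt \<epsilon>1 + real (card bad) / (\<theta> * real T ^ 2) + k * \<theta>) * T =
      T * sqrt \<epsilon>1 + card bad / (\<theta> * T) + real k * (\<theta> * real T)"
    using T by (simp add: distrib_right power2_eq_square)
  then have "spread * T \<le> (sqrt \<epsilon>1 + real (card bad) / (\<theta> * real T ^ 2) + k * \<theta>) * T"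
    using 1 2 by linarith
  then show ?thesis using T by simp
qed

end

section \<open>Counting lemma and block models\<close>

definition pairs :: "nat set \<Rightarrow> nat set set" where
  "pairs U = {e. e \<subseteq> U \<and> card e = 2}"

lemma finite_pairs: "finite U \<Longrightarrow> finite (pairs U)"
  unfolding pairs_def by (rule finite_subset[of _ "Pow U"]) auto

text \<open>A stochastic block model with \<open>k\<close> blocks. Laws are required at every
  \<open>s\<close>, so that each index carries a probability distribution.\<close>

definition sbm :: "real set \<Rightarrow> nat \<Rightarrow> (nat \<Rightarrow> real) \<Rightarrow> (nat set \<times> real \<Rightarrow> real) \<Rightarrow> bool" where
  "sbm L k \<alpha> \<beta> \<longleftrightarrow> (\<forall>i<k. \<alpha> i \<ge> 0) \<and> (\<Sum>i<k. \<alpha> i) = 1 \<and>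
     (\<forall>s. \<forall>l\<in>L. \<beta> (s, l) \<ge> 0) \<and> (\<forall>s. (\<Sum>l\<in>L. \<beta> (s, l)) = 1)"

definition shom :: "real set \<Rightarrow> nat \<Rightarrow> (nat \<Rightarrow> real) \<Rightarrow> (nat set \<times> real \<Rightarrow> real) \<Rightarrow> nat set \<Rightarrow> nat set multiset \<Rightarrow> real" where
  "shom L k \<alpha> \<beta> U E = (\<Sum>\<phi>\<in>U \<rightarrow>\<^sub>E {..<k}. (\<Prod>i\<in>U. \<alpha> (\<phi> i)) *
     (\<Prod>e\<in>pairs U. \<Sum>l\<in>L. l ^ count E e * \<beta> (\<phi> ` e, l)))"

lemma abs_prod_le_power:
  fixes g :: "'a \<Rightarrow> real"
  assumes "\<And>e. e \<in> S \<Longrightarrow> \<bar>g e\<bar> \<le> M"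
  shows "\<bar>\<Prod>e\<in>S. g e\<bar> \<le> M ^ card S"
proof -
  have "(\<Prod>e\<in>S. \<bar>g e\<bar>) \<le> (\<Prod>e\<in>S. M)" using assms by (intro prod_mono) simp
  then show ?thesis by (simp add: abs_prod)
qed

text \<open>With the other nodes frozen, no remaining pair contains both \<open>i\<close> and
  \<open>j\<close>, so the remaining product splits into a function of \<open>x\<close> times a
  function of \<open>y\<close>. Divided by powers of \<open>M\<close>, these are admissible test
  functions.\<close>

lemma edge_step:
  fixes H :: "nat set \<Rightarrow> nat set \<Rightarrow> real" and d :: "nat set \<Rightarrow> real"
  assumes T: "T \<ge> 1" and U: "finite U" "i \<in> U" "j \<in> U" "i \<noteq> j"
    and P: "finite P" "\<And>e. e \<in> P \<Longrightarrow> e \<subseteq> U \<and> card e = 2 \<and> e \<noteq> {i, j}"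
    and H: "\<And>e x y. e \<in> P \<Longrightarrow> x < T \<Longrightarrow> y < T \<Longrightarrow> \<bar>H e {x, y}\<bar> \<le> M" and M: "M > 0"
    and d: "\<And>a b. (\<And>x. x < T \<Longrightarrow> \<bar>a x\<bar> \<le> 1) \<Longrightarrow> (\<And>y. y < T \<Longrightarrow> \<bar>b y\<bar> \<le> 1) \<Longrightarrow>
      \<bar>\<Sum>x<T. \<Sum>y<T. a x * b y * d {x, y}\<bar> \<le> D"
  shows "\<bar>\<Sum>\<psi>\<in>U \<rightarrow>\<^sub>E {..<T}. d (\<psi> ` {i, j}) * (\<Prod>e\<in>P. H e (\<psi> ` e))\<bar> \<le>
    real T ^ (card U - 2) * (M ^ card P * D)"
proof -
  define V where "V = U - {i, j}"
  have UV: "U = insert i (insert j V)" "finite V" "j \<notin> V" "i \<notin> insert j V"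
    using U by (auto simp: V_def)
  have cV: "card V = card U - 2" using UV by simp
  define F where "F \<psi> = d (\<psi> ` {i, j}) * (\<Prod>e\<in>P. H e (\<psi> ` e))" for \<psi> :: "nat \<Rightarrow> nat"
  have one: "\<bar>\<Sum>y<T. \<Sum>x<T. F (\<rho>(j := y, i := x))\<bar> \<le> M ^ card P * D" if \<rho>: "\<rho> \<in> V \<rightarrow>\<^sub>E {..<T}" for \<rho>
  proof -
    \<comment> \<open>Pairs in \<open>P1\<close> avoid \<open>j\<close>, because
      \<open>{i, j}\<close> itself is excluded from \<open>P\<close>.\<close>
    define P1 where "P1 = {e \<in> P. i \<in> e}"
    define P2 where "P2 = {e \<in> P. i \<notin> e}"
    have PP: "P = P1 \<union> P2" "P1 \<inter> P2 = {}" "finite P1" "finite P2"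
      using P(1) by (auto simp: P1_def P2_def)
    \<comment> \<open>\<open>A\<close> does not depend on the image of \<open>j\<close>; the
      placeholder \<open>0\<close> is below \<open>T\<close>, so the bound \<open>M\<close> still
      applies.\<close>
    define A where "A x = (\<Prod>e\<in>P1. H e ((\<rho>(j := 0, i := x)) ` e))" for x
    define B where "B y = (\<Prod>e\<in>P2. H e ((\<rho>(j := y, i := 0)) ` e))" for y
    have bd: "\<bar>H e ((\<rho>(j := y, i := x)) ` e)\<bar> \<le> M" if "e \<in> P" "x < T" "y < T" for e x y
    proof -
      have "card e = 2" "e \<subseteq> U" using P(2)[OF that(1)] by simp_all
      then obtain p q where e: "e = {p, q}" "p \<in> U" "q \<in> U" by (auto simp: card_2_iff)
      let ?f = "\<rho>(j := y, i := x)"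
      have f: "?f z < T" if "z \<in> U" for z
        using that UV(1) \<open>x < T\<close> \<open>y < T\<close> PiE_mem[OF \<rho>, of z] by auto
      have "?f ` e = {?f p, ?f q}" unfolding e(1) by (simp only: image_insert image_empty)
      then show ?thesis using H[OF that(1) f[OF e(2)] f[OF e(3)]] by (simp only:)
    qed
    have T0: "0 < T" using T by simp
    have A: "\<bar>A x\<bar> \<le> M ^ card P1" if "x < T" for x
      unfolding A_def using that T0 by (intro abs_prod_le_power bd) (simp_all add: P1_def)
    have B: "\<bar>B y\<bar> \<le> M ^ card P2" if "y < T" for y
      unfolding B_def using that T0 by (intro abs_prod_le_power bd) (simp_all add: P2_def)
    have "F (\<rho>(j := y, i := x)) = A x * B y * d {x, y}" for x y
    proof -
      have 1: "H e ((\<rho>(j := y, i := x)) ` e) = H e ((\<rho>(j := 0, i := x)) ` e)" if e: "e \<in> P1" for e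
      proof -
        have ee: "card e = 2" "e \<noteq> {i, j}" "i \<in> e" using e P(2)[of e] by (simp_all add: P1_def)
        have "finite e" using ee(1) by (metis card.infinite zero_neq_numeral)
        have "j \<notin> e"
        proof
          assume "j \<in> e"
          then have "{i, j} = e" using ee U(4) \<open>finite e\<close> by (intro card_subset_eq) auto
          then show False using ee(2) by simp
        qed
        then have "(\<rho>(j := y, i := x)) ` e = (\<rho>(j := 0, i := x)) ` e" by (intro image_cong) auto
        then show ?thesis by simp
      qed
      have 2: "H e ((\<rho>(j := y, i := x)) ` e) = H e ((\<rho>(j := y, i := 0)) ` e)" if e: "e \<in> P2" for e
      proof -
        have "i \<notin> e" using e by (simp add: P2_def)
        then have "(\<rho>(j := y, i := x)) ` e = (\<rho>(j := y, i := 0)) ` e" by (intro image_cong) auto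
        then show ?thesis by simp
      qed
      have "(\<Prod>e\<in>P. H e ((\<rho>(j := y, i := x)) ` e)) = A x * B y"
        unfolding PP(1) prod.union_disjoint[OF PP(3,4,2)] A_def B_def
        using 1 2 by simp
      moreover have "(\<rho>(j := y, i := x)) ` {i, j} = {x, y}" using U(4) by auto
      ultimately show ?thesis unfolding F_def by simp
    qed
    then have "(\<Sum>y<T. \<Sum>x<T. F (\<rho>(j := y, i := x))) = (\<Sum>x<T. \<Sum>y<T. A x * B y * d {x, y})"
      by (subst sum.swap) simp
    also have "\<dots> = (M ^ card P1 * M ^ card P2) * (\<Sum>x<T. \<Sum>y<T. (A x / M ^ card P1) * (B y / M ^ card P2) * d {x, y})"
      unfolding sum_distrib_left using M by (intro sum.cong refl) simp
    also have "M ^ card P1 * M ^ card P2 = M ^ card P"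
      unfolding PP(1) using PP by (simp add: card_Un_disjoint power_add)
    finally have eq: "(\<Sum>y<T. \<Sum>x<T. F (\<rho>(j := y, i := x))) =
      M ^ card P * (\<Sum>x<T. \<Sum>y<T. (A x / M ^ card P1) * (B y / M ^ card P2) * d {x, y})" .
    have "\<bar>\<Sum>x<T. \<Sum>y<T. (A x / M ^ card P1) * (B y / M ^ card P2) * d {x, y}\<bar> \<le> D"
      using A B M by (intro d) (simp_all add: divide_le_eq_1_pos)
    then show ?thesis unfolding eq abs_mult using M by (simp add: mult_left_mono)
  qed
  have "(\<Sum>\<psi>\<in>U \<rightarrow>\<^sub>E {..<T}. F \<psi>) = (\<Sum>\<rho>\<in>V \<rightarrow>\<^sub>E {..<T}. \<Sum>y<T. \<Sum>x<T. F (\<rho>(j := y, i := x)))"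
    unfolding UV(1) using UV by (subst sum_PiE_insert, simp, simp, simp)+ simp
  also have "\<bar>\<dots>\<bar> \<le> (\<Sum>\<rho>\<in>V \<rightarrow>\<^sub>E {..<T}. M ^ card P * D)"
    by (rule order_trans[OF sum_abs], rule sum_mono, rule one)
  also have "\<dots> = real T ^ (card U - 2) * (M ^ card P * D)"
    using UV(2) cV by (simp add: card_PiE)
  finally show ?thesis unfolding F_def .
qed

text \<open>The pairs are changed from \<open>G\<close> to \<open>G'\<close> one at a time;
  \<open>h S\<close> is the hybrid in which those in \<open>S\<close> have been changed.\<close>

lemma counting:
  fixes G G' :: "nat set \<Rightarrow> nat set \<Rightarrow> real"
  assumes T: "T \<ge> 1" and U: "finite U" and P: "finite P" "P \<subseteq> pairs U"
    and G: "\<And>e x y. e \<in> P \<Longrightarrow> x < T \<Longrightarrow> y < T \<Longrightarrow> \<bar>G e {x, y}\<bar> \<le> M"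
    and G': "\<And>e x y. e \<in> P \<Longrightarrow> x < T \<Longrightarrow> y < T \<Longrightarrow> \<bar>G' e {x, y}\<bar> \<le> M" and M: "M > 0"
    and d: "\<And>e a b. e \<in> P \<Longrightarrow> (\<And>x. x < T \<Longrightarrow> \<bar>a x\<bar> \<le> 1) \<Longrightarrow> (\<And>y. y < T \<Longrightarrow> \<bar>b y\<bar> \<le> 1) \<Longrightarrow>
      \<bar>\<Sum>x<T. \<Sum>y<T. a x * b y * (G' e {x, y} - G e {x, y})\<bar> \<le> D"
  shows "\<bar>(\<Sum>\<psi>\<in>U \<rightarrow>\<^sub>E {..<T}. \<Prod>e\<in>P. G' e (\<psi> ` e)) - (\<Sum>\<psi>\<in>U \<rightarrow>\<^sub>E {..<T}. \<Prod>e\<in>P. G e (\<psi> ` e))\<bar> \<le>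
    card P * (real T ^ (card U - 2) * (M ^ (card P - 1) * D))"
proof -
  define h where "h S e = (if e \<in> S then G' e else G e)" for S e
  let ?s = "\<lambda>S. \<Sum>\<psi>\<in>U \<rightarrow>\<^sub>E {..<T}. \<Prod>e\<in>P. h S e (\<psi> ` e)"
  let ?c = "real T ^ (card U - 2) * (M ^ (card P - 1) * D)"
  have claim: "S \<subseteq> P \<longrightarrow> \<bar>?s S - ?s {}\<bar> \<le> card S * ?c" if "finite S" for S
    using that
  proof (induction S rule: finite_induct)
    case (insert e0 S)
    show ?case
    proof
      assume S: "insert e0 S \<subseteq> P"
      then have e0: "e0 \<in> P" "e0 \<in> pairs U" using P by auto
      then obtain i j where ij: "e0 = {i, j}" "i \<noteq> j" "i \<in> U" "j \<in> U"
        by (auto simp: pairs_def card_2_iff)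
      have "?s (insert e0 S) - ?s S =
          (\<Sum>\<psi>\<in>U \<rightarrow>\<^sub>E {..<T}. (G' e0 (\<psi> ` {i, j}) - G e0 (\<psi> ` {i, j})) * (\<Prod>e\<in>P - {e0}. h S e (\<psi> ` e)))"
        unfolding sum_subtractf[symmetric]
      proof (rule sum.cong[OF refl])
        fix \<psi> :: "nat \<Rightarrow> nat"
        have "(\<Prod>e\<in>P - {e0}. h (insert e0 S) e (\<psi> ` e)) = (\<Prod>e\<in>P - {e0}. h S e (\<psi> ` e))"
          by (intro prod.cong refl) (simp add: h_def)
        moreover have "h (insert e0 S) e0 = G' e0" "h S e0 = G e0" using insert(2) by (simp_all add: h_def)
        ultimately show "(\<Prod>e\<in>P. h (insert e0 S) e (\<psi> ` e)) - (\<Prod>e\<in>P. h S e (\<psi> ` e)) =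
            (G' e0 (\<psi> ` {i, j}) - G e0 (\<psi> ` {i, j})) * (\<Prod>e\<in>P - {e0}. h S e (\<psi> ` e))"
          unfolding prod.remove[OF P(1) e0(1)] by (simp add: left_diff_distrib ij(1)[symmetric])
      qed
      also have "\<bar>\<dots>\<bar> \<le> real T ^ (card U - 2) * (M ^ card (P - {e0}) * D)"
      proof (rule edge_step[OF T U ij(3,4,2)])
        show "e \<subseteq> U \<and> card e = 2 \<and> e \<noteq> {i, j}" if "e \<in> P - {e0}" for e
          using that P(2) ij(1) by (auto simp: pairs_def)
        show "\<bar>h S e {x, y}\<bar> \<le> M" if "e \<in> P - {e0}" "x < T" "y < T" for e x y
          using that G G' by (simp add: h_def)
      qed (use P(1) M d[OF e0(1)] in simp_all)
      also have "card (P - {e0}) = card P - 1" using P(1) e0 by simp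
      finally have "\<bar>?s (insert e0 S) - ?s S\<bar> \<le> ?c" .
      moreover have "\<bar>?s S - ?s {}\<bar> \<le> card S * ?c" using insert.IH S by simp
      moreover have "real (card (insert e0 S)) * ?c = ?c + card S * ?c"
        using insert(1,2) by (simp add: distrib_right)
      ultimately show "\<bar>?s (insert e0 S) - ?s {}\<bar> \<le> card (insert e0 S) * ?c" by linarith
    qed
  qed simp
  have "?s P = (\<Sum>\<psi>\<in>U \<rightarrow>\<^sub>E {..<T}. \<Prod>e\<in>P. G' e (\<psi> ` e))"
    "?s {} = (\<Sum>\<psi>\<in>U \<rightarrow>\<^sub>E {..<T}. \<Prod>e\<in>P. G e (\<psi> ` e))"
    by (simp_all add: h_def)
  then show ?thesis using claim[OF P(1)] by simp
qed

lemma dens_single: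
  assumes U: "finite U" and E: "\<And>e. e \<in># E \<Longrightarrow> e \<subseteq> U \<and> card e = 2"
  shows "dens U (Poly_Mapping.single E 1) T w =
    (\<Sum>\<psi>\<in>U \<rightarrow>\<^sub>E {..<T}. \<Prod>e\<in>pairs U. w (\<psi> ` e) ^ count E e) / real T ^ card U"
proof -
  have "prod_mset (image_mset (\<lambda>e. w (\<psi> ` e)) E) = (\<Prod>e\<in>pairs U. w (\<psi> ` e) ^ count E e)" for \<psi> :: "nat \<Rightarrow> nat"
    unfolding image_prod_mset_multiplicity
    using E finite_pairs[OF U] by (intro prod.mono_neutral_left) (auto simp: pairs_def not_in_iff)
  then show ?thesis by (simp add: dens_def ev_single)
qed

section \<open>The block model of a partition\<close>

context coloured_partition
begin

lemma block_sum:
  assumes U: "finite U"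
  shows "(\<Sum>\<psi>\<in>U \<rightarrow>\<^sub>E {..<T}. K (\<lambda>i\<in>U. cl (\<psi> i))) =
    (\<Sum>\<phi>\<in>U \<rightarrow>\<^sub>E {..<k}. (\<Prod>i\<in>U. real (card (block (\<phi> i)))) * K \<phi>)"
proof -
  let ?F = "U \<rightarrow>\<^sub>E {..<T}" and ?r = "\<lambda>\<psi>. \<lambda>i\<in>U. cl (\<psi> i)"
  have fin: "finite ?F" "finite (U \<rightarrow>\<^sub>E {..<k})" using U by (simp_all add: finite_PiE)
  have "?r ` ?F \<subseteq> U \<rightarrow>\<^sub>E {..<k}"
  proof (rule image_subsetI)
    fix \<psi> assume "\<psi> \<in> ?F"
    then have "cl (\<psi> i) < k" if "i \<in> U" for i using PiE_mem[of \<psi> U "\<lambda>_. {..<T}" i] that cl by simp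
    then show "?r \<psi> \<in> U \<rightarrow>\<^sub>E {..<k}" by simp
  qed
  then have "(\<Sum>\<psi>\<in>?F. K (?r \<psi>)) = (\<Sum>\<phi>\<in>U \<rightarrow>\<^sub>E {..<k}. \<Sum>\<psi>\<in>{\<psi> \<in> ?F. ?r \<psi> = \<phi>}. K (?r \<psi>))"
    by (intro sum.group[symmetric] fin)
  also have "\<dots> = (\<Sum>\<phi>\<in>U \<rightarrow>\<^sub>E {..<k}. (\<Prod>i\<in>U. real (card (block (\<phi> i)))) * K \<phi>)"
  proof (rule sum.cong[OF refl])
    fix \<phi> assume \<phi>: "\<phi> \<in> U \<rightarrow>\<^sub>E {..<k}"
    have "{\<psi> \<in> ?F. ?r \<psi> = \<phi>} = (\<Pi>\<^sub>E i\<in>U. block (\<phi> i))"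
    proof (intro set_eqI iffI)
      fix \<psi> assume a: "\<psi> \<in> {\<psi> \<in> ?F. ?r \<psi> = \<phi>}"
      then have r: "?r \<psi> = \<phi>" by simp
      have e: "cl (\<psi> i) = ?r \<psi> i" if "i \<in> U" for i using that by simp
      have "cl (\<psi> i) = \<phi> i" if "i \<in> U" for i
        using e[OF that] fun_cong[OF r, of i] by (rule trans)
      moreover have "\<psi> i < T" if "i \<in> U" for i
        using a that PiE_mem[of \<psi> U "\<lambda>_. {..<T}" i] by simp
      ultimately have "\<psi> i < T" "cl (\<psi> i) = \<phi> i" if "i \<in> U" for i using that by blast+
      then show "\<psi> \<in> (\<Pi>\<^sub>E i\<in>U. block (\<phi> i))" using a by (simp add: PiE_iff block_def)
    next
      fix \<psi> assume a: "\<psi> \<in> (\<Pi>\<^sub>E i\<in>U. block (\<phi> i))"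
      then have b: "\<psi> i < T" "cl (\<psi> i) = \<phi> i" if "i \<in> U" for i
        using PiE_mem[OF a that] by (simp_all add: block_def)
      then have "?r \<psi> = \<phi>" using \<phi> by (intro PiE_ext[of _ U "\<lambda>_. UNIV"]) (auto simp: PiE_iff)
      then show "\<psi> \<in> {\<psi> \<in> ?F. ?r \<psi> = \<phi>}" using a b by (simp add: PiE_iff)
    qed
    then have "real (card {\<psi> \<in> ?F. ?r \<psi> = \<phi>}) = (\<Prod>i\<in>U. real (card (block (\<phi> i))))"
      using U by (simp add: card_PiE)
    moreover have "(\<Sum>\<psi>\<in>{\<psi> \<in> ?F. ?r \<psi> = \<phi>}. K (?r \<psi>)) = (\<Sum>\<psi>\<in>{\<psi> \<in> ?F. ?r \<psi> = \<phi>}. K \<phi>)"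
      by (intro sum.cong refl) simp
    ultimately show "(\<Sum>\<psi>\<in>{\<psi> \<in> ?F. ?r \<psi> = \<phi>}. K (?r \<psi>)) = (\<Prod>i\<in>U. real (card (block (\<phi> i)))) * K \<phi>"
      by simp
  qed
  finally show ?thesis .
qed

definition weight :: "nat \<Rightarrow> real" where
  "weight c = card (block c) / T"

text \<open>\<open>Min\<close> and \<open>Max\<close> recover both ends of an unordered pair of
  blocks, loops included; \<open>density\<close> is symmetric. Involving an empty block it would be
  zero, so a point mass is put there to keep a probability law.\<close>

definition law :: "nat set \<times> real \<Rightarrow> real" where
  "law p = (case p of (s, l) \<Rightarrow>
     if block (Min s) \<noteq> {} \<and> block (Max s) \<noteq> {} then density (Min s) (Max s) l
     else if l = (SOME l. l \<in> L) then 1 else 0)"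

lemma sum_density:
  assumes "block c \<noteq> {}" "block c' \<noteq> {}"
  shows "(\<Sum>l\<in>L. density c c' l) = 1"
proof -
  have "(\<Sum>l\<in>L. \<Sum>u\<in>block c. \<Sum>u'\<in>block c'. hit l u u') = (\<Sum>u\<in>block c. \<Sum>u'\<in>block c'. \<Sum>l\<in>L. hit l u u')"
    by (subst sum.swap) (intro sum.cong refl sum.swap)
  also have "\<dots> = (\<Sum>u\<in>block c. \<Sum>u'\<in>block c'. 1)"
  proof (intro sum.cong refl)
    fix u u' assume "u \<in> block c" "u' \<in> block c'"
    then have "w {u, u'} \<in> L" using w by (simp add: block_def)
    then show "(\<Sum>l\<in>L. hit l u u') = 1" using L by (simp add: hit_def)
  qed
  finally show ?thesis
    using assms by (simp add: density_def sum_divide_distrib[symmetric] card_gt_0_iff)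
qed

lemma L_nonempty: "L \<noteq> {}"
  using w[of 0 0] T by auto

lemma sbm_block: "sbm L k weight law"
proof -
  have "(\<Sum>i<k. real (card (block i))) = T"
  proof -
    have "(\<Sum>i<k. \<Sum>x\<in>{x \<in> {..<T}. cl x = i}. 1::real) = (\<Sum>x<T. 1)"
      using cl by (intro sum.group) auto
    then show ?thesis by (simp add: block_def)
  qed
  then have "(\<Sum>i<k. weight i) = 1" using T by (simp add: weight_def sum_divide_distrib[symmetric])
  moreover have "law (s, l) \<ge> 0" for s l
  proof -
    have "hit l x y \<ge> 0" for x y by (simp add: hit_def)
    then show ?thesis
      by (auto simp: law_def density_def intro!: divide_nonneg_nonneg sum_nonneg)
  qed
  moreover have "(\<Sum>l\<in>L. law (s, l)) = 1" for s
  proof (cases "block (Min s) \<noteq> {} \<and> block (Max s) \<noteq> {}")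
    case True
    then show ?thesis using sum_density[of "Min s" "Max s"] by (simp add: law_def)
  next
    case False
    have "(SOME l. l \<in> L) \<in> L" using L_nonempty by (simp add: some_in_eq)
    moreover have "law (s, l) = (if l = (SOME l. l \<in> L) then 1 else 0)" for l
      using False unfolding law_def by (simp only: prod.case if_False)
    ultimately show ?thesis using L by (simp add: sum.delta)
  qed
  ultimately show ?thesis by (simp add: sbm_def weight_def)
qed

lemma law_cl:
  assumes "x < T" "y < T"
  shows "law ({cl x, cl y}, l) = density (cl x) (cl y) l"
proof -
  have "block (cl x) \<noteq> {}" "block (cl y) \<noteq> {}" using block_pos assms by (force simp: card_gt_0_iff)+
  then show ?thesis
    using density_commute[of "cl x" "cl y" l] by (auto simp: law_def min_def max_def)
qed

text \<open>The counting lemma compares powers of actual colours with their means over pairs of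
  classes. Both are combinations of the colour indicators, so the cut bound for each colour
  applies.\<close>

lemma block_approx:
  fixes b :: real
  assumes U: "finite U" and E: "\<And>e. e \<in># E \<Longrightarrow> e \<subseteq> U \<and> card e = 2"
    and b: "b \<ge> 1" "\<And>l. l \<in> L \<Longrightarrow> \<bar>l\<bar> \<le> b"
  shows "\<bar>dens U (Poly_Mapping.single E 1) T w - shom L k weight law U E\<bar> \<le>
    card (pairs U) * (b ^ size E) ^ card (pairs U) * card L * 2 * sqrt (2 * spread)"
proof -
  \<comment> \<open>One bound for all multiplicities, since each is at most \<open>size E\<close>
    and \<open>b\<close> is at least \<open>1\<close>.\<close>
  define M where "M = b ^ size E"
  have M: "M \<ge> 1" unfolding M_def using b(1) by simp
  define G where "G e s = w s ^ count E e" for e s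
  define G' where "G' e s = (\<Sum>l\<in>L. l ^ count E e * law (cl ` s, l))" for e s
  let ?p = "card (pairs U)"
  have lM: "\<bar>l ^ count E e\<bar> \<le> M" if "l \<in> L" for l e
  proof -
    have "\<bar>l ^ count E e\<bar> \<le> b ^ count E e" using b(2)[OF that] by (simp add: power_abs power_mono)
    also have "\<dots> \<le> M" unfolding M_def using b(1) count_le_size by (intro power_increasing)
    finally show ?thesis .
  qed
  have law0: "law (s, l) \<ge> 0" if "l \<in> L" for s l using sbm_block that by (simp add: sbm_def)
  have law1: "(\<Sum>l\<in>L. law (s, l)) = 1" for s using sbm_block by (simp add: sbm_def)
  have d: "\<bar>\<Sum>x<T. \<Sum>y<T. a x * c y * (G' e {x, y} - G e {x, y})\<bar> \<le> card L * (M * (2 * real T ^ 2 * sqrt (2 * spread)))"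
    if a: "\<And>x. x < T \<Longrightarrow> \<bar>a x\<bar> \<le> 1" and c: "\<And>y. y < T \<Longrightarrow> \<bar>c y\<bar> \<le> 1" for e a c
  proof -
    have "(\<Sum>x<T. \<Sum>y<T. a x * c y * (G' e {x, y} - G e {x, y})) =
        (\<Sum>x<T. \<Sum>y<T. \<Sum>l\<in>L. - (l ^ count E e * (a x * c y * (hit l x y - density (cl x) (cl y) l))))"
    proof (intro sum.cong refl)
      fix x y assume xy: "x \<in> {..<T}" "y \<in> {..<T}"
      have "w {x, y} ^ count E e = (\<Sum>l\<in>L. if w {x, y} = l then l ^ count E e else 0)"
        using w[of x y] xy L by simp
      also have "\<dots> = (\<Sum>l\<in>L. l ^ count E e * hit l x y)"
        by (intro sum.cong refl) (simp add: hit_def)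
      finally have "G' e {x, y} - G e {x, y} = (\<Sum>l\<in>L. - (l ^ count E e * (hit l x y - density (cl x) (cl y) l)))"
        unfolding G_def G'_def using law_cl[of x y] xy
        by (simp add: sum_subtractf[symmetric] right_diff_distrib)
      then show "a x * c y * (G' e {x, y} - G e {x, y}) =
          (\<Sum>l\<in>L. - (l ^ count E e * (a x * c y * (hit l x y - density (cl x) (cl y) l))))"
        by (simp only: sum_distrib_left mult_minus_right mult_ac)
    qed
    also have "\<dots> = (\<Sum>l\<in>L. - (l ^ count E e * (\<Sum>x<T. \<Sum>y<T. a x * c y * (hit l x y - density (cl x) (cl y) l))))"
    proof -
      have "(\<Sum>x<T. \<Sum>y<T. \<Sum>l\<in>L. F x y l) = (\<Sum>l\<in>L. \<Sum>x<T. \<Sum>y<T. F x y l)" for F :: "nat \<Rightarrow> nat \<Rightarrow> real \<Rightarrow> real"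
        by (subst sum.swap[of _ L]) (intro sum.cong refl sum.swap)
      then show ?thesis by (simp only: sum_distrib_left sum_negf)
    qed
    finally have eq: "(\<Sum>x<T. \<Sum>y<T. a x * c y * (G' e {x, y} - G e {x, y})) =
        (\<Sum>l\<in>L. - (l ^ count E e * (\<Sum>x<T. \<Sum>y<T. a x * c y * (hit l x y - density (cl x) (cl y) l))))" .
    have "\<bar>\<Sum>x<T. \<Sum>y<T. a x * c y * (G' e {x, y} - G e {x, y})\<bar> \<le> (\<Sum>l\<in>L. M * (2 * real T ^ 2 * sqrt (2 * spread)))"
      unfolding eq using cut_bound[OF a c] lM M
      by (intro order_trans[OF sum_abs] sum_mono) (simp add: abs_mult mult_mono del: power_abs)
    then show ?thesis by simp
  qed
  have "\<bar>(\<Sum>\<psi>\<in>U \<rightarrow>\<^sub>E {..<T}. \<Prod>e\<in>pairs U. G' e (\<psi> ` e)) - (\<Sum>\<psi>\<in>U \<rightarrow>\<^sub>E {..<T}. \<Prod>e\<in>pairs U. G e (\<psi> ` e))\<bar> \<le>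
    ?p * (real T ^ (card U - 2) * (M ^ (?p - 1) * (card L * (M * (2 * real T ^ 2 * sqrt (2 * spread))))))"
  proof (rule counting[OF T U finite_pairs[OF U] subset_refl _ _ _ d])
    show "\<bar>G e {x, y}\<bar> \<le> M" if "x < T" "y < T" for e x y
      unfolding G_def using lM w[OF that] by simp
    show "\<bar>G' e {x, y}\<bar> \<le> M" for e x y
    proof -
      have "\<bar>G' e {x, y}\<bar> \<le> (\<Sum>l\<in>L. M * law (cl ` {x, y}, l))"
        unfolding G'_def using lM law0
        by (intro order_trans[OF sum_abs] sum_mono) (simp only: abs_mult abs_of_nonneg mult_right_mono)
      also have "\<dots> = M" using law1 by (simp only: sum_distrib_left[symmetric] mult_1_right)
      finally show ?thesis .
    qed
  qed (use M in auto)
  also have "\<dots> \<le> (?p * M ^ ?p * card L * 2 * sqrt (2 * spread)) * real T ^ card U"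
  \<comment> \<open>A pair in \<open>U\<close> is needed for the truncated exponent
    \<open>card U - 2\<close> to be a true difference; without pairs both sides are zero.\<close>
  proof (cases "?p = 0")
    case False
    then have "pairs U \<noteq> {}" by auto
    then obtain e where e: "e \<subseteq> U" "card e = 2" unfolding pairs_def by blast
    then have "card U \<ge> 2" using U card_mono[of U e] by simp
    then have "real T ^ (card U - 2) * real T ^ 2 = real T ^ card U"
      by (simp only: power_add[symmetric] le_add_diff_inverse2)
    moreover have "M ^ (?p - 1) * M = M ^ ?p" using False by (simp flip: power_Suc2)
    moreover have "?p * (real T ^ (card U - 2) * (M ^ (?p - 1) * (card L * (M * (2 * real T ^ 2 * sqrt (2 * spread)))))) =
        ?p * (M ^ (?p - 1) * M) * card L * 2 * sqrt (2 * spread) * (real T ^ (card U - 2) * real T ^ 2)"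
      by (simp only: mult_ac)
    ultimately show ?thesis by (simp only: order_refl)
  qed simp
  finally have main: "\<bar>(\<Sum>\<psi>\<in>U \<rightarrow>\<^sub>E {..<T}. \<Prod>e\<in>pairs U. G' e (\<psi> ` e)) - (\<Sum>\<psi>\<in>U \<rightarrow>\<^sub>E {..<T}. \<Prod>e\<in>pairs U. G e (\<psi> ` e))\<bar> \<le>
      (?p * M ^ ?p * card L * 2 * sqrt (2 * spread)) * real T ^ card U" .
  have Tp: "real T ^ card U > 0" using T by simp
  have dd: "dens U (Poly_Mapping.single E 1) T w = (\<Sum>\<psi>\<in>U \<rightarrow>\<^sub>E {..<T}. \<Prod>e\<in>pairs U. G e (\<psi> ` e)) / real T ^ card U"
    unfolding G_def by (rule dens_single[OF U E])
  have "shom L k weight law U E = (\<Sum>\<psi>\<in>U \<rightarrow>\<^sub>E {..<T}. \<Prod>e\<in>pairs U. G' e (\<psi> ` e)) / real T ^ card U"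
  proof -
    let ?K = "\<lambda>\<phi>. \<Prod>e\<in>pairs U. \<Sum>l\<in>L. l ^ count E e * law (\<phi> ` e, l)"
    have "(\<Sum>\<psi>\<in>U \<rightarrow>\<^sub>E {..<T}. \<Prod>e\<in>pairs U. G' e (\<psi> ` e)) = (\<Sum>\<psi>\<in>U \<rightarrow>\<^sub>E {..<T}. ?K (\<lambda>i\<in>U. cl (\<psi> i)))"
    proof (intro sum.cong prod.cong refl)
      fix \<psi> :: "nat \<Rightarrow> nat" and e assume "e \<in> pairs U"
      then have "(\<lambda>i\<in>U. cl (\<psi> i)) ` e = cl ` \<psi> ` e"
        unfolding image_image by (intro image_cong) (auto simp: pairs_def)
      then show "G' e (\<psi> ` e) = (\<Sum>l\<in>L. l ^ count E e * law ((\<lambda>i\<in>U. cl (\<psi> i)) ` e, l))"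
        by (simp add: G'_def)
    qed
    also have "\<dots> = (\<Sum>\<phi>\<in>U \<rightarrow>\<^sub>E {..<k}. (\<Prod>i\<in>U. real (card (block (\<phi> i)))) * ?K \<phi>)"
      by (rule block_sum[OF U])
    finally show ?thesis
      unfolding shom_def weight_def prod_dividef by (simp add: sum_divide_distrib)
  qed
  then have "dens U (Poly_Mapping.single E 1) T w - shom L k weight law U E =
     - (((\<Sum>\<psi>\<in>U \<rightarrow>\<^sub>E {..<T}. \<Prod>e\<in>pairs U. G' e (\<psi> ` e)) - (\<Sum>\<psi>\<in>U \<rightarrow>\<^sub>E {..<T}. \<Prod>e\<in>pairs U. G e (\<psi> ` e))) / real T ^ card U)"
    unfolding dd by (simp add: diff_divide_distrib)
  then show ?thesis
    using main Tp unfolding M_def[symmetric] by (simp add: abs_divide divide_le_eq)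
qed

end

text \<open>Splitting off the zero of \<open>r\<close> at \<open>0\<close> leaves a factor bounded
  away from zero nearby. Hence \<open>r\<close> has no root in \<open>(0, 4 * \<epsilon>]\<close>,
  the range in which distances inside one class lie.\<close>

lemma poly_lower_bound:
  fixes r :: "real poly"
  assumes "r \<noteq> 0"
  shows "\<exists>\<epsilon>>0. \<exists>\<rho>>0. \<exists>a. \<forall>t. 0 \<le> t \<and> t \<le> 4 * \<epsilon> \<longrightarrow> \<rho> * t ^ a \<le> \<bar>poly r t\<bar>"
proof -
  obtain q where q: "r = [:- 0, 1:] ^ order 0 r * q" "\<not> [:- 0, 1:] dvd q"
    using order_decomp[OF assms, of 0] by blast
  then have q0: "poly q 0 \<noteq> 0" by (simp add: poly_eq_0_iff_dvd)
  have "isCont (poly q) 0" by simp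
  then have "\<forall>e>0. \<exists>d>0. \<forall>t. dist t 0 < d \<longrightarrow> dist (poly q t) (poly q 0) < e"
    unfolding continuous_at_eps_delta .
  moreover have "\<bar>poly q 0\<bar> / 2 > 0" using q0 by simp
  ultimately have "\<exists>d>0. \<forall>t. dist t 0 < d \<longrightarrow> dist (poly q t) (poly q 0) < \<bar>poly q 0\<bar> / 2"
    by blast
  then obtain d where d: "d > 0" "\<And>t. dist t 0 < d \<Longrightarrow> dist (poly q t) (poly q 0) < \<bar>poly q 0\<bar> / 2"
    by blast
  \<comment> \<open>With \<epsilon> equal to \<open>d / 8\<close> the range ends at
    \<open>d / 2\<close>, strictly inside the continuity neighbourhood.\<close>
  have "\<bar>poly q 0\<bar> / 2 * t ^ order 0 r \<le> \<bar>poly r t\<bar>" if t: "0 \<le> t" "t \<le> 4 * (d / 8)" for t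
  proof -
    have "dist t 0 < d" using t d(1) by (simp add: dist_real_def)
    then have "\<bar>poly q t - poly q 0\<bar> < \<bar>poly q 0\<bar> / 2" using d(2) by (simp add: dist_real_def)
    then have "\<bar>poly q 0\<bar> / 2 \<le> \<bar>poly q t\<bar>" by linarith
    then have "\<bar>poly q 0\<bar> / 2 * t ^ order 0 r \<le> \<bar>poly q t\<bar> * t ^ order 0 r"
      using t(1) by (intro mult_right_mono) auto
    moreover have "poly r t = t ^ order 0 r * poly q t"
      by (subst q(1)) (simp add: poly_power)
    ultimately show ?thesis using t(1) by (simp add: abs_mult mult.commute)
  qed
  then show ?thesis
    using d(1) q0
    by (intro exI[of _ "d / 8"] conjI exI[of _ "\<bar>poly q 0\<bar> / 2"] exI[of _ "order 0 r"]) auto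
qed

text \<open>Inside a class a distance of at least \<open>e1\<close> keeps \<open>poly r\<close> away
  from zero, so Markov's inequality bounds the number of such pairs.\<close>

lemma spread_small:
  assumes "coloured_partition T w L cl k" and r: "\<And>t. 0 \<le> t \<Longrightarrow> t \<le> 4 * \<epsilon> \<Longrightarrow> \<rho> * t ^ a \<le> \<bar>poly r t\<bar>"
    and \<rho>: "\<rho> > 0" and \<sigma>: "\<sigma> > 0"
    and near: "\<And>x y. x < T \<Longrightarrow> y < T \<Longrightarrow> cl x = cl y \<Longrightarrow> sep T w x y < 4 * \<epsilon>"
    and A: "(\<Sum>x<T. \<Sum>y<T. (poly r (sep T w x y))\<^sup>2) / real T ^ 2 <
      (\<rho> * ((\<sigma> / 3)\<^sup>2) ^ a)\<^sup>2 * (\<sigma> / (3 * (real k + 1)) * (\<sigma> / 3))"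
  shows "coloured_partition.spread T w cl \<le> \<sigma>"
proof -
  interpret coloured_partition T w L cl k by fact
  \<comment> \<open>\<open>e1\<close> and \<theta> give each of the three terms of
    \<open>spread_bound\<close> at most \<open>\<sigma> / 3\<close>; \<open>k + 1\<close> avoids a
    zero denominator.\<close>
  define e1 where "e1 = (\<sigma> / 3)\<^sup>2"
  define \<theta> where "\<theta> = \<sigma> / (3 * (real k + 1))"
  have pos: "e1 > 0" "\<theta> > 0" using \<sigma> by (simp_all add: e1_def \<theta>_def)
  define bad where "bad = {(x, u). x < T \<and> u < T \<and> cl u = cl x \<and> sep T w x u \<ge> e1}"
  have sub: "bad \<subseteq> {..<T} \<times> {..<T}" unfolding bad_def by blast
  define c where "c = (\<rho> * e1 ^ a)\<^sup>2"
  have c: "c > 0" using \<rho> pos by (simp add: c_def)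
  let ?f = "\<lambda>q. (poly r (sep T w (fst q) (snd q)))\<^sup>2"
  have "real (card bad) * c = (\<Sum>q\<in>bad. c)" by simp
  also have "\<dots> \<le> (\<Sum>q\<in>bad. ?f q)"
  proof (rule sum_mono)
    fix q assume "q \<in> bad"
    then obtain x u where q: "q = (x, u)" "x < T" "u < T" "cl u = cl x" "e1 \<le> sep T w x u"
      unfolding bad_def by blast
    have "sep T w x u < 4 * \<epsilon>" using near[of x u] q by simp
    then have "\<rho> * sep T w x u ^ a \<le> \<bar>poly r (sep T w x u)\<bar>" using r sep_nonneg by simp
    moreover have "\<rho> * e1 ^ a \<le> \<rho> * sep T w x u ^ a"
      using q(5) pos \<rho> by (intro mult_left_mono power_mono) auto
    ultimately have "\<rho> * e1 ^ a \<le> \<bar>poly r (sep T w x u)\<bar>" by linarith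
    then have "c \<le> \<bar>poly r (sep T w x u)\<bar>\<^sup>2"
      unfolding c_def using \<rho> pos by (intro power_mono) auto
    then show "c \<le> ?f q" by (simp add: q(1))
  qed
  also have "\<dots> \<le> (\<Sum>q\<in>{..<T} \<times> {..<T}. ?f q)" using sub by (intro sum_mono2) auto
  also have "\<dots> = (\<Sum>x<T. \<Sum>y<T. (poly r (sep T w x y))\<^sup>2)"
    by (simp only: sum.cartesian_product split_def)
  finally have "real (card bad) * c \<le> (\<Sum>x<T. \<Sum>y<T. (poly r (sep T w x y))\<^sup>2)" .
  moreover have T2: "real T ^ 2 > 0" using T by simp
  moreover have "(\<Sum>x<T. \<Sum>y<T. (poly r (sep T w x y))\<^sup>2) < c * (\<theta> * (\<sigma> / 3)) * real T ^ 2"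
    using A T2 unfolding c_def e1_def \<theta>_def by (simp only: pos_divide_less_eq)
  ultimately have "c * real (card bad) < c * (\<theta> * (\<sigma> / 3) * real T ^ 2)"
    by (simp only: mult_ac)
  then have "real (card bad) < \<theta> * (\<sigma> / 3) * real T ^ 2" using c by simp
  then have b: "real (card bad) / (\<theta> * real T ^ 2) < \<sigma> / 3"
    using pos T2 by (simp add: pos_divide_less_eq mult_ac)
  have "real k * \<theta> \<le> (real k + 1) * \<theta>" using pos by (intro mult_right_mono) auto
  also have "\<dots> = \<sigma> / 3"
    unfolding \<theta>_def divide_divide_eq_left[symmetric]
    by (rule trans[OF times_divide_eq_right nonzero_mult_div_cancel_left]) (simp add: add_nonneg_eq_0_iff)
  finally have k: "real k * \<theta> \<le> \<sigma> / 3" .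
  have "spread \<le> sqrt e1 + real (card bad) / (\<theta> * real T ^ 2) + k * \<theta>"
    unfolding bad_def using pos by (intro spread_bound) auto
  moreover have "sqrt e1 = \<sigma> / 3" using \<sigma> by (simp add: e1_def)
  ultimately show ?thesis using b k by linarith
qed

text \<open>The order of quantifiers is the point: \<open>k\<close> comes from a covering number
  depending only on \<open>L\<close> and \<open>r\<close>, before the tests and the accuracy are
  given.\<close>

theorem sbm_approximation:
  fixes L :: "real set" and r :: "real poly"
  assumes L: "finite L" and r: "r \<noteq> 0"
  shows "\<exists>k. \<forall>FF. finite FF \<longrightarrow> (\<forall>(U, E)\<in>FF. finite U \<and> (\<forall>e\<in>#E. e \<subseteq> U \<and> card e = 2)) \<longrightarrow>
    (\<forall>\<eta>>0. \<exists>\<eta>'>0. \<forall>T w. coloured T w L \<longrightarrow>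
      (\<Sum>x<T. \<Sum>y<T. (poly r (sep T w x y))\<^sup>2) / real T ^ 2 < \<eta>' \<longrightarrow>
      (\<exists>\<alpha> \<beta>. sbm L k \<alpha> \<beta> \<and>
        (\<forall>(U, E)\<in>FF. \<bar>dens U (Poly_Mapping.single E 1) T w - shom L k \<alpha> \<beta> U E\<bar> < \<eta>)))"
proof -
  obtain \<epsilon> \<rho> a where er: "\<epsilon> > 0" "\<rho> > 0" "\<forall>t. 0 \<le> t \<and> t \<le> 4 * \<epsilon> \<longrightarrow> \<rho> * t ^ a \<le> \<bar>poly r t\<bar>"
    using poly_lower_bound[OF r] by blast
  obtain n :: nat where n: "8 / \<epsilon> < real n" using reals_Archimedean2 by blast
  define k where "k = 2 * card L ^ n"
  define b where "b = 1 + (\<Sum>l\<in>L. \<bar>l\<bar>)"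
  have b: "b \<ge> 1" "\<And>l. l \<in> L \<Longrightarrow> \<bar>l\<bar> \<le> b"
  proof -
    show "b \<ge> 1" by (simp add: b_def sum_nonneg)
    fix l assume "l \<in> L"
    then have "\<bar>l\<bar> \<le> (\<Sum>l\<in>L. \<bar>l\<bar>)" using L by (intro member_le_sum) auto
    then show "\<bar>l\<bar> \<le> b" by (simp add: b_def)
  qed
  have "\<exists>\<eta>'>0. \<forall>T w. coloured T w L \<longrightarrow>
      (\<Sum>x<T. \<Sum>y<T. (poly r (sep T w x y))\<^sup>2) / real T ^ 2 < \<eta>' \<longrightarrow>
      (\<exists>\<alpha> \<beta>. sbm L k \<alpha> \<beta> \<and>
        (\<forall>(U, E)\<in>FF. \<bar>dens U (Poly_Mapping.single E 1) T w - shom L k \<alpha> \<beta> U E\<bar> < \<eta>))"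
    if FF: "finite FF" "\<forall>(U, E)\<in>FF. finite U \<and> (\<forall>e\<in>#E. e \<subseteq> U \<and> card e = 2)" and \<eta>: "\<eta> > 0" for FF \<eta>
  proof -
    define c where "c p = real (card (pairs (fst p))) * (b ^ size (snd p)) ^ card (pairs (fst p)) * card L * 2"
      for p :: "nat set \<times> nat set multiset"
    define C where "C = (\<Sum>p\<in>FF. c p)"
    have c0: "c p \<ge> 0" for p using b by (simp add: c_def)
    have cC: "c p \<le> C" if "p \<in> FF" for p unfolding C_def using that FF(1) c0 by (intro member_le_sum) auto
    have C0: "C \<ge> 0" unfolding C_def using c0 by (intro sum_nonneg)
    \<comment> \<open>Makes \<open>sqrt (2 * \<sigma>)\<close> equal to
      \<open>\<eta> / (C + 1)\<close>; the summand \<open>1\<close> yields a strict inequality and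
      covers \<open>C = 0\<close>.\<close>
    define \<sigma> where "\<sigma> = (\<eta> / (C + 1))\<^sup>2 / 2"
    have \<sigma>: "\<sigma> > 0" using \<eta> C0 by (simp add: \<sigma>_def)
    have s\<sigma>: "sqrt (2 * \<sigma>) = \<eta> / (C + 1)" using \<eta> C0 by (simp add: \<sigma>_def)
    define \<eta>' where "\<eta>' = (\<rho> * ((\<sigma> / 3)\<^sup>2) ^ a)\<^sup>2 * (\<sigma> / (3 * (real k + 1)) * (\<sigma> / 3))"
    have "\<exists>\<alpha> \<beta>. sbm L k \<alpha> \<beta> \<and>
        (\<forall>(U, E)\<in>FF. \<bar>dens U (Poly_Mapping.single E 1) T w - shom L k \<alpha> \<beta> U E\<bar> < \<eta>)"
      if cT: "coloured T w L"
        and A: "(\<Sum>x<T. \<Sum>y<T. (poly r (sep T w x y))\<^sup>2) / real T ^ 2 < \<eta>'" for T w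
    proof -
      obtain cl where clp: "\<forall>x<T. cl x < k" "\<forall>x<T. \<forall>y<T. cl x = cl y \<longrightarrow> sep T w x y < 4 * \<epsilon>"
        using coloured.ex_partition[OF cT er(1) less_imp_le[OF n]] unfolding k_def by blast
      have cp: "coloured_partition T w L cl k"
        using cT clp(1) by (simp add: coloured_partition_def coloured_partition_axioms_def)
      interpret coloured_partition T w L cl k by (rule cp)
      have "spread \<le> \<sigma>"
        by (rule spread_small[OF cp _ er(2) \<sigma> _ A[unfolded \<eta>'_def]]) (use er(3) clp(2) in auto)
      then have sp: "sqrt (2 * spread) \<le> \<eta> / (C + 1)" unfolding s\<sigma>[symmetric] by simp
      have "\<bar>dens U (Poly_Mapping.single E 1) T w - shom L k weight law U E\<bar> < \<eta>" if UE: "(U, E) \<in> FF" for U E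
      proof -
        have fU: "finite U" and E: "\<And>e. e \<in># E \<Longrightarrow> e \<subseteq> U \<and> card e = 2"
          using bspec[OF FF(2) UE] by simp_all
        have "\<bar>dens U (Poly_Mapping.single E 1) T w - shom L k weight law U E\<bar> \<le> c (U, E) * sqrt (2 * spread)"
          using block_approx[OF fU E b] by (simp add: c_def)
        also have "\<dots> \<le> c (U, E) * (\<eta> / (C + 1))" using sp c0 by (rule mult_left_mono)
        also have "\<dots> \<le> C * (\<eta> / (C + 1))"
          using cC[OF UE] \<eta> C0 by (intro mult_right_mono) auto
        also have "\<dots> < \<eta>" using \<eta> C0 by (simp add: field_simps)
        finally show ?thesis .
      qed
      then show ?thesis using sbm_block by blast
    qed
    moreover have "\<eta>' > 0" using er(2) \<sigma> by (simp add: \<eta>'_def)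
    ultimately show ?thesis by blast
  qed
  then show ?thesis by blast
qed

text \<open>Compactness of the space of block models turns approximations into an exact representation.\<close>

lemma continuous_on_coordinate:
  "continuous_on S (\<lambda>x. (fst x :: 'a \<Rightarrow> real) i)" "continuous_on S (\<lambda>x. (snd x :: 'b \<Rightarrow> real) j)"
proof -
  have c: "continuous_on UNIV (\<lambda>f :: 'c \<Rightarrow> real. f i)" for i :: 'c
    by (rule continuous_on_product_coordinates)
  show "continuous_on S (\<lambda>x. (fst x :: 'a \<Rightarrow> real) i)"
    by (rule continuous_on_compose2[OF c]) (auto intro: continuous_intros)
  show "continuous_on S (\<lambda>x. (snd x :: 'b \<Rightarrow> real) j)"
    by (rule continuous_on_compose2[OF c]) (auto intro: continuous_intros)
qed

lemma compact_cube: "compact (UNIV \<rightarrow>\<^sub>E {0..1} :: ('a \<Rightarrow> real) set)"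
proof -
  have "compactin (product_topology (\<lambda>_. euclidean) UNIV) (UNIV \<rightarrow>\<^sub>E {0..1} :: ('a \<Rightarrow> real) set)"
    by (subst compactin_PiE) simp
  then show ?thesis by (simp only: euclidean_product_topology compactin_euclidean_iff)
qed

theorem sbm_limit:
  fixes v :: "nat set multiset \<Rightarrow> real"
  assumes L: "finite L"
    and approx: "\<And>FF \<eta>. finite FF \<Longrightarrow> (\<And>U E. (U, E) \<in> FF \<Longrightarrow> finite U \<and> (\<forall>e\<in>#E. e \<subseteq> U \<and> card e = 2)) \<Longrightarrow>
      \<eta> > 0 \<Longrightarrow> \<exists>\<alpha> \<beta>. sbm L k \<alpha> \<beta> \<and> (\<forall>(U, E)\<in>FF. \<bar>v E - shom L k \<alpha> \<beta> U E\<bar> \<le> \<eta>)"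
  shows "\<exists>\<alpha> \<beta>. sbm L k \<alpha> \<beta> \<and> (\<forall>U E. finite U \<longrightarrow> (\<forall>e\<in>#E. e \<subseteq> U \<and> card e = 2) \<longrightarrow> v E = shom L k \<alpha> \<beta> U E)"
proof -
  define Q :: "((nat \<Rightarrow> real) \<times> (nat set \<times> real \<Rightarrow> real)) set"
    where "Q = (UNIV \<rightarrow>\<^sub>E {0..1}) \<times> (UNIV \<rightarrow>\<^sub>E {0..1})"
  have cQ: "compact Q" unfolding Q_def by (intro compact_Times compact_cube)
  define good :: "(nat set \<times> nat set multiset) set"
    where "good = {(U, E). finite U \<and> (\<forall>e\<in>#E. e \<subseteq> U \<and> card e = (2::nat))}"
  define M where "M = {x :: (nat \<Rightarrow> real) \<times> (nat set \<times> real \<Rightarrow> real). sbm L k (fst x) (snd x)}"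
  define Z where "Z q = {x. \<bar>v (snd (fst q)) - shom L k (fst x) (snd x) (fst (fst q)) (snd (fst q))\<bar> \<le> 1 / real (Suc (snd q))}"
    for q :: "(nat set \<times> nat set multiset) \<times> nat"
  note cont = continuous_on_coordinate continuous_intros
  have closed_Z: "closed (Z q)" for q
    unfolding Z_def shom_def
    by (intro closed_Collect_le cont)
  have closed_M: "closed M"
  proof -
    have "M = (\<Inter>i\<in>{..<k}. {x. 0 \<le> fst x i}) \<inter> {x. (\<Sum>i<k. fst x i) = 1} \<inter>
        (\<Inter>s. \<Inter>l\<in>L. {x. 0 \<le> snd x (s, l)}) \<inter> (\<Inter>s. {x. (\<Sum>l\<in>L. snd x (s, l)) = 1})"
      unfolding M_def sbm_def by auto
    also have "closed \<dots>"
      by (intro closed_Int closed_INT ballI closed_Collect_le closed_Collect_eq cont)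
    finally show ?thesis .
  qed
  \<comment> \<open>The coordinates form an uncountable family, so the finite intersection property
    is used in place of convergent subsequences.\<close>
  have "Q \<inter> \<Inter>(insert M (Z ` (good \<times> UNIV))) \<noteq> {}"
  proof (rule compact_imp_fip[OF cQ])
    show "closed T" if "T \<in> insert M (Z ` (good \<times> UNIV))" for T
      using that closed_M closed_Z by auto
    fix F' assume F': "finite F'" "F' \<subseteq> insert M (Z ` (good \<times> UNIV))"
    then have "F' - {M} \<subseteq> Z ` (good \<times> UNIV)" "finite (F' - {M})" by auto
    then obtain J where J: "J \<subseteq> good \<times> UNIV" "finite J" "F' - {M} = Z ` J"
      using finite_subset_image[of "F' - {M}" Z "good \<times> UNIV"] by blast
    define N where "N = Max (insert 0 (snd ` J))"
    have N: "snd q \<le> N" if "q \<in> J" for q unfolding N_def using J(2) that by (intro Max_ge) auto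
    have gd: "finite U \<and> (\<forall>e\<in>#E. e \<subseteq> U \<and> card e = 2)" if "(U, E) \<in> fst ` J" for U E
    proof -
      have "(U, E) \<in> good" using that J(1) by auto
      then show ?thesis by (simp add: good_def)
    qed
    have "\<exists>\<alpha> \<beta>. sbm L k \<alpha> \<beta> \<and> (\<forall>(U, E)\<in>fst ` J. \<bar>v E - shom L k \<alpha> \<beta> U E\<bar> \<le> 1 / real (Suc N))"
      using J(2) gd by (intro approx) auto
    then obtain \<alpha> \<beta> where ab: "sbm L k \<alpha> \<beta>" "\<forall>(U, E)\<in>fst ` J. \<bar>v E - shom L k \<alpha> \<beta> U E\<bar> \<le> 1 / real (Suc N)"
      by blast
    \<comment> \<open>\<open>sbm\<close> does not constrain coordinates beyond \<open>k\<close> or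
      colours outside \<open>L\<close>; zero there places the model in the cube without changing
      \<open>shom\<close>.\<close>
    define \<alpha>' where "\<alpha>' i = (if i < k then \<alpha> i else 0)" for i
    define \<beta>' where "\<beta>' p = (if snd p \<in> L then \<beta> p else 0)" for p
    have sb: "sbm L k \<alpha>' \<beta>'" using ab(1) by (simp add: sbm_def \<alpha>'_def \<beta>'_def)
    have sh: "shom L k \<alpha>' \<beta>' U E = shom L k \<alpha> \<beta> U E" for U E
      unfolding shom_def
    proof (intro sum.cong refl arg_cong2[of _ _ _ _ "(*)"] prod.cong)
      fix \<phi> :: "nat \<Rightarrow> nat" and i assume "\<phi> \<in> U \<rightarrow>\<^sub>E {..<k}" "i \<in> U"
      then have "\<phi> i < k" using PiE_mem[of \<phi> U "\<lambda>_. {..<k}" i] by simp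
      then show "\<alpha>' (\<phi> i) = \<alpha> (\<phi> i)" by (simp add: \<alpha>'_def)
    qed (simp add: \<beta>'_def)
    have "\<alpha>' i \<in> {0..1}" for i
    proof (cases "i < k")
      case True
      then have "\<alpha> i \<le> (\<Sum>i<k. \<alpha> i)" using ab(1) by (intro member_le_sum) (auto simp: sbm_def)
      then show ?thesis using ab(1) True by (simp add: sbm_def \<alpha>'_def)
    qed (simp add: \<alpha>'_def)
    moreover have "\<beta>' p \<in> {0..1}" for p
    proof (cases "snd p \<in> L")
      case True
      obtain s l where p: "p = (s, l)" by (cases p)
      then have "\<beta> (s, l) \<le> (\<Sum>l\<in>L. \<beta> (s, l))"
        using ab(1) True L by (intro member_le_sum) (auto simp: sbm_def)
      then show ?thesis using ab(1) True p by (simp add: sbm_def \<beta>'_def)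
    qed (simp add: \<beta>'_def)
    ultimately have "(\<alpha>', \<beta>') \<in> Q" by (simp add: Q_def PiE_iff)
    moreover have "(\<alpha>', \<beta>') \<in> M" using sb by (simp add: M_def)
    moreover have "(\<alpha>', \<beta>') \<in> Z q" if q: "q \<in> J" for q
    proof -
      obtain U E n where qe: "q = ((U, E), n)" by (metis surj_pair)
      have "(U, E) \<in> fst ` J" using q qe by force
      then have "\<bar>v E - shom L k \<alpha> \<beta> U E\<bar> \<le> 1 / real (Suc N)" using ab(2) by auto
      also have "\<dots> \<le> 1 / real (Suc n)" using N[OF q] qe by (simp add: frac_le)
      finally show ?thesis by (simp add: Z_def sh qe)
    qed
    ultimately have "(\<alpha>', \<beta>') \<in> Q \<inter> \<Inter>F'" using J(3) by blast
    then show "Q \<inter> \<Inter>F' \<noteq> {}" by blast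
  qed
  then obtain x where x: "x \<in> M" "\<And>q. q \<in> good \<times> UNIV \<Longrightarrow> x \<in> Z q" by blast
  have "v E = shom L k (fst x) (snd x) U E" if "finite U" "\<forall>e\<in>#E. e \<subseteq> U \<and> card e = 2" for U E
  proof (rule ccontr)
    assume "v E \<noteq> shom L k (fst x) (snd x) U E"
    then have "\<bar>v E - shom L k (fst x) (snd x) U E\<bar> > 0" by simp
    then obtain n where n: "inverse (real (Suc n)) < \<bar>v E - shom L k (fst x) (snd x) U E\<bar>"
      using reals_Archimedean by blast
    have "((U, E), n) \<in> good \<times> UNIV" using that by (simp add: good_def)
    then have "x \<in> Z ((U, E), n)" by (rule x(2))
    then show False using n by (simp add: Z_def inverse_eq_divide)
  qed
  then show ?thesis using x(1) by (auto simp: M_def)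
qed

context edge_functional
begin

theorem block_model:
  "\<exists>k \<alpha> \<beta>. sbm colours k \<alpha> \<beta> \<and>
    (\<forall>U E. finite U \<longrightarrow> (\<forall>e\<in>#E. e \<subseteq> U \<and> card e = 2) \<longrightarrow> v E = shom colours k \<alpha> \<beta> U E)"
proof -
  obtain r where r0: "r \<noteq> 0" and r: "\<forall>FF. finite FF \<longrightarrow> (\<forall>(U, E)\<in>FF. finite U \<and> (\<forall>e\<in>#E. e \<subseteq> U \<and> card e = 2)) \<longrightarrow>
     (\<forall>\<eta>>0. \<exists>T\<ge>1. \<exists>w. valid T w \<and>
        (\<forall>(U, E)\<in>FF. (dens U (Poly_Mapping.single E 1) T w - v E)\<^sup>2 < \<eta>) \<and>
        (\<Sum>x<T. \<Sum>y<T. (poly r (sep T w x y))\<^sup>2) / real T ^ 2 < \<eta>)"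
    using sampling by (elim exE conjE)
  obtain k where k: "\<forall>FF. finite FF \<longrightarrow> (\<forall>(U, E)\<in>FF. finite U \<and> (\<forall>e\<in>#E. e \<subseteq> U \<and> card e = 2)) \<longrightarrow>
    (\<forall>\<eta>>0. \<exists>\<eta>'>0. \<forall>T w. coloured T w colours \<longrightarrow>
      (\<Sum>x<T. \<Sum>y<T. (poly r (sep T w x y))\<^sup>2) / real T ^ 2 < \<eta>' \<longrightarrow>
      (\<exists>\<alpha> \<beta>. sbm colours k \<alpha> \<beta> \<and>
        (\<forall>(U, E)\<in>FF. \<bar>dens U (Poly_Mapping.single E 1) T w - shom colours k \<alpha> \<beta> U E\<bar> < \<eta>)))"
    using sbm_approximation[OF finite_colours r0] by (elim exE)
  have approx: "\<exists>\<alpha> \<beta>. sbm colours k \<alpha> \<beta> \<and> (\<forall>(U, E)\<in>FF. \<bar>v E - shom colours k \<alpha> \<beta> U E\<bar> \<le> \<eta>)"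
    if FF: "finite FF" "\<And>U E. (U, E) \<in> FF \<Longrightarrow> finite U \<and> (\<forall>e\<in>#E. e \<subseteq> U \<and> card e = 2)" and \<eta>: "\<eta> > 0"
    for FF :: "(nat set \<times> nat set multiset) set" and \<eta> :: real
  proof -
    have FF': "\<forall>(U, E)\<in>FF. finite U \<and> (\<forall>e\<in>#E. e \<subseteq> U \<and> card e = 2)" using FF(2) by blast
    have "\<eta> / 2 > 0" using \<eta> by simp
    from k[THEN spec[of _ FF], THEN mp, OF FF(1), THEN mp, OF FF', THEN spec, THEN mp, OF this] obtain \<eta>' where \<eta>': "\<eta>' > 0"
      and ap: "\<And>T w. coloured T w colours \<Longrightarrow>
        (\<Sum>x<T. \<Sum>y<T. (poly r (sep T w x y))\<^sup>2) / real T ^ 2 < \<eta>' \<Longrightarrow>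
        \<exists>\<alpha> \<beta>. sbm colours k \<alpha> \<beta> \<and>
          (\<forall>(U, E)\<in>FF. \<bar>dens U (Poly_Mapping.single E 1) T w - shom colours k \<alpha> \<beta> U E\<bar> < \<eta> / 2)"
      by blast
    \<comment> \<open>One sample must meet both the threshold for the twin polynomial and the
      accuracy \<open>\<eta> / 2\<close> of the densities, which enter squared.\<close>
    have "min \<eta>' ((\<eta> / 2)\<^sup>2) > 0" using \<eta> \<eta>' by simp
    from r[THEN spec[of _ FF], THEN mp, OF FF(1), THEN mp, OF FF', THEN spec, THEN mp, OF this] obtain T w where T: "T \<ge> 1" "valid T w"
      and dv: "\<forall>(U, E)\<in>FF. (dens U (Poly_Mapping.single E 1) T w - v E)\<^sup>2 < min \<eta>' ((\<eta> / 2)\<^sup>2)"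
      and A: "(\<Sum>x<T. \<Sum>y<T. (poly r (sep T w x y))\<^sup>2) / real T ^ 2 < min \<eta>' ((\<eta> / 2)\<^sup>2)"
      by blast
    have "coloured T w colours" using T by (simp add: coloured_def valid_def)
    moreover have "(\<Sum>x<T. \<Sum>y<T. (poly r (sep T w x y))\<^sup>2) / real T ^ 2 < \<eta>'"
      using A by (rule less_le_trans) simp
    ultimately obtain \<alpha> \<beta> where ab: "sbm colours k \<alpha> \<beta>"
      "\<forall>(U, E)\<in>FF. \<bar>dens U (Poly_Mapping.single E 1) T w - shom colours k \<alpha> \<beta> U E\<bar> < \<eta> / 2"
      using ap by blast
    have "\<bar>v E - shom colours k \<alpha> \<beta> U E\<bar> \<le> \<eta>" if UE: "(U, E) \<in> FF" for U E
    proof -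
      have "(dens U (Poly_Mapping.single E 1) T w - v E)\<^sup>2 < (\<eta> / 2)\<^sup>2"
        using bspec[OF dv UE] by simp
      then have "\<bar>dens U (Poly_Mapping.single E 1) T w - v E\<bar>\<^sup>2 < (\<eta> / 2)\<^sup>2"
        by (simp only: power2_abs)
      then have "\<bar>dens U (Poly_Mapping.single E 1) T w - v E\<bar> < \<eta> / 2"
        by (rule power2_less_imp_less) (use \<eta> in simp)
      moreover have "\<bar>dens U (Poly_Mapping.single E 1) T w - shom colours k \<alpha> \<beta> U E\<bar> < \<eta> / 2"
        using bspec[OF ab(2) UE] by simp
      ultimately show ?thesis by linarith
    qed
    then show ?thesis using ab(1) by blast
  qed
  show ?thesis
    by (rule exI[of _ k], rule sbm_limit[OF finite_colours], rule approx)
qed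

end

lemma (in nonzero_parameter) edge_functionalI:
  assumes "weakly_reflection_positive f" "connection_rank f 2 < \<infinity>"
  shows "edge_functional v"
proof
  show "v {#} = 1" by simp
  show "v (image_mset (image h) E) = v E" if "inj_on h (verts E)" for h E
    using that by (rule edge_value_rename)
  show "v (E + E') = v E * v E'" if "verts E \<inter> verts E' = {}" for E E'
    using that by (rule edge_value_disjoint)
  show "lin v (a * a) \<ge> 0" for a
    by (rule edge_value_psd[OF assms(1)])
  show "\<exists>(m::nat) a b. \<forall>E E'. verts E \<inter> verts E' \<subseteq> {1, 2} \<longrightarrow> v (E + E') = (\<Sum>i<m. a i E * b i E')"
    by (rule edge_value_rank[OF assms(2)])
qed

section \<open>Randomly weighted graphs realising block models\<close>

lemma ex_pmf_finite:
  fixes q :: "real \<Rightarrow> real"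
  assumes "finite L" "\<And>l. l \<in> L \<Longrightarrow> q l \<ge> 0" "(\<Sum>l\<in>L. q l) = 1"
  shows "\<exists>p. \<forall>l. pmf p l = (if l \<in> L then q l else 0)"
proof -
  let ?f = "\<lambda>l. if l \<in> L then q l else 0"
  have "(\<integral>\<^sup>+ l. ennreal (?f l) \<partial>count_space UNIV) = (\<Sum>l\<in>L. ennreal (?f l))"
    using assms(1) by (intro nn_integral_count_space') auto
  also have "\<dots> = (\<Sum>l\<in>L. ennreal (q l))" by (intro sum.cong) auto
  also have "\<dots> = ennreal (\<Sum>l\<in>L. q l)" using assms(2) by (rule sum_ennreal)
  finally have "(\<integral>\<^sup>+ l. ennreal (?f l) \<partial>count_space UNIV) = 1" using assms(3) by simp
  then have "pmf (embed_pmf ?f) l = ?f l" for l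
    using assms(2) by (intro pmf_embed_pmf) auto
  then show ?thesis by blast
qed

text \<open>Independence is a property of the joint law, and the joint law of the composed variables
  under \<open>P\<close> is that of \<open>Y\<close> under the image of \<open>P\<close>.\<close>

lemma indep_vars_map_pmf:
  assumes "prob_space.indep_vars (measure_pmf (map_pmf R P)) N Y I"
  shows "prob_space.indep_vars (measure_pmf P) N (\<lambda>i x. Y i (R x)) I"
proof (cases "I = {}")
  case True
  show ?thesis unfolding True
    by (subst prob_space.indep_vars_def [OF measure_pmf.prob_space_axioms],
        subst prob_space.indep_sets_def [OF measure_pmf.prob_space_axioms]) simp_all
next
  case False
  have rv: "Y i \<in> measurable (measure_pmf (map_pmf R P)) (N i)" if "i \<in> I" for i
    using assms that unfolding prob_space.indep_vars_def[OF measure_pmf.prob_space_axioms] by blast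
  then have rv': "(\<lambda>x. Y i (R x)) \<in> measurable (measure_pmf P) (N i)" if "i \<in> I" for i
    using rv[OF that] by (auto simp: measurable_def Pi_iff)
  have m: "(\<lambda>x. \<lambda>i\<in>I. Y i x) \<in> measurable (count_space UNIV) (\<Pi>\<^sub>M i\<in>I. N i)"
    using rv by (auto simp: measurable_def space_PiM Pi_iff)
  have d: "measure_pmf (map_pmf R P) = distr (measure_pmf P) (count_space UNIV) R"
    by (rule map_pmf_rep_eq)
  have "distr (measure_pmf P) (\<Pi>\<^sub>M i\<in>I. N i) (\<lambda>x. \<lambda>i\<in>I. Y i (R x)) =
      distr (measure_pmf (map_pmf R P)) (\<Pi>\<^sub>M i\<in>I. N i) (\<lambda>x. \<lambda>i\<in>I. Y i x)"
    unfolding d using m by (subst distr_distr) (simp_all add: comp_def)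
  also have "\<dots> = (\<Pi>\<^sub>M i\<in>I. distr (measure_pmf (map_pmf R P)) (N i) (Y i))"
  proof -
    have "prob_space.indep_vars (measure_pmf (map_pmf R P)) N Y I \<longleftrightarrow>
        distr (measure_pmf (map_pmf R P)) (\<Pi>\<^sub>M i\<in>I. N i) (\<lambda>x. \<lambda>i\<in>I. Y i x) =
        (\<Pi>\<^sub>M i\<in>I. distr (measure_pmf (map_pmf R P)) (N i) (Y i))"
      by (rule prob_space.indep_vars_iff_distr_eq_PiM'[OF measure_pmf.prob_space_axioms False rv])
    then show ?thesis using assms by (rule iffD1)
  qed
  also have "\<dots> = (\<Pi>\<^sub>M i\<in>I. distr (measure_pmf P) (N i) (\<lambda>x. Y i (R x)))"
  proof (intro PiM_cong refl)
    fix i assume "i \<in> I"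
    then have "Y i \<in> measurable (count_space UNIV) (N i)" using rv by (simp add: measurable_def)
    then show "distr (measure_pmf (map_pmf R P)) (N i) (Y i) = distr (measure_pmf P) (N i) (\<lambda>x. Y i (R x))"
      unfolding d by (subst distr_distr) (simp_all add: comp_def)
  qed
  finally have eq: "distr (measure_pmf P) (\<Pi>\<^sub>M i\<in>I. N i) (\<lambda>x. \<lambda>i\<in>I. Y i (R x)) =
      (\<Pi>\<^sub>M i\<in>I. distr (measure_pmf P) (N i) (\<lambda>x. Y i (R x)))" .
  have "prob_space.indep_vars (measure_pmf P) N (\<lambda>i x. Y i (R x)) I \<longleftrightarrow>
      distr (measure_pmf P) (\<Pi>\<^sub>M i\<in>I. N i) (\<lambda>x. \<lambda>i\<in>I. Y i (R x)) =
      (\<Pi>\<^sub>M i\<in>I. distr (measure_pmf P) (N i) (\<lambda>x. Y i (R x)))"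
    by (rule prob_space.indep_vars_iff_distr_eq_PiM'[OF measure_pmf.prob_space_axioms False rv'])
  then show ?thesis using eq by (rule iffD2)
qed

text \<open>The edge laws are made independent by a product distribution on functions. It has finite
  support, so it can be encoded in any infinite type of sample points. Multiplying node weights by
  \<open>c\<close> gives one factor \<open>c\<close> per node.\<close>

lemma ex_rwgraph:
  fixes c :: real
  assumes L: "finite L" and s: "sbm L k \<alpha> \<beta>" and c: "c \<ge> 0"
  shows "\<exists>H :: ('v::infinite, 'w::infinite) rwgraph. randomly_weighted_graph H \<and>
    (\<forall>F. multigraph F \<longrightarrow> hom_rw F H = c ^ card (nodes F) * shom L k \<alpha> \<beta> (nodes F) (edges F))"
proof -
  obtain g :: "nat \<Rightarrow> 'v" where g: "inj g"
    using infinite_countable_subset[OF infinite_UNIV] by blast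
  have ig: "inv g (g i) = i" for i using g by (rule inv_f_f)
  define V where "V = g ` {..<k}"
  define Ix where "Ix = {{i, j} | i j. i \<in> V \<and> j \<in> V}"
  have "Ix = (\<lambda>(i, j). {i, j}) ` (V \<times> V)" by (auto simp: Ix_def)
  then have finI: "finite Ix" by (simp add: V_def)
  have "\<forall>e. \<exists>p. \<forall>l. pmf p l = (if l \<in> L then \<beta> (inv g ` e, l) else 0)"
    using s L by (intro allI ex_pmf_finite) (auto simp: sbm_def)
  then obtain M where M: "\<And>e l. pmf (M e) l = (if l \<in> L then \<beta> (inv g ` e, l) else 0)"
    by metis
  define D where "D = Pi_pmf Ix (0 :: real) M"
  have "set_pmf (M e) \<subseteq> L" for e using M[of e] by (auto simp: set_pmf_eq)
  then have finM: "finite (set_pmf (M e))" for e using L finite_subset by blast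
  define S where "S = set_pmf D"
  have finS: "finite S"
    unfolding S_def D_def set_Pi_pmf[OF finI] using finI finM by (intro finite_PiE_dflt) auto
  have "\<exists>B :: 'w set. finite B \<and> card B = card S \<and> B \<subseteq> UNIV"
    using infinite_UNIV by (rule infinite_arbitrarily_large)
  then obtain B :: "'w set" where B: "finite B" "card B = card S" by blast
  then obtain J where J: "bij_betw J S B"
    using finite_same_card_bij[OF finS B(1)] by auto
  have injJ: "inj_on J S" using J by (rule bij_betw_imp_inj_on)
  \<comment> \<open>Decodes sample points. The space of a pmf is the whole type, so points outside
    the image need a value as well; a constant one keeps every edge weight finitely valued.\<close>
  define R where "R x = (if x \<in> J ` S then inv_into S J x else (\<lambda>_. 0))" for x
  have RJ: "R (J y) = y" if "y \<in> S" for y using that injJ by (simp add: R_def)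
  define P where "P = map_pmf J D"
  have RP: "map_pmf R P = D"
  proof -
    have "map_pmf R P = map_pmf (\<lambda>x. R (J x)) D" by (simp add: P_def pmf.map_comp comp_def)
    also have "\<dots> = map_pmf (\<lambda>x. x) D" using RJ by (intro map_pmf_cong) (simp_all add: S_def)
    finally show ?thesis by simp
  qed
  define H :: "('v, 'w) rwgraph" where
    "H = \<lparr>wnodes = V, node_weight = (\<lambda>x. c * \<alpha> (inv g x)), sample_space = measure_pmf P,
          edge_weight = (\<lambda>e x. R x e)\<rparr>"
  have indep: "prob_space.indep_vars (measure_pmf P) (\<lambda>_. borel) (\<lambda>e x. R x e) Ix"
  proof (rule indep_vars_map_pmf[where Y = "\<lambda>e s. s e"])
    have "prob_space.indep_vars (measure_pmf D) (\<lambda>_. count_space UNIV) (\<lambda>e s. s e) Ix"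
      unfolding D_def by (rule indep_vars_Pi_pmf[OF finI])
    then show "prob_space.indep_vars (measure_pmf (map_pmf R P)) (\<lambda>_. borel) (\<lambda>e s. s e) Ix"
      unfolding RP
      by (rule prob_space.indep_vars_compose2[OF measure_pmf.prob_space_axioms, where Y = "\<lambda>_ x. x"]) simp
  qed
  have "finite ((\<lambda>x. R x e) ` UNIV)" for e
  proof (rule finite_subset)
    show "(\<lambda>x. R x e) ` UNIV \<subseteq> insert 0 ((\<lambda>y. y e) ` S)"
    proof (rule image_subsetI)
      fix x :: 'w
      have "inv_into S J x \<in> S" if "x \<in> J ` S" using that by (rule inv_into_into)
      then show "R x e \<in> insert 0 ((\<lambda>y. y e) ` S)" by (simp add: R_def)
    qed
    show "finite (insert 0 ((\<lambda>y. y e) ` S))" using finS by simp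
  qed
  moreover have "\<alpha> (inv g x) \<ge> 0" if "x \<in> V" for x
    using that s ig by (auto simp: V_def sbm_def)
  ultimately have rw: "randomly_weighted_graph H"
    using indep c measure_pmf.prob_space_axioms
    unfolding randomly_weighted_graph_def H_def Ix_def by (simp add: V_def)
  have mom: "prob_space.expectation (measure_pmf P) (\<lambda>x. R x e ^ n) = (\<Sum>l\<in>L. l ^ n * \<beta> (inv g ` e, l))"
    if "e \<in> Ix" for e n
  proof -
    have "(\<integral>x. R x e ^ n \<partial>measure_pmf P) = (\<integral>y. y e ^ n \<partial>measure_pmf (map_pmf R P))"
      by simp
    also have "\<dots> = (\<integral>l. l ^ n \<partial>measure_pmf (map_pmf (\<lambda>y. y e) D))"
      unfolding RP by simp
    also have "map_pmf (\<lambda>y. y e) D = M e"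
      unfolding D_def by (subst Pi_pmf_component[OF finI]) (simp add: that)
    also have "(\<integral>l. l ^ n \<partial>measure_pmf (M e)) = (\<Sum>l\<in>L. l ^ n * pmf (M e) l)"
      using M L by (intro integral_measure_pmf_real) (auto simp: set_pmf_eq split: if_splits)
    finally show ?thesis using M by simp
  qed
  have "hom_rw F H = c ^ card (nodes F) * shom L k \<alpha> \<beta> (nodes F) (edges F)" if F: "multigraph F" for F
  proof -
    let ?U = "nodes F" and ?E = "edges F"
    have finU: "finite ?U" using F by (simp add: multigraph_def)
    let ?T = "\<lambda>\<phi>. (\<Prod>i\<in>?U. c * \<alpha> (inv g (\<phi> i))) *
        (\<Prod>e\<in>pairs ?U. \<Sum>l\<in>L. l ^ count ?E e * \<beta> (inv g ` \<phi> ` e, l))"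
    have "hom_rw F H = (\<Sum>\<phi>\<in>?U \<rightarrow>\<^sub>E V. ?T \<phi>)"
      unfolding hom_rw_def H_def rwgraph.simps pairs_def[symmetric]
    proof (intro sum.cong refl arg_cong2[of _ _ _ _ "(*)"] prod.cong mom)
      fix \<phi> e assume \<phi>: "\<phi> \<in> ?U \<rightarrow>\<^sub>E V" and e: "e \<in> pairs ?U"
      then obtain i j where "e = {i, j}" "i \<in> ?U" "j \<in> ?U" by (auto simp: pairs_def card_2_iff)
      then show "\<phi> ` e \<in> Ix" using PiE_mem[OF \<phi>] by (auto simp: Ix_def)
    qed
    also have "\<dots> = (\<Sum>\<psi>\<in>?U \<rightarrow>\<^sub>E {..<k}. c ^ card ?U * ((\<Prod>i\<in>?U. \<alpha> (\<psi> i)) *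
        (\<Prod>e\<in>pairs ?U. \<Sum>l\<in>L. l ^ count ?E e * \<beta> (\<psi> ` e, l))))"
    proof (rule sum.reindex_bij_witness[of _ "\<lambda>\<psi>. \<lambda>i\<in>?U. g (\<psi> i)" "\<lambda>\<phi>. \<lambda>i\<in>?U. inv g (\<phi> i)"])
      fix \<phi> assume \<phi>: "\<phi> \<in> ?U \<rightarrow>\<^sub>E V"
      have m: "g (inv g (\<phi> i)) = \<phi> i \<and> inv g (\<phi> i) < k" if "i \<in> ?U" for i
        using PiE_mem[OF \<phi> that] ig by (auto simp: V_def)
      show "(\<lambda>i\<in>?U. g ((\<lambda>i\<in>?U. inv g (\<phi> i)) i)) = \<phi>"
      proof
        fix i show "(\<lambda>i\<in>?U. g ((\<lambda>i\<in>?U. inv g (\<phi> i)) i)) i = \<phi> i"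
          using m[of i] PiE_arb[OF \<phi>, of i] by (cases "i \<in> ?U") auto
      qed
      show "(\<lambda>i\<in>?U. inv g (\<phi> i)) \<in> ?U \<rightarrow>\<^sub>E {..<k}" using m by simp
      have "(\<lambda>i\<in>?U. inv g (\<phi> i)) ` e = inv g ` \<phi> ` e" if "e \<in> pairs ?U" for e
        unfolding image_image using that by (intro image_cong) (auto simp: pairs_def)
      then show "c ^ card ?U * ((\<Prod>i\<in>?U. \<alpha> ((\<lambda>i\<in>?U. inv g (\<phi> i)) i)) *
          (\<Prod>e\<in>pairs ?U. \<Sum>l\<in>L. l ^ count ?E e * \<beta> ((\<lambda>i\<in>?U. inv g (\<phi> i)) ` e, l))) = ?T \<phi>"
        by (simp add: prod.distrib mult.assoc)
    next
      fix \<psi> assume \<psi>: "\<psi> \<in> ?U \<rightarrow>\<^sub>E {..<k}"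
      show "(\<lambda>i\<in>?U. inv g ((\<lambda>i\<in>?U. g (\<psi> i)) i)) = \<psi>"
      proof
        fix i show "(\<lambda>i\<in>?U. inv g ((\<lambda>i\<in>?U. g (\<psi> i)) i)) i = \<psi> i"
          using ig PiE_arb[OF \<psi>, of i] by (cases "i \<in> ?U") auto
      qed
      show "(\<lambda>i\<in>?U. g (\<psi> i)) \<in> ?U \<rightarrow>\<^sub>E V" using PiE_mem[OF \<psi>] by (simp add: V_def)
    qed
    finally show ?thesis by (simp add: shom_def sum_distrib_left)
  qed
  then show ?thesis using rw by blast
qed

text \<open>A multigraph has a node, so no map into the empty node set exists and the sum is
  empty.\<close>

lemma ex_empty_rwgraph:
  "\<exists>H :: ('v, 'w) rwgraph. randomly_weighted_graph H \<and> (\<forall>F. multigraph F \<longrightarrow> hom_rw F H = 0)"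
proof -
  obtain x :: 'w where True by blast
  define H :: "('v, 'w) rwgraph" where
    "H = \<lparr>wnodes = {}, node_weight = (\<lambda>_. 0), sample_space = measure_pmf (return_pmf x), edge_weight = (\<lambda>_ _. 0)\<rparr>"
  have "prob_space.indep_vars (measure_pmf (return_pmf x)) (\<lambda>_. borel) (\<lambda>_ _. 0 :: real) ({} :: 'v set set)"
    by (subst prob_space.indep_vars_def [OF measure_pmf.prob_space_axioms],
        subst prob_space.indep_sets_def [OF measure_pmf.prob_space_axioms]) simp_all
  then have "randomly_weighted_graph H"
    using measure_pmf.prob_space_axioms by (simp add: randomly_weighted_graph_def H_def)
  moreover have "hom_rw F H = 0" if "multigraph F" for F
  proof -
    have "nodes F \<noteq> {}" using that by (simp add: multigraph_def)
    then have "nodes F \<rightarrow>\<^sub>E ({} :: 'v set) = {}" by (simp add: PiE_eq_empty_iff ex_in_conv)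
    then show ?thesis by (simp add: hom_rw_def H_def)
  qed
  ultimately show ?thesis by blast
qed

section \<open>Gram representation of homomorphism functions\<close>

definition moment :: "('v, 'w) rwgraph \<Rightarrow> 'v set \<Rightarrow> nat \<Rightarrow> real" where
  "moment H s n = prob_space.expectation (sample_space H) (\<lambda>x. edge_weight H s x ^ n)"

definition mass :: "('v, 'w) rwgraph \<Rightarrow> 'v set \<Rightarrow> real \<Rightarrow> real" where
  "mass H s y = measure (sample_space H) {x \<in> space (sample_space H). edge_weight H s x = y}"

text \<open>A common finite range lets all pairs be summed over the same set; values that a pair
  does not attain have mass zero.\<close>

definition weight_values :: "('v, 'w) rwgraph \<Rightarrow> real set" where
  "weight_values H = (\<Union>i\<in>wnodes H. \<Union>j\<in>wnodes H. edge_weight H {i, j} ` space (sample_space H))"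

lemma finite_weight_values: "randomly_weighted_graph H \<Longrightarrow> finite (weight_values H)"
  by (auto simp: weight_values_def randomly_weighted_graph_def)

lemma moment_eq:
  assumes H: "randomly_weighted_graph H" and ij: "i \<in> wnodes H" "j \<in> wnodes H"
  shows "moment H {i, j} n = (\<Sum>y\<in>weight_values H. mass H {i, j} y * y ^ n)"
proof -
  let ?M = "sample_space H" and ?X = "edge_weight H {i, j}"
  interpret prob_space ?M using H by (simp add: randomly_weighted_graph_def)
  have "indep_vars (\<lambda>_. borel) (edge_weight H) {{i, j} | i j. i \<in> wnodes H \<and> j \<in> wnodes H}"
    using H by (simp add: randomly_weighted_graph_def)
  then have X: "?X \<in> borel_measurable ?M"
    using ij unfolding indep_vars_def by blast
  have A: "{x \<in> space ?M. ?X x = y} \<in> sets ?M" for y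
    using X by measurable
  have fin: "finite (weight_values H)" by (rule finite_weight_values[OF H])
  have "moment H {i, j} n = (\<integral>x. (\<Sum>y\<in>weight_values H. y ^ n * indicator {x \<in> space ?M. ?X x = y} x) \<partial>?M)"
    unfolding moment_def
  proof (rule Bochner_Integration.integral_cong[OF refl])
    fix x assume x: "x \<in> space ?M"
    then have "?X x \<in> weight_values H" using ij by (auto simp: weight_values_def)
    moreover have "(\<Sum>y\<in>weight_values H. y ^ n * indicator {x \<in> space ?M. ?X x = y} x) =
        (\<Sum>y\<in>weight_values H. if y = ?X x then y ^ n else 0)"
      using x by (intro sum.cong refl) (auto simp: indicator_def)
    ultimately show "?X x ^ n = (\<Sum>y\<in>weight_values H. y ^ n * indicator {x \<in> space ?M. ?X x = y} x)"
      using fin by simp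
  qed
  also have "\<dots> = (\<Sum>y\<in>weight_values H. (\<integral>x. y ^ n * indicator {x \<in> space ?M. ?X x = y} x \<partial>?M))"
    using A by (intro Bochner_Integration.integral_sum) (simp add: integrable_real_indicator emeasure_eq_measure)
  also have "\<dots> = (\<Sum>y\<in>weight_values H. mass H {i, j} y * y ^ n)"
    using A by (intro sum.cong refl) (simp add: mass_def mult.commute)
  finally show ?thesis .
qed

lemma moment_0: "randomly_weighted_graph H \<Longrightarrow> moment H s 0 = 1"
  by (simp add: moment_def randomly_weighted_graph_def prob_space.prob_space)

definition merge_on :: "nat set \<Rightarrow> (nat \<Rightarrow> 'v) \<Rightarrow> (nat \<Rightarrow> 'v) \<Rightarrow> nat \<Rightarrow> 'v" where
  "merge_on N \<phi> \<xi> x = (if x \<in> N then \<phi> x else \<xi> x)"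

lemma sum_PiE_merge:
  assumes "N \<inter> A = {}"
  shows "(\<Sum>\<psi>\<in>N \<union> A \<rightarrow>\<^sub>E S. g \<psi>) = (\<Sum>\<phi>\<in>N \<rightarrow>\<^sub>E S. \<Sum>\<xi>\<in>A \<rightarrow>\<^sub>E S. g (merge_on N \<phi> \<xi>))"
proof -
  have "(\<Sum>\<phi>\<in>N \<rightarrow>\<^sub>E S. \<Sum>\<xi>\<in>A \<rightarrow>\<^sub>E S. g (merge_on N \<phi> \<xi>)) =
      (\<Sum>p\<in>(N \<rightarrow>\<^sub>E S) \<times> (A \<rightarrow>\<^sub>E S). g (merge_on N (fst p) (snd p)))"
    by (simp add: sum.cartesian_product split_def)
  also have "\<dots> = (\<Sum>\<psi>\<in>N \<union> A \<rightarrow>\<^sub>E S. g \<psi>)"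
  proof (rule sum.reindex_bij_witness[of _ "\<lambda>\<psi>. (restrict \<psi> N, restrict \<psi> A)" "\<lambda>p. merge_on N (fst p) (snd p)"])
    fix p assume p: "p \<in> (N \<rightarrow>\<^sub>E S) \<times> (A \<rightarrow>\<^sub>E S)"
    obtain a b where ab: "p = (a, b)" "a \<in> N \<rightarrow>\<^sub>E S" "b \<in> A \<rightarrow>\<^sub>E S" using p by auto
    have "restrict (merge_on N a b) N = a"
    proof
      fix x show "restrict (merge_on N a b) N x = a x"
        using PiE_arb[OF ab(2), of x] by (simp add: merge_on_def)
    qed
    moreover have "restrict (merge_on N a b) A = b"
    proof
      fix x show "restrict (merge_on N a b) A x = b x"
        using PiE_arb[OF ab(3), of x] assms by (auto simp: merge_on_def)
    qed
    ultimately show "(restrict (merge_on N (fst p) (snd p)) N, restrict (merge_on N (fst p) (snd p)) A) = p"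
      using ab(1) by simp
    show "merge_on N (fst p) (snd p) \<in> N \<union> A \<rightarrow>\<^sub>E S"
      using ab by (auto simp: merge_on_def PiE_iff extensional_def)
  next
    fix \<psi> assume \<psi>: "\<psi> \<in> N \<union> A \<rightarrow>\<^sub>E S"
    show "merge_on N (fst (restrict \<psi> N, restrict \<psi> A)) (snd (restrict \<psi> N, restrict \<psi> A)) = \<psi>"
    proof
      fix x show "merge_on N (fst (restrict \<psi> N, restrict \<psi> A)) (snd (restrict \<psi> N, restrict \<psi> A)) x = \<psi> x"
        using PiE_arb[OF \<psi>, of x] by (auto simp: merge_on_def)
    qed
    show "(restrict \<psi> N, restrict \<psi> A) \<in> (N \<rightarrow>\<^sub>E S) \<times> (A \<rightarrow>\<^sub>E S)" using \<psi> by (simp add: PiE_iff)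
  qed simp
  finally show ?thesis ..
qed

text \<open>
  Summing out the unlabeled nodes \<open>nodes F - N\<close>: the contribution of \<open>F\<close> given the images
  \<open>\<phi>\<close> of the labeled nodes and the sampled weights \<open>c\<close> of the pairs of labeled nodes.
\<close>

definition local_value :: "('v, 'w) rwgraph \<Rightarrow> nat set \<Rightarrow> mgraph \<Rightarrow> (nat \<Rightarrow> 'v) \<times> (nat set \<Rightarrow> real) \<Rightarrow> real" where
  "local_value H N F p = (\<Prod>e\<in>pairs N. snd p e ^ count (edges F) e) *
     (\<Sum>\<xi>\<in>nodes F - N \<rightarrow>\<^sub>E wnodes H. (\<Prod>i\<in>nodes F - N. node_weight H (\<xi> i)) *
        (\<Prod>e\<in>set_mset (edges F) - pairs N. moment H (merge_on N (fst p) \<xi> ` e) (count (edges F) e)))"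

definition local_weight :: "('v, 'w) rwgraph \<Rightarrow> nat set \<Rightarrow> (nat \<Rightarrow> 'v) \<times> (nat set \<Rightarrow> real) \<Rightarrow> real" where
  "local_weight H N p = (\<Prod>i\<in>N. node_weight H (fst p i)) * (\<Prod>e\<in>pairs N. mass H (fst p ` e) (snd p e))"

definition local_states :: "('v, 'w) rwgraph \<Rightarrow> nat set \<Rightarrow> ((nat \<Rightarrow> 'v) \<times> (nat set \<Rightarrow> real)) set" where
  "local_states H N = (N \<rightarrow>\<^sub>E wnodes H) \<times> (pairs N \<rightarrow>\<^sub>E weight_values H)"

text \<open>The moment of parallel edges from both graphs is not a product of moments. It factors
  once the weight of the pair is fixed, which is why states record weights of labeled pairs; every
  other edge belongs to one graph only.\<close>

lemma hom_rw_graph_union: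
  assumes H: "randomly_weighted_graph H" and F: "multigraph F" "multigraph G"
    and N: "nodes F \<inter> nodes G = N"
  shows "hom_rw (graph_union F G) H =
    (\<Sum>p\<in>local_states H N. local_weight H N p * local_value H N F p * local_value H N G p)"
proof -
  let ?V = "wnodes H" and ?A = "nodes F - N" and ?B = "nodes G - N"
  let ?SF = "set_mset (edges F) - pairs N" and ?SG = "set_mset (edges G) - pairs N"
  let ?U = "N \<union> (?A \<union> ?B)"
  have U: "nodes F \<union> nodes G = ?U" using N by blast
  have fin: "finite ?A" "finite ?B" "finite N" "?A \<inter> ?B = {}" "N \<inter> (?A \<union> ?B) = {}"
    using F N by (auto simp: multigraph_def)
  have EF: "e \<subseteq> nodes F \<and> card e = 2" if "e \<in># edges F" for e using F(1) that by (simp add: multigraph_def)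
  have EG: "e \<subseteq> nodes G \<and> card e = 2" if "e \<in># edges G" for e using F(2) that by (simp add: multigraph_def)
  \<comment> \<open>An edge present in both graphs has both ends in \<open>N\<close>.\<close>
  have cF: "count (edges G) e = 0" if "e \<in> ?SF" for e
  proof (rule ccontr)
    assume "count (edges G) e \<noteq> 0"
    then have "e \<in># edges G" by (simp add: count_eq_zero_iff)
    then have "e \<in> pairs N" using EF[of e] EG[of e] that N by (auto simp: pairs_def)
    then show False using that by simp
  qed
  have cG: "count (edges F) e = 0" if "e \<in> ?SG" for e
  proof (rule ccontr)
    assume "count (edges F) e \<noteq> 0"
    then have "e \<in># edges F" by (simp add: count_eq_zero_iff)
    then have "e \<in> pairs N" using EF[of e] EG[of e] that N by (auto simp: pairs_def)
    then show False using that by simp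
  qed
  have dis: "?SF \<inter> ?SG = {}" "pairs N \<inter> (?SF \<union> ?SG) = {}"
    using cF by (auto simp: count_eq_zero_iff)
  have finp: "finite (pairs N)" using finite_pairs[OF fin(3)] .
  let ?n = "\<lambda>e. count (edges F + edges G) e"
  have sub: "pairs N \<union> (?SF \<union> ?SG) \<subseteq> pairs ?U"
    using EF EG U by (auto simp: pairs_def)
  have prod: "(\<Prod>e\<in>pairs ?U. moment H (\<psi> ` e) (?n e)) =
      (\<Prod>e\<in>pairs N. moment H (\<psi> ` e) (?n e)) * ((\<Prod>e\<in>?SF. moment H (\<psi> ` e) (count (edges F) e)) *
        (\<Prod>e\<in>?SG. moment H (\<psi> ` e) (count (edges G) e)))" for \<psi>
  proof -
    have "(\<Prod>e\<in>pairs ?U. moment H (\<psi> ` e) (?n e)) = (\<Prod>e\<in>pairs N \<union> (?SF \<union> ?SG). moment H (\<psi> ` e) (?n e))"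
    proof (rule prod.mono_neutral_right[OF finite_pairs sub])
      show "finite ?U" using fin by simp
      show "\<forall>e\<in>pairs ?U - (pairs N \<union> (?SF \<union> ?SG)). moment H (\<psi> ` e) (?n e) = 1"
      proof
        fix e assume "e \<in> pairs ?U - (pairs N \<union> (?SF \<union> ?SG))"
        then have "?n e = 0" by (auto simp: count_eq_zero_iff)
        then show "moment H (\<psi> ` e) (?n e) = 1" using moment_0[OF H] by simp
      qed
    qed
    also have "\<dots> = (\<Prod>e\<in>pairs N. moment H (\<psi> ` e) (?n e)) * (\<Prod>e\<in>?SF \<union> ?SG. moment H (\<psi> ` e) (?n e))"
      using finp dis(2) by (intro prod.union_disjoint) auto
    also have "(\<Prod>e\<in>?SF \<union> ?SG. moment H (\<psi> ` e) (?n e)) =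
        (\<Prod>e\<in>?SF. moment H (\<psi> ` e) (?n e)) * (\<Prod>e\<in>?SG. moment H (\<psi> ` e) (?n e))"
      using dis(1) by (intro prod.union_disjoint) auto
    finally show ?thesis using cF cG by simp
  qed
  let ?mA = "\<lambda>\<phi> \<xi>. (\<Prod>i\<in>?A. node_weight H (\<xi> i)) * (\<Prod>e\<in>?SF. moment H (merge_on N \<phi> \<xi> ` e) (count (edges F) e))"
  let ?mB = "\<lambda>\<phi> \<xi>. (\<Prod>i\<in>?B. node_weight H (\<xi> i)) * (\<Prod>e\<in>?SG. moment H (merge_on N \<phi> \<xi> ` e) (count (edges G) e))"
  let ?w = "\<lambda>\<phi>. \<Prod>i\<in>N. node_weight H (\<phi> i)"
  have "hom_rw (graph_union F G) H = (\<Sum>\<psi>\<in>?U \<rightarrow>\<^sub>E ?V. (\<Prod>i\<in>?U. node_weight H (\<psi> i)) *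
      (\<Prod>e\<in>pairs ?U. moment H (\<psi> ` e) (?n e)))"
    by (simp only: hom_rw_def graph_union_def mgraph.simps U pairs_def moment_def)
  also have "\<dots> = (\<Sum>\<phi>\<in>N \<rightarrow>\<^sub>E ?V. \<Sum>\<xi>\<in>?A \<union> ?B \<rightarrow>\<^sub>E ?V. ?w \<phi> * (\<Prod>e\<in>pairs N. moment H (\<phi> ` e) (?n e)) *
      (?mA \<phi> (restrict \<xi> ?A) * ?mB \<phi> (restrict \<xi> ?B)))"
    unfolding sum_PiE_merge[OF fin(5)]
  proof (intro sum.cong refl)
    fix \<phi> :: "nat \<Rightarrow> 'a" and \<xi> :: "nat \<Rightarrow> 'a"
    let ?\<psi> = "merge_on N \<phi> \<xi>"
    have 1: "(\<Prod>i\<in>?U. node_weight H (?\<psi> i)) =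
        ?w \<phi> * ((\<Prod>i\<in>?A. node_weight H (restrict \<xi> ?A i)) * (\<Prod>i\<in>?B. node_weight H (restrict \<xi> ?B i)))"
    proof -
      have "(\<Prod>i\<in>?U. node_weight H (?\<psi> i)) = (\<Prod>i\<in>N. node_weight H (?\<psi> i)) * (\<Prod>i\<in>?A \<union> ?B. node_weight H (?\<psi> i))"
        using fin by (intro prod.union_disjoint) auto
      also have "(\<Prod>i\<in>?A \<union> ?B. node_weight H (?\<psi> i)) = (\<Prod>i\<in>?A. node_weight H (?\<psi> i)) * (\<Prod>i\<in>?B. node_weight H (?\<psi> i))"
        using fin by (intro prod.union_disjoint) auto
      finally show ?thesis by (simp add: merge_on_def)
    qed
    have 2: "?\<psi> ` e = \<phi> ` e" if "e \<in> pairs N" for e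
      using that by (intro image_cong) (auto simp: pairs_def merge_on_def)
    have 3: "?\<psi> ` e = merge_on N \<phi> (restrict \<xi> ?A) ` e" if "e \<in> ?SF" for e
      using that EF[of e] by (intro image_cong) (auto simp: merge_on_def)
    have 4: "?\<psi> ` e = merge_on N \<phi> (restrict \<xi> ?B) ` e" if "e \<in> ?SG" for e
      using that EG[of e] by (intro image_cong) (auto simp: merge_on_def)
    have 5: "(\<Prod>e\<in>pairs N. moment H (?\<psi> ` e) (?n e)) = (\<Prod>e\<in>pairs N. moment H (\<phi> ` e) (?n e))"
      using 2 by (intro prod.cong refl) simp
    have 6: "(\<Prod>e\<in>?SF. moment H (?\<psi> ` e) (count (edges F) e)) =
        (\<Prod>e\<in>?SF. moment H (merge_on N \<phi> (restrict \<xi> ?A) ` e) (count (edges F) e))"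
      using 3 by (intro prod.cong refl) simp
    have 7: "(\<Prod>e\<in>?SG. moment H (?\<psi> ` e) (count (edges G) e)) =
        (\<Prod>e\<in>?SG. moment H (merge_on N \<phi> (restrict \<xi> ?B) ` e) (count (edges G) e))"
      using 4 by (intro prod.cong refl) simp
    show "(\<Prod>i\<in>?U. node_weight H (?\<psi> i)) * (\<Prod>e\<in>pairs ?U. moment H (?\<psi> ` e) (?n e)) =
        ?w \<phi> * (\<Prod>e\<in>pairs N. moment H (\<phi> ` e) (?n e)) * (?mA \<phi> (restrict \<xi> ?A) * ?mB \<phi> (restrict \<xi> ?B))"
      unfolding prod 1 5 6 7 by (simp only: mult_ac)
  qed
  also have "\<dots> = (\<Sum>\<phi>\<in>N \<rightarrow>\<^sub>E ?V. ?w \<phi> * (\<Prod>e\<in>pairs N. moment H (\<phi> ` e) (?n e)) *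
      ((\<Sum>\<xi>\<in>?A \<rightarrow>\<^sub>E ?V. ?mA \<phi> \<xi>) * (\<Sum>\<xi>\<in>?B \<rightarrow>\<^sub>E ?V. ?mB \<phi> \<xi>)))"
  proof (rule sum.cong[OF refl])
    fix \<phi> :: "nat \<Rightarrow> 'a"
    show "(\<Sum>\<xi>\<in>?A \<union> ?B \<rightarrow>\<^sub>E ?V. ?w \<phi> * (\<Prod>e\<in>pairs N. moment H (\<phi> ` e) (?n e)) *
        (?mA \<phi> (restrict \<xi> ?A) * ?mB \<phi> (restrict \<xi> ?B))) =
      ?w \<phi> * (\<Prod>e\<in>pairs N. moment H (\<phi> ` e) (?n e)) *
      ((\<Sum>\<xi>\<in>?A \<rightarrow>\<^sub>E ?V. ?mA \<phi> \<xi>) * (\<Sum>\<xi>\<in>?B \<rightarrow>\<^sub>E ?V. ?mB \<phi> \<xi>))"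
      unfolding sum_distrib_left[symmetric]
        sum_PiE_disjoint[OF fin(1,2,4), where f = "?mA \<phi>" and g = "?mB \<phi>"] ..
  qed
  also have "\<dots> = (\<Sum>\<phi>\<in>N \<rightarrow>\<^sub>E ?V. \<Sum>c\<in>pairs N \<rightarrow>\<^sub>E weight_values H.
      local_weight H N (\<phi>, c) * local_value H N F (\<phi>, c) * local_value H N G (\<phi>, c))"
  proof (rule sum.cong[OF refl])
    fix \<phi> assume \<phi>: "\<phi> \<in> N \<rightarrow>\<^sub>E ?V"
    let ?Y = "(\<Sum>\<xi>\<in>?A \<rightarrow>\<^sub>E ?V. ?mA \<phi> \<xi>) * (\<Sum>\<xi>\<in>?B \<rightarrow>\<^sub>E ?V. ?mB \<phi> \<xi>)"
    have "(\<Prod>e\<in>pairs N. moment H (\<phi> ` e) (?n e)) =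
        (\<Prod>e\<in>pairs N. \<Sum>y\<in>weight_values H. mass H (\<phi> ` e) y * y ^ ?n e)"
    proof (rule prod.cong[OF refl])
      fix e assume "e \<in> pairs N"
      then obtain i j where e: "e = {i, j}" "i \<in> N" "j \<in> N" by (auto simp: pairs_def card_2_iff)
      have "\<phi> i \<in> ?V" "\<phi> j \<in> ?V" using PiE_mem[OF \<phi>] e by auto
      from moment_eq[OF H this] show "moment H (\<phi> ` e) (?n e) = (\<Sum>y\<in>weight_values H. mass H (\<phi> ` e) y * y ^ ?n e)"
        using e(1) by simp
    qed
    \<comment> \<open>Expanding the product over pairs yields a sum over simultaneous weight
      assignments, the second component of a state.\<close>
    also have "\<dots> = (\<Sum>c\<in>pairs N \<rightarrow>\<^sub>E weight_values H. \<Prod>e\<in>pairs N. mass H (\<phi> ` e) (c e) * c e ^ ?n e)"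
      using finp finite_weight_values[OF H] by (intro prod_sum_PiE) auto
    finally have moments: "(\<Prod>e\<in>pairs N. moment H (\<phi> ` e) (?n e)) =
        (\<Sum>c\<in>pairs N \<rightarrow>\<^sub>E weight_values H. \<Prod>e\<in>pairs N. mass H (\<phi> ` e) (c e) * c e ^ ?n e)" .
    have distrib: "a * sum g S * y = (\<Sum>c\<in>S. a * g c * y)" for a y :: real and g and S :: "(nat set \<Rightarrow> real) set"
      by (simp add: sum_distrib_left sum_distrib_right)
    have "?w \<phi> * (\<Prod>e\<in>pairs N. moment H (\<phi> ` e) (?n e)) * ?Y =
        (\<Sum>c\<in>pairs N \<rightarrow>\<^sub>E weight_values H. ?w \<phi> * (\<Prod>e\<in>pairs N. mass H (\<phi> ` e) (c e) * c e ^ ?n e) * ?Y)"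
      unfolding moments by (rule distrib)
    also have "\<dots> = (\<Sum>c\<in>pairs N \<rightarrow>\<^sub>E weight_values H.
      local_weight H N (\<phi>, c) * local_value H N F (\<phi>, c) * local_value H N G (\<phi>, c))"
      unfolding local_weight_def local_value_def fst_conv snd_conv count_union power_add prod.distrib
      by (simp only: mult_ac)
    finally show "?w \<phi> * (\<Prod>e\<in>pairs N. moment H (\<phi> ` e) (?n e)) * ?Y =
      (\<Sum>c\<in>pairs N \<rightarrow>\<^sub>E weight_values H. local_weight H N (\<phi>, c) * local_value H N F (\<phi>, c) * local_value H N G (\<phi>, c))" .
  qed
  also have "\<dots> = (\<Sum>p\<in>local_states H N. local_weight H N p * local_value H N F p * local_value H N G p)"
    by (simp add: local_states_def sum.cartesian_product split_def)
  finally show ?thesis .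
qed

lemma sum_PiE_reindex:
  assumes h: "bij_betw h A B"
  shows "(\<Sum>\<eta>\<in>A \<rightarrow>\<^sub>E S. g \<eta>) = (\<Sum>\<xi>\<in>B \<rightarrow>\<^sub>E S. g (restrict (\<lambda>x. \<xi> (h x)) A))"
proof (rule sum.reindex_bij_witness[of _ "\<lambda>\<xi>. restrict (\<lambda>x. \<xi> (h x)) A" "\<lambda>\<eta>. restrict (\<lambda>y. \<eta> (inv_into A h y)) B"])
  have inj: "inj_on h A" and hA: "h ` A = B" using h by (auto simp: bij_betw_def)
  have kB: "inv_into A h y \<in> A" "h (inv_into A h y) = y" if "y \<in> B" for y
    using that hA by (auto intro: inv_into_into f_inv_into_f)
  fix \<eta> assume \<eta>: "\<eta> \<in> A \<rightarrow>\<^sub>E S"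
  show "restrict (\<lambda>x. restrict (\<lambda>y. \<eta> (inv_into A h y)) B (h x)) A = \<eta>"
  proof
    fix x show "restrict (\<lambda>x. restrict (\<lambda>y. \<eta> (inv_into A h y)) B (h x)) A x = \<eta> x"
      using PiE_arb[OF \<eta>, of x] inj hA by (auto simp: restrict_def)
  qed
  then show "g (restrict (\<lambda>x. restrict (\<lambda>y. \<eta> (inv_into A h y)) B (h x)) A) = g \<eta>" by simp
  show "restrict (\<lambda>y. \<eta> (inv_into A h y)) B \<in> B \<rightarrow>\<^sub>E S"
    using kB PiE_mem[OF \<eta>] by (auto simp: PiE_iff)
next
  have hA: "h ` A = B" using h by (auto simp: bij_betw_def)
  have kB: "inv_into A h y \<in> A" "h (inv_into A h y) = y" if "y \<in> B" for y
    using that hA by (auto intro: inv_into_into f_inv_into_f)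
  fix \<xi> assume \<xi>: "\<xi> \<in> B \<rightarrow>\<^sub>E S"
  show "restrict (\<lambda>y. restrict (\<lambda>x. \<xi> (h x)) A (inv_into A h y)) B = \<xi>"
  proof
    fix y show "restrict (\<lambda>y. restrict (\<lambda>x. \<xi> (h x)) A (inv_into A h y)) B y = \<xi> y"
      using PiE_arb[OF \<xi>, of y] kB[of y] by (auto simp: restrict_def)
  qed
  show "restrict (\<lambda>x. \<xi> (h x)) A \<in> A \<rightarrow>\<^sub>E S"
    using hA PiE_mem[OF \<xi>] by (auto simp: PiE_iff)
qed

text \<open>Makes the local value a function of the type, so a representative may be moved away from
  the other factor before gluing.\<close>

lemma local_value_iso:
  assumes F: "labeled n F" and iso: "labeled_iso n F G"
  shows "local_value H {1..n} F p = local_value H {1..n} G p"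
proof -
  let ?N = "{1..n}"
  obtain h where h: "bij_betw h (nodes F) (nodes G)" "\<And>i. i \<in> ?N \<Longrightarrow> h i = i"
    "image_mset (image h) (edges F) = edges G"
    using iso by (auto simp: labeled_iso_def)
  have NF: "?N \<subseteq> nodes F" and EF: "\<And>e. e \<in># edges F \<Longrightarrow> e \<subseteq> nodes F \<and> card e = 2"
    using F by (auto simp: labeled_def multigraph_def)
  have inj: "inj_on h (nodes F)" using h(1) by (rule bij_betw_imp_inj_on)
  have hN: "h x \<in> ?N \<longleftrightarrow> x \<in> ?N" if x: "x \<in> nodes F" for x
  proof
    assume a: "h x \<in> ?N"
    then have "h x = x" using inj_onD[OF inj h(2)[OF a]] NF x by blast
    then show "x \<in> ?N" using a by simp
  qed (use h(2) in simp)
  let ?A = "nodes F - ?N" and ?B = "nodes G - ?N"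
  have hN': "h ` ?N = ?N" using h(2) by (simp add: image_def)
  have bij: "bij_betw h ?A ?B"
    using inj_on_image_set_diff[OF inj Diff_subset NF] hN' h(1)
    by (auto simp: bij_betw_def intro: inj_on_subset)
  have inj_e: "e = e'" if "e \<subseteq> nodes F" "e' \<subseteq> nodes F" "h ` e = h ` e'" for e e'
    using inj_on_image_eq_iff[OF inj that(1,2)] that(3) by simp
  have cnt: "count (edges G) (h ` e) = count (edges F) e" if e: "e \<subseteq> nodes F" for e
  proof -
    have "(\<lambda>e'. h ` e') -` {h ` e} \<inter> set_mset (edges F) = {e} \<inter> set_mset (edges F)"
      using inj_e[OF _ e] EF by auto
    then show ?thesis
      unfolding h(3)[symmetric] count_image_mset
      by (cases "e \<in># edges F") (simp_all add: count_eq_zero_iff)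
  qed
  have cntN: "count (edges G) e = count (edges F) e" if "e \<in> pairs ?N" for e
  proof -
    have "e \<subseteq> ?N" using that by (simp add: pairs_def)
    then have "h ` e = e" using h(2) by (force simp: image_def)
    then show ?thesis using cnt[of e] \<open>e \<subseteq> ?N\<close> NF by auto
  qed
  let ?SF = "set_mset (edges F) - pairs ?N" and ?SG = "set_mset (edges G) - pairs ?N"
  have hp: "h ` e \<in> pairs ?N \<longleftrightarrow> e \<in> pairs ?N" if "e \<in># edges F" for e
  proof -
    have e: "e \<subseteq> nodes F" "card e = 2" using EF[OF that] by auto
    have "card (h ` e) = card e" using inj_on_subset[OF inj e(1)] by (rule card_image)
    moreover have "h ` e \<subseteq> ?N \<longleftrightarrow> e \<subseteq> ?N" using hN e(1) by blast
    ultimately show ?thesis using e(2) by (simp add: pairs_def)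
  qed
  have SG: "?SG = image h ` ?SF"
  proof -
    have "set_mset (edges G) = image h ` set_mset (edges F)" by (simp add: h(3)[symmetric])
    then show ?thesis using hp by auto
  qed
  have injS: "inj_on (image h) ?SF"
    by (rule inj_onI, rule inj_e) (use EF in auto)
  have m: "merge_on ?N \<phi> (restrict (\<lambda>x. \<xi> (h x)) ?A) ` e = merge_on ?N \<phi> \<xi> ` h ` e"
    if "e \<subseteq> nodes F" for e and \<phi> \<xi> :: "nat \<Rightarrow> 'a"
    unfolding image_image
  proof (rule image_cong[OF refl])
    fix x assume "x \<in> e"
    then have x: "x \<in> nodes F" using that by blast
    show "merge_on ?N \<phi> (restrict (\<lambda>x. \<xi> (h x)) ?A) x = merge_on ?N \<phi> \<xi> (h x)"
      using hN[OF x] h(2)[of x] x by (auto simp: merge_on_def)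
  qed
  have w: "(\<Prod>i\<in>?A. node_weight H (restrict (\<lambda>x. \<xi> (h x)) ?A i)) = (\<Prod>i\<in>?B. node_weight H (\<xi> i))" for \<xi>
    using prod.reindex_bij_betw[OF bij, of "\<lambda>i. node_weight H (\<xi> i)"] by simp
  have mo: "(\<Prod>e\<in>?SF. moment H (merge_on ?N \<phi> (restrict (\<lambda>x. \<xi> (h x)) ?A) ` e) (count (edges F) e)) =
      (\<Prod>e\<in>?SG. moment H (merge_on ?N \<phi> \<xi> ` e) (count (edges G) e))" for \<phi> \<xi>
    unfolding SG prod.reindex[OF injS] comp_def
  proof (rule prod.cong[OF refl])
    fix e assume "e \<in> ?SF"
    then have e: "e \<subseteq> nodes F" using EF by simp
    show "moment H (merge_on ?N \<phi> (restrict (\<lambda>x. \<xi> (h x)) ?A) ` e) (count (edges F) e) =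
        moment H (merge_on ?N \<phi> \<xi> ` h ` e) (count (edges G) (h ` e))"
      unfolding cnt[OF e] m[OF e] ..
  qed
  have pp: "(\<Prod>e\<in>pairs ?N. snd p e ^ count (edges F) e) = (\<Prod>e\<in>pairs ?N. snd p e ^ count (edges G) e)"
    using cntN by simp
  let ?t = "\<lambda>\<eta>. (\<Prod>i\<in>?A. node_weight H (\<eta> i)) *
      (\<Prod>e\<in>?SF. moment H (merge_on ?N (fst p) \<eta> ` e) (count (edges F) e))"
  have "(\<Sum>\<eta>\<in>?A \<rightarrow>\<^sub>E wnodes H. ?t \<eta>) = (\<Sum>\<xi>\<in>?B \<rightarrow>\<^sub>E wnodes H. ?t (restrict (\<lambda>x. \<xi> (h x)) ?A))"
    by (rule sum_PiE_reindex[OF bij])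
  also have "\<dots> = (\<Sum>\<xi>\<in>?B \<rightarrow>\<^sub>E wnodes H. (\<Prod>i\<in>?B. node_weight H (\<xi> i)) *
      (\<Prod>e\<in>?SG. moment H (merge_on ?N (fst p) \<xi> ` e) (count (edges G) e)))"
    unfolding w mo ..
  finally show ?thesis unfolding local_value_def pp by (rule arg_cong)
qed

lemma finite_local_states:
  assumes "randomly_weighted_graph H" "finite N"
  shows "finite (local_states H N)"
  using assms finite_weight_values[OF assms(1)] finite_pairs[OF assms(2)]
  by (auto simp: local_states_def randomly_weighted_graph_def intro!: finite_PiE)

lemma local_weight_nonneg:
  assumes "randomly_weighted_graph H" "p \<in> local_states H N"
  shows "local_weight H N p \<ge> 0"
proof -
  have "fst p i \<in> wnodes H" if "i \<in> N" for i using assms(2) that by (auto simp: local_states_def)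
  then show ?thesis
    using assms(1) unfolding local_weight_def
    by (intro mult_nonneg_nonneg prod_nonneg) (auto simp: randomly_weighted_graph_def mass_def)
qed

lemma local_value_no_labels:
  assumes H: "randomly_weighted_graph H" and F: "multigraph F"
  shows "local_value H {} F p = hom_rw F H"
proof -
  have E: "set_mset (edges F) \<subseteq> pairs (nodes F)" using F by (auto simp: multigraph_def pairs_def)
  have fin: "finite (nodes F)" using F by (simp add: multigraph_def)
  have m: "merge_on {} \<phi> \<xi> = \<xi>" for \<phi> \<xi> :: "nat \<Rightarrow> 'a" by (simp add: merge_on_def fun_eq_iff)
  have "(\<Prod>e\<in>pairs (nodes F). moment H (\<xi> ` e) (count (edges F) e)) =
      (\<Prod>e\<in>set_mset (edges F). moment H (\<xi> ` e) (count (edges F) e))" for \<xi>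
    using finite_pairs[OF fin] E
    by (rule prod.mono_neutral_right) (auto simp: not_in_iff moment_0[OF H])
  moreover have "pairs {} = {}" by (auto simp: pairs_def)
  ultimately show ?thesis
    by (simp add: local_value_def hom_rw_def m pairs_def[symmetric] moment_def[symmetric])
qed

text \<open>The gluing formula without labels: there is a single state, of weight
  \<open>1\<close>.\<close>

lemma hom_rw_disjoint_union:
  assumes H: "randomly_weighted_graph H" and "multigraph F" "multigraph G" "nodes F \<inter> nodes G = {}"
  shows "hom_rw (graph_union F G) H = hom_rw F H * hom_rw G H"
proof -
  have "pairs {} = {}" by (auto simp: pairs_def)
  then show ?thesis
    by (simp add: hom_rw_graph_union[OF assms] local_value_no_labels[OF H] assms local_states_def local_weight_def)
qed

definition type_local_value :: "('v, 'w) rwgraph \<Rightarrow> nat \<Rightarrow> mgraph set \<Rightarrow> (nat \<Rightarrow> 'v) \<times> (nat set \<Rightarrow> real) \<Rightarrow> real" where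
  "type_local_value H n A p = local_value H {1..n} (SOME F. labeled n F \<and> A = iso_type n F) p"

text \<open>The connection matrix as a Gram matrix: this gives both positivity and finite rank.\<close>

lemma connection_matrix_hom:
  assumes f: "graph_parameter f" and H: "randomly_weighted_graph H"
    and fH: "\<And>F. multigraph F \<Longrightarrow> f F = hom_rw F H"
    and A: "A \<in> labeled_types n" and B: "B \<in> labeled_types n"
  shows "type_value f (glue n A B) =
    (\<Sum>p\<in>local_states H {1..n}. local_weight H {1..n} p * type_local_value H n A p * type_local_value H n B p)"
proof -
  have ex: "\<exists>F. labeled n F \<and> C = iso_type n F" if "C \<in> labeled_types n" for C
    using that by (auto simp: labeled_types_def)
  define F where "F = (SOME F. labeled n F \<and> A = iso_type n F)"
  define G where "G = (SOME G. labeled n G \<and> B = iso_type n G)"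
  have F: "labeled n F" "A = iso_type n F" using someI_ex[OF ex[OF A]] by (simp_all add: F_def)
  have G: "labeled n G" "B = iso_type n G" using someI_ex[OF ex[OF B]] by (simp_all add: G_def)
  have "finite (nodes F)" using F by (simp add: labeled_def multigraph_def)
  \<comment> \<open>The gluing formula requires that exactly the labels be common, so the second
    representative is replaced by a disjoint copy.\<close>
  then obtain G' where G': "labeled n G'" "labeled_iso n G G'" "nodes G' \<inter> nodes F \<subseteq> {1..n}"
    using exists_disjoint_representative[OF G(1)] by blast
  have int: "nodes F \<inter> nodes G' = {1..n}" using G' F by (auto simp: labeled_def)
  have mg: "multigraph F" "multigraph G'" "multigraph (graph_union F G')"
    using F G' labeled_graph_union by (auto simp: labeled_def)
  have "B = iso_type n G'" using G G' iso_type_eq by blast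
  then have "type_value f (glue n A B) = f (graph_union F G')"
    using F type_value_glue[OF f F(1) G'(1) int] by simp
  also have "\<dots> = (\<Sum>p\<in>local_states H {1..n}. local_weight H {1..n} p * local_value H {1..n} F p * local_value H {1..n} G' p)"
    using fH[OF mg(3)] hom_rw_graph_union[OF H mg(1,2) int] by simp
  finally show ?thesis
    unfolding type_local_value_def F_def[symmetric] G_def[symmetric]
    using local_value_iso[OF G(1) G'(2), of H] by simp
qed

lemma reflection_positive_hom:
  assumes f: "graph_parameter f" and H: "randomly_weighted_graph H"
    and fH: "\<And>F. multigraph F \<Longrightarrow> f F = hom_rw F H"
  shows "reflection_positive f"
  unfolding reflection_positive_def
proof (intro allI impI)
  fix n :: nat and q :: quantum_graph assume q: "Poly_Mapping.keys q \<subseteq> labeled_types n"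
  let ?S = "local_states H {1..n}" and ?w = "local_weight H {1..n}" and ?X = "type_local_value H n"
  have "linear_extension f (quantum_mult n q q) =
      lin (\<lambda>A. lin (\<lambda>B. \<Sum>p\<in>?S. ?w p * ?X A p * ?X B p) q) q"
    unfolding linear_extension_quantum_mult
    by (intro lin_cong connection_matrix_hom[OF f H fH]) (use q in auto)
  also have "\<dots> = (\<Sum>A\<in>Poly_Mapping.keys q. \<Sum>B\<in>Poly_Mapping.keys q. \<Sum>p\<in>?S.
      ?w p * ((Poly_Mapping.lookup q A * ?X A p) * (Poly_Mapping.lookup q B * ?X B p)))"
    unfolding lin_def sum_distrib_left by (simp only: mult_ac)
  also have "\<dots> = (\<Sum>A\<in>Poly_Mapping.keys q. \<Sum>p\<in>?S. \<Sum>B\<in>Poly_Mapping.keys q.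
      ?w p * ((Poly_Mapping.lookup q A * ?X A p) * (Poly_Mapping.lookup q B * ?X B p)))"
    by (intro sum.cong refl sum.swap)
  also have "\<dots> = (\<Sum>p\<in>?S. \<Sum>A\<in>Poly_Mapping.keys q. \<Sum>B\<in>Poly_Mapping.keys q.
      ?w p * ((Poly_Mapping.lookup q A * ?X A p) * (Poly_Mapping.lookup q B * ?X B p)))"
    by (rule sum.swap)
  also have "\<dots> = (\<Sum>p\<in>?S. ?w p * (lin (\<lambda>A. ?X A p) q * lin (\<lambda>A. ?X A p) q))"
    by (simp only: lin_def sum_product) (simp only: sum_distrib_left)
  also have "\<dots> \<ge> 0"
    by (rule sum_nonneg, rule mult_nonneg_nonneg[OF local_weight_nonneg[OF H] zero_le_square])
  finally show "linear_extension f (quantum_mult n q q) \<ge> 0" .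
qed

text \<open>More rows than states have linearly dependent state vectors, and the Gram form transfers
  the dependence to the rows.\<close>

lemma connection_rank_hom:
  assumes f: "graph_parameter f" and H: "randomly_weighted_graph H"
    and fH: "\<And>F. multigraph F \<Longrightarrow> f F = hom_rw F H"
  shows "connection_rank f n < \<infinity>"
proof -
  let ?S = "local_states H {1..n}" and ?w = "local_weight H {1..n}" and ?X = "type_local_value H n"
  have fin: "finite ?S" using finite_local_states[OF H] by simp
  have "card R \<le> card ?S"
    if R: "finite R" "R \<subseteq> labeled_types n" "rows_independent (labeled_types n) (connection_matrix f n) R" for R
  proof (rule ccontr)
    assume "\<not> card R \<le> card ?S"
    then have "card ?S < card R" by simp
    from linear_dependence[OF fin R(1) this, of ?X]
    obtain c where c: "\<exists>A\<in>R. c A \<noteq> 0" "\<forall>p\<in>?S. (\<Sum>A\<in>R. c A * ?X A p) = 0" by blast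
    have "(\<Sum>A\<in>R. c A * connection_matrix f n A B) = 0" if B: "B \<in> labeled_types n" for B
    proof -
      have "(\<Sum>A\<in>R. c A * connection_matrix f n A B) = (\<Sum>A\<in>R. \<Sum>p\<in>?S. (?w p * ?X B p) * (c A * ?X A p))"
      proof (rule sum.cong[OF refl])
        fix A assume "A \<in> R"
        then have A: "A \<in> labeled_types n" using R(2) by blast
        have entry: "type_value f (glue n A B) = (\<Sum>p\<in>?S. ?w p * ?X A p * ?X B p)"
          by (rule connection_matrix_hom[OF f H _ A B]) (rule fH)
        show "c A * connection_matrix f n A B = (\<Sum>p\<in>?S. (?w p * ?X B p) * (c A * ?X A p))"
          unfolding connection_matrix_def entry sum_distrib_left
          by (simp only: mult_ac)
      qed
      also have "\<dots> = (\<Sum>p\<in>?S. (?w p * ?X B p) * (\<Sum>A\<in>R. c A * ?X A p))"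
        unfolding sum_distrib_left by (rule sum.swap)
      also have "\<dots> = 0" using c(2) by simp
      finally show ?thesis .
    qed
    then have "\<forall>A\<in>R. c A = 0" using R(3) unfolding rows_independent_def by blast
    then show False using c(1) by blast
  qed
  then have "connection_rank f n \<le> enat (card ?S)"
    unfolding connection_rank_def matrix_rank_def by (intro SUP_least) auto
  then show ?thesis using enat_ord_simps(4) order_le_less_trans by blast
qed

section \<open>The equivalence\<close>

lemma reflection_positive_imp_weakly: "reflection_positive f \<Longrightarrow> weakly_reflection_positive f"
proof -
  have "fully_labeled_types n \<subseteq> labeled_types n" for n
    by (auto simp: fully_labeled_types_def labeled_types_def)
  then show "reflection_positive f \<Longrightarrow> weakly_reflection_positive f"
    unfolding reflection_positive_def weakly_reflection_positive_def by blast
qed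

lemma ex_rwgraph_parameter:
  assumes f: "graph_parameter f" "weakly_reflection_positive f" "multiplicative f" "connection_rank f 2 < \<infinity>"
  shows "\<exists>H :: ('v::infinite, 'w::infinite) rwgraph.
    randomly_weighted_graph H \<and> (\<forall>F. multigraph F \<longrightarrow> f F = hom_rw F H)"
proof -
  interpret mult_parameter f using f by unfold_locales
  show ?thesis
  proof (cases "f (mg {0} {#}) = 0")
    case True
    have "f F = 0" if "multigraph F" for F using f_zero[OF f(2) True that] .
    then show ?thesis using ex_empty_rwgraph[where 'v = 'v and 'w = 'w] by auto
  next
    case False
    interpret nonzero_parameter f using False by unfold_locales
    interpret ef: edge_functional v using edge_functionalI[OF f(2,4)] .
    obtain k \<alpha> \<beta> where s: "sbm ef.colours k \<alpha> \<beta>" and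
      v: "\<And>U E. finite U \<Longrightarrow> \<forall>e\<in>#E. e \<subseteq> U \<and> card e = 2 \<Longrightarrow> v E = shom ef.colours k \<alpha> \<beta> U E"
      using ef.block_model by blast
    \<comment> \<open>Node weights scaled by \<open>k1\<close> restore the factor per node that was
      removed by normalisation; nonnegativity of \<open>k1\<close> makes them admissible.\<close>
    obtain H :: "('v, 'w) rwgraph" where H: "randomly_weighted_graph H"
      "\<And>F. multigraph F \<Longrightarrow> hom_rw F H = k1 ^ card (nodes F) * shom ef.colours k \<alpha> \<beta> (nodes F) (edges F)"
      using ex_rwgraph[OF ef.finite_colours s f_K1_nonneg[OF f(2)], where 'v = 'v and 'w = 'w] by blast
    have "f F = hom_rw F H" if F: "multigraph F" for F
    proof -
      have E: "\<forall>e\<in>#edges F. e \<subseteq> nodes F \<and> card e = 2" and N: "finite (nodes F)" "nodes F \<noteq> {}"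
        using F by (auto simp: multigraph_def)
      have sE: "simple (edges F) = edges F" using E by (intro simple_id) auto
      have verts: "verts (edges F) \<subseteq> nodes F" using E by blast
      have "f (mg (nodes F) (edges F)) = k1 ^ card (nodes F) * v (edges F)"
        using f_eq_edge_value[OF N, of "edges F"] verts unfolding sE by simp
      moreover have "mg (nodes F) (edges F) = F" by (cases F) simp
      ultimately show ?thesis using H(2)[OF F] v[OF N(1) E] by simp
    qed
    then show ?thesis using H(1) by blast
  qed
qed

(* The types 'v of nodes and 'w of sample points are arbitrary infinite types, so that they
   accommodate every finite node set and every finite probability space. *)
theorem theorem3p8:
  fixes f :: "mgraph \<Rightarrow> real"
  assumes "graph_parameter f"
  shows
    "((\<exists>H :: ('v::infinite, 'w::infinite) rwgraph.
         randomly_weighted_graph H \<and> (\<forall>F. multigraph F \<longrightarrow> f F = hom_rw F H))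
      \<longleftrightarrow> (reflection_positive f \<and> multiplicative f \<and> connection_rank f 2 < \<infinity>))
     \<and>
     ((reflection_positive f \<and> multiplicative f \<and> connection_rank f 2 < \<infinity>)
      \<longleftrightarrow> (weakly_reflection_positive f \<and> multiplicative f \<and> connection_rank f 2 < \<infinity>))"
  (is "(?hom \<longleftrightarrow> ?rp) \<and> (?rp \<longleftrightarrow> ?wrp)")
proof -
  have "?rp" if h: "?hom"
  proof -
    obtain H :: "('v, 'w) rwgraph" where H: "randomly_weighted_graph H"
      and fH: "\<And>F. multigraph F \<Longrightarrow> f F = hom_rw F H"
      using h by blast
    have "multiplicative f"
      unfolding multiplicative_def
    proof (intro allI impI, elim conjE)
      fix F G assume FG: "multigraph F" "multigraph G" "nodes F \<inter> nodes G = {}"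
      then have "multigraph (graph_union F G)" by (auto simp: multigraph_def graph_union_def)
      then show "f (graph_union F G) = f F * f G"
        using hom_rw_disjoint_union[OF H FG] fH FG by simp
    qed
    then show ?thesis
      using reflection_positive_hom[OF assms H fH] connection_rank_hom[OF assms H fH] by simp
  qed
  moreover have "?wrp" if "?rp" using that reflection_positive_imp_weakly by blast
  moreover have "?hom" if "?wrp" using that ex_rwgraph_parameter[OF assms] by blast
  ultimately show ?thesis by blast
qed

end
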